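(* Let $0\le M<1/2$ and let $\mathbb{D}$ be the symmetric operator in $L^2((-\pi/2,\pi/2),\mathbb{C}^2)$ with domain $C_c^\infty((-\pi/2,\pi/2),\mathbb{C}^2)$ given by $$\mathbb{D}=\begin{pmatrix}0&-\frac{d}{d\rho}+M\sec\rho\\ \frac{d}{d\rho}+M\sec\rho&0\end{pmatrix}.$$ For a $2\times2$ unitary matrix $U$, let $\mathbb{D}_U$ be the restriction of $\mathbb{D}^\dagger$ to those $\Phi=(\Phi^{(1)},\Phi^{(2)})^T\in\mathrm{Dom}(\mathbb{D}^\dagger)$ satisfying the boundary condition $$(\mathbb{I}-U)\begin{pmatrix}\widetilde{\Phi^{(2)}}(\pi/2)\\ \widetilde{\Phi^{(2)}}(-\pi/2)\end{pmatrix}=i(\mathbb{I}+U)\begin{pmatrix}\widetilde{\Phi^{(1)}}(\pi/2)\\ -\widetilde{\Phi^{(1)}}(-\pi/2)\end{pmatrix}.$$ Then each $\mathbb{D}_U$ is a self-adjoint extension of $\mathbb{D}$, and $U\mapsto\mathbb{D}_U$ is a one-to-one correspondence between the $2\times 2$ unitary matrices and the self-adjoint extensions of $\mathbb{D}$.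
   Context: The Hilbert space carries the inner product $\langle\Phi,\Phi'\rangle=\int_{-\pi/2}^{\pi/2}\Phi^\dagger\Phi'\,d\rho$, and $\mathbb{D}^\dagger$ is the adjoint of $\mathbb{D}$. Put $\sigma(\rho)=\left(\frac{1-\sin\rho}{1+\sin\rho}\right)^{1/2}$. For $\Phi=(\Phi^{(1)},\Phi^{(2)})^T\in\mathrm{Dom}(\mathbb{D}^\dagger)$ the weighted components are $\widetilde{\Phi^{(1)}}=\sigma^{-M}\Phi^{(1)}$ and $\widetilde{\Phi^{(2)}}=\sigma^{M}\Phi^{(2)}$; their values at $\rho=\pm\pi/2$ are understood as limits $\rho\to\pm\pi/2$ from inside the interval (these limits exist for $0\le M<1/2$). *)

theory Defs
  imports "HOL-Analysis.Analysis"
begin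

abbreviation I0 :: "real set" where
  "I0 \<equiv> {-(pi / 2)<..<pi / 2}"

definition hdot :: "complex ^ 'n \<Rightarrow> complex ^ 'n \<Rightarrow> complex" where
  "hdot u v = (\<Sum>i\<in>UNIV. cnj (u $ i) * v $ i)"

definition sq_integrable :: "(real \<Rightarrow> complex ^ 2) \<Rightarrow> bool" where
  "sq_integrable f \<longleftrightarrow> f \<in> borel_measurable (lebesgue_on I0) \<and>
     integrable (lebesgue_on I0) (\<lambda>x. (norm (f x))\<^sup>2)"

definition L2_rel :: "(real \<Rightarrow> complex ^ 2) \<Rightarrow> (real \<Rightarrow> complex ^ 2) \<Rightarrow> bool" where
  "L2_rel f g \<longleftrightarrow> sq_integrable f \<and> sq_integrable g \<and> (AE x in lebesgue_on I0. f x = g x)"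

lemma hdot_bound: "cmod (hdot u v) \<le> norm u * norm v"
proof -
  have "cmod (hdot u v) \<le> (\<Sum>i\<in>UNIV. \<bar>norm (u $ i)\<bar> * \<bar>norm (v $ i)\<bar>)"
    unfolding hdot_def by (rule sum_norm_le) (simp add: norm_mult)
  also have "\<dots> \<le> L2_set (\<lambda>i. norm (u $ i)) UNIV * L2_set (\<lambda>i. norm (v $ i)) UNIV"
    by (rule L2_set_mult_ineq)
  finally show ?thesis by (simp add: norm_vec_def)
qed

lemma hdot_self: "hdot u u = of_real ((norm u)\<^sup>2)"
  by (simp add: hdot_def norm_vec_def L2_set_def sum_nonneg real_sqrt_pow2
      complex_norm_square mult.commute del: of_real_power)

lemma sq_integrable_scaleR: "sq_integrable f \<Longrightarrow> sq_integrable (\<lambda>x. r *\<^sub>R f x)"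
  by (auto simp: sq_integrable_def power_mult_distrib)

lemma borel_measurable_vec_nth:
  "f \<in> borel_measurable M \<Longrightarrow> (\<lambda>x. f x $ i) \<in> borel_measurable M"
  for f :: "'a \<Rightarrow> complex ^ 2"
  by (rule borel_measurable_continuous_on[where f="\<lambda>v. v $ i"])
    (auto intro!: continuous_intros)

lemma borel_measurable_csmult:
  "f \<in> borel_measurable M \<Longrightarrow> (\<lambda>x. c *s f x) \<in> borel_measurable M"
  for f :: "'a \<Rightarrow> complex ^ 2"
  by (rule borel_measurable_continuous_on[where f="\<lambda>v. c *s v"])
    (auto simp: vector_scalar_mult_def intro!: continuous_intros)

lemma norm_csmult: "norm (c *s v) = cmod c * norm v" for v :: "complex ^ 'n"
  by (simp add: norm_vec_def norm_mult L2_set_right_distrib)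

lemma sq_integrable_csmult: "sq_integrable f \<Longrightarrow> sq_integrable (\<lambda>x. c *s f x)"
  by (auto simp: sq_integrable_def power_mult_distrib norm_csmult borel_measurable_csmult)

lemma sq_integrable_add:
  assumes "sq_integrable f" "sq_integrable g"
  shows "sq_integrable (\<lambda>x. f x + g x)"
proof -
  have fm: "f \<in> borel_measurable (lebesgue_on I0)" "g \<in> borel_measurable (lebesgue_on I0)"
    and fi: "integrable (lebesgue_on I0) (\<lambda>x. (norm (f x))\<^sup>2)"
      "integrable (lebesgue_on I0) (\<lambda>x. (norm (g x))\<^sup>2)"
    using assms by (auto simp: sq_integrable_def)
  have "integrable (lebesgue_on I0) (\<lambda>x. (norm (f x + g x))\<^sup>2)"
  proof (rule Bochner_Integration.integrable_bound)
    show "integrable (lebesgue_on I0) (\<lambda>x. 2 * (norm (f x))\<^sup>2 + 2 * (norm (g x))\<^sup>2)"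
      using fi by simp
    show "(\<lambda>x. (norm (f x + g x))\<^sup>2) \<in> borel_measurable (lebesgue_on I0)"
      using fm by measurable
    have "(norm (f x + g x))\<^sup>2 \<le> 2 * (norm (f x))\<^sup>2 + 2 * (norm (g x))\<^sup>2" for x
    proof -
      have "(norm (f x + g x))\<^sup>2 \<le> (norm (f x) + norm (g x))\<^sup>2"
        by (simp add: norm_triangle_ineq power_mono)
      also have "\<dots> \<le> 2 * (norm (f x))\<^sup>2 + 2 * (norm (g x))\<^sup>2"
        using zero_le_power2[of "norm (f x) - norm (g x)"]
        by (simp add: power2_eq_square algebra_simps)
      finally show ?thesis .
    qed
    then show "AE x in lebesgue_on I0. norm ((norm (f x + g x))\<^sup>2)
        \<le> norm (2 * (norm (f x))\<^sup>2 + 2 * (norm (g x))\<^sup>2)"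
      by simp
  qed
  with fm show ?thesis by (auto simp: sq_integrable_def)
qed

lemma integrable_hdot:
  assumes "sq_integrable f" "sq_integrable g"
  shows "integrable (lebesgue_on I0) (\<lambda>x. hdot (f x) (g x))"
proof (rule Bochner_Integration.integrable_bound)
  have fm: "f \<in> borel_measurable (lebesgue_on I0)" "g \<in> borel_measurable (lebesgue_on I0)"
    and fi: "integrable (lebesgue_on I0) (\<lambda>x. (norm (f x))\<^sup>2)"
      "integrable (lebesgue_on I0) (\<lambda>x. (norm (g x))\<^sup>2)"
    using assms by (auto simp: sq_integrable_def)
  show "integrable (lebesgue_on I0) (\<lambda>x. (norm (f x))\<^sup>2 + (norm (g x))\<^sup>2)"
    using fi by simp
  have cnjm: "(\<lambda>x. cnj (f x $ i)) \<in> borel_measurable (lebesgue_on I0)" for i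
    by (rule borel_measurable_continuous_on[where f=cnj, OF _ borel_measurable_vec_nth[OF fm(1)]])
      (auto intro!: continuous_intros)
  show "(\<lambda>x. hdot (f x) (g x)) \<in> borel_measurable (lebesgue_on I0)"
    unfolding hdot_def
    by (intro borel_measurable_sum borel_measurable_times cnjm borel_measurable_vec_nth fm)
  have "norm (f x) * norm (g x) \<le> (norm (f x))\<^sup>2 + (norm (g x))\<^sup>2" for x
  proof -
    have "2 * (norm (f x) * norm (g x)) \<le> (norm (f x))\<^sup>2 + (norm (g x))\<^sup>2"
      using zero_le_power2[of "norm (f x) - norm (g x)"]
      by (simp add: power2_eq_square algebra_simps)
    moreover have "0 \<le> norm (f x) * norm (g x)" by simp
    ultimately show ?thesis by linarith
  qed
  then have "cmod (hdot (f x) (g x)) \<le> (norm (f x))\<^sup>2 + (norm (g x))\<^sup>2" for x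
    using hdot_bound order_trans by blast
  then show "AE x in lebesgue_on I0. norm (hdot (f x) (g x))
      \<le> norm ((norm (f x))\<^sup>2 + (norm (g x))\<^sup>2)"
    by simp
qed

quotient_type spinorL2 = "real \<Rightarrow> complex ^ 2" / partial: L2_rel
proof (rule part_equivpI)
  show "\<exists>x. L2_rel x x"
    by (rule exI[of _ "\<lambda>_. 0"]) (simp add: L2_rel_def sq_integrable_def)
  show "symp L2_rel"
    by (rule sympI) (auto simp: L2_rel_def elim: AE_mp)
  show "transp L2_rel"
    by (rule transpI) (auto simp: L2_rel_def elim: AE_mp)
qed

lift_definition cinner :: "spinorL2 \<Rightarrow> spinorL2 \<Rightarrow> complex"
  is "\<lambda>f g. LINT \<rho>|lebesgue_on I0. hdot (f \<rho>) (g \<rho>)"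
proof -
  fix f f' g g' assume "L2_rel f f'" "L2_rel g g'"
  then have *: "sq_integrable f" "sq_integrable g" "sq_integrable f'" "sq_integrable g'"
     "AE x in lebesgue_on I0. f x = f' x" "AE x in lebesgue_on I0. g x = g' x"
    by (auto simp: L2_rel_def)
  show "(LINT \<rho>|lebesgue_on I0. hdot (f \<rho>) (g \<rho>)) = (LINT \<rho>|lebesgue_on I0. hdot (f' \<rho>) (g' \<rho>))"
  proof (rule integral_cong_AE)
    show "AE x in lebesgue_on I0. hdot (f x) (g x) = hdot (f' x) (g' x)"
      using *(5,6) by eventually_elim simp
  qed (use * integrable_hdot in \<open>auto intro: borel_measurable_integrable\<close>)
qed

lift_definition cscale :: "complex \<Rightarrow> spinorL2 \<Rightarrow> spinorL2" (infixr "*\<^sub>C" 75)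
  is "\<lambda>c f \<rho>. c *s f \<rho>"
  by (auto simp: L2_rel_def sq_integrable_csmult elim: AE_mp)

text \<open>Viewed as a real inner product space with inner product \<open>Re (cinner \<Phi> \<Psi>)\<close>, the space
  inherits the norm and topology belonging to \<open>cinner\<close>.\<close>

instantiation spinorL2 :: real_inner
begin

lift_definition zero_spinorL2 :: spinorL2 is "\<lambda>_. 0"
  by (simp add: L2_rel_def sq_integrable_def)

lift_definition plus_spinorL2 :: "spinorL2 \<Rightarrow> spinorL2 \<Rightarrow> spinorL2"
  is "\<lambda>f g \<rho>. f \<rho> + g \<rho>"
  by (auto simp: L2_rel_def sq_integrable_add elim: AE_mp)

lift_definition scaleR_spinorL2 :: "real \<Rightarrow> spinorL2 \<Rightarrow> spinorL2"
  is "\<lambda>r f \<rho>. r *\<^sub>R f \<rho>"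
  by (auto simp: L2_rel_def sq_integrable_scaleR elim: AE_mp)

definition uminus_spinorL2 :: "spinorL2 \<Rightarrow> spinorL2" where
  "uminus_spinorL2 \<Phi> = (-1) *\<^sub>R \<Phi>"

definition minus_spinorL2 :: "spinorL2 \<Rightarrow> spinorL2 \<Rightarrow> spinorL2" where
  "minus_spinorL2 \<Phi> \<Psi> = \<Phi> + (- \<Psi>)"

definition inner_spinorL2 :: "spinorL2 \<Rightarrow> spinorL2 \<Rightarrow> real" where
  "inner_spinorL2 \<Phi> \<Psi> = Re (cinner \<Phi> \<Psi>)"

definition norm_spinorL2 :: "spinorL2 \<Rightarrow> real" where
  "norm_spinorL2 \<Phi> = sqrt (inner \<Phi> \<Phi>)"

definition dist_spinorL2 :: "spinorL2 \<Rightarrow> spinorL2 \<Rightarrow> real" where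
  "dist_spinorL2 \<Phi> \<Psi> = norm (\<Phi> - \<Psi>)"

definition sgn_spinorL2 :: "spinorL2 \<Rightarrow> spinorL2" where
  "sgn_spinorL2 \<Phi> = inverse (norm \<Phi>) *\<^sub>R \<Phi>"

definition uniformity_spinorL2 :: "(spinorL2 \<times> spinorL2) filter" where
  "uniformity_spinorL2 = (INF e\<in>{0<..}. principal {(x, y). dist x y < e})"

definition open_spinorL2 :: "spinorL2 set \<Rightarrow> bool" where
  "open_spinorL2 S = (\<forall>x\<in>S. \<forall>\<^sub>F (x', y) in uniformity. x' = x \<longrightarrow> y \<in> S)"

instance
proof
  fix a b c :: spinorL2 and r s :: real
  show "a + b + c = a + (b + c)"
    by transfer (auto simp: L2_rel_def sq_integrable_add add.assoc)
  show "a + b = b + a"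
    by transfer (auto simp: L2_rel_def sq_integrable_add add.commute)
  show "0 + a = a"
    by transfer (auto simp: L2_rel_def)
  show "- a + a = 0"
    unfolding uminus_spinorL2_def
    by transfer (auto simp: L2_rel_def sq_integrable_def)
  show "a - b = a + - b" by (fact minus_spinorL2_def)
  show "r *\<^sub>R (a + b) = r *\<^sub>R a + r *\<^sub>R b"
    by transfer (auto simp: L2_rel_def sq_integrable_add sq_integrable_scaleR scaleR_right_distrib)
  show "(r + s) *\<^sub>R a = r *\<^sub>R a + s *\<^sub>R a"
    by transfer (auto simp: L2_rel_def sq_integrable_add sq_integrable_scaleR scaleR_left_distrib)
  show "r *\<^sub>R s *\<^sub>R a = (r * s) *\<^sub>R a"
    by transfer (auto simp: L2_rel_def sq_integrable_scaleR)
  show "1 *\<^sub>R a = a"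
    by transfer (auto simp: L2_rel_def)
  show "sgn a = inverse (norm a) *\<^sub>R a" by (fact sgn_spinorL2_def)
  show "dist a b = norm (a - b)" by (fact dist_spinorL2_def)
  show "uniformity = (INF e\<in>{0<..}. principal {(x::spinorL2, y). dist x y < e})"
    by (fact uniformity_spinorL2_def)
  show "open U = (\<forall>x\<in>U. \<forall>\<^sub>F (x', y) in uniformity. x' = x \<longrightarrow> y \<in> U)" for U :: "spinorL2 set"
    by (fact open_spinorL2_def)
  have cnj: "cinner b a = cnj (cinner a b)"
  proof (transfer)
    fix f g :: "real \<Rightarrow> complex ^ 2"
    have "hdot (g x) (f x) = cnj (hdot (f x) (g x))" for x
      by (simp add: hdot_def mult.commute)
    then show "(LINT \<rho>|lebesgue_on I0. hdot (g \<rho>) (f \<rho>)) =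
        cnj (LINT \<rho>|lebesgue_on I0. hdot (f \<rho>) (g \<rho>))"
      by (simp only: Bochner_Integration.integral_cnj)
  qed
  show "inner a b = inner b a" by (simp add: inner_spinorL2_def cnj)
  have "cinner (a + b) c = cinner a c + cinner b c"
  proof (transfer)
    fix f g h :: "real \<Rightarrow> complex ^ 2" assume "L2_rel f f" "L2_rel g g" "L2_rel h h"
    then have *: "sq_integrable f" "sq_integrable g" "sq_integrable h" by (auto simp: L2_rel_def)
    have "hdot (u + v) w = hdot u w + hdot v w" for u v w :: "complex ^ 2"
      by (simp add: hdot_def distrib_right sum.distrib)
    then show "(LINT \<rho>|lebesgue_on I0. hdot (f \<rho> + g \<rho>) (h \<rho>)) =
      (LINT \<rho>|lebesgue_on I0. hdot (f \<rho>) (h \<rho>)) + (LINT \<rho>|lebesgue_on I0. hdot (g \<rho>) (h \<rho>))"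
      by (simp add: integrable_hdot *)
  qed
  then show "inner (a + b) c = inner a c + inner b c" by (simp add: inner_spinorL2_def)
  have "cinner (r *\<^sub>R a) b = of_real r * cinner a b"
  proof (transfer)
    fix f g :: "real \<Rightarrow> complex ^ 2" and r :: real
    have "hdot (r *\<^sub>R u) w = of_real r * hdot u w" for u w :: "complex ^ 2"
      by (simp add: hdot_def sum_distrib_left scaleR_conv_of_real[where 'a=complex] mult.assoc)
    then show "(LINT \<rho>|lebesgue_on I0. hdot (r *\<^sub>R f \<rho>) (g \<rho>)) =
        of_real r * (LINT \<rho>|lebesgue_on I0. hdot (f \<rho>) (g \<rho>))"
      by simp
  qed
  then show "inner (r *\<^sub>R a) b = r * inner a b" by (simp add: inner_spinorL2_def)
  have self: "inner a a \<ge> 0 \<and> (inner a a = 0 \<longleftrightarrow> a = 0)"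
    unfolding inner_spinorL2_def
  proof (transfer)
    fix f :: "real \<Rightarrow> complex ^ 2" assume "L2_rel f f"
    then have f: "sq_integrable f" by (simp add: L2_rel_def)
    then have fi: "integrable (lebesgue_on I0) (\<lambda>x. (norm (f x))\<^sup>2)"
      by (simp add: sq_integrable_def)
    have eq: "Re (LINT \<rho>|lebesgue_on I0. hdot (f \<rho>) (f \<rho>)) =
        (LINT \<rho>|lebesgue_on I0. (norm (f \<rho>))\<^sup>2)"
      unfolding hdot_self integral_complex_of_real by simp
    have "(LINT \<rho>|lebesgue_on I0. (norm (f \<rho>))\<^sup>2) = 0 \<longleftrightarrow> (AE x in lebesgue_on I0. f x = 0)"
      using integral_nonneg_eq_0_iff_AE[OF fi] by simp
    then show "0 \<le> Re (LINT \<rho>|lebesgue_on I0. hdot (f \<rho>) (f \<rho>)) \<and>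
        (Re (LINT \<rho>|lebesgue_on I0. hdot (f \<rho>) (f \<rho>)) = 0 \<longleftrightarrow> L2_rel f (\<lambda>_. 0))"
      unfolding eq using f by (simp add: L2_rel_def) (simp add: sq_integrable_def)
  qed
  then show "0 \<le> inner a a" "inner a a = 0 \<longleftrightarrow> a = 0" by auto
  show "norm a = sqrt (inner a a)" by (fact norm_spinorL2_def)
qed

end

text \<open>An operator is a partial map; \<open>dom T\<close> is its domain, \<open>T \<subseteq>\<^sub>m S\<close> says that \<open>S\<close> extends
  \<open>T\<close>, and \<open>T |` A\<close> is the restriction of \<open>T\<close> to \<open>A\<close>.\<close>

type_synonym operator = "spinorL2 \<rightharpoonup> spinorL2"

definition linear_operator :: "operator \<Rightarrow> bool" where
  "linear_operator T \<longleftrightarrow> T 0 = Some 0 \<and>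
     (\<forall>\<Phi> \<Psi> \<Phi>' \<Psi>'. T \<Phi> = Some \<Phi>' \<longrightarrow> T \<Psi> = Some \<Psi>' \<longrightarrow> T (\<Phi> + \<Psi>) = Some (\<Phi>' + \<Psi>')) \<and>
     (\<forall>c \<Phi> \<Phi>'. T \<Phi> = Some \<Phi>' \<longrightarrow> T (c *\<^sub>C \<Phi>) = Some (c *\<^sub>C \<Phi>'))"

definition densely_defined :: "operator \<Rightarrow> bool" where
  "densely_defined T \<longleftrightarrow> closure (dom T) = UNIV"

definition is_adjoint_value :: "operator \<Rightarrow> spinorL2 \<Rightarrow> spinorL2 \<Rightarrow> bool" where
  "is_adjoint_value T \<Phi> \<Psi> \<longleftrightarrow> (\<forall>\<xi>\<in>dom T. cinner \<Phi> (the (T \<xi>)) = cinner \<Psi> \<xi>)"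

text \<open>For densely defined \<open>T\<close> the vector \<open>\<Psi>\<close> below is unique.\<close>

definition op_adjoint :: "operator \<Rightarrow> operator" where
  "op_adjoint T = (\<lambda>\<Phi>. if \<exists>\<Psi>. is_adjoint_value T \<Phi> \<Psi>
                        then Some (THE \<Psi>. is_adjoint_value T \<Phi> \<Psi>) else None)"

definition self_adjoint :: "operator \<Rightarrow> bool" where
  "self_adjoint T \<longleftrightarrow> linear_operator T \<and> densely_defined T \<and> op_adjoint T = T"

definition smooth :: "(real \<Rightarrow> complex ^ 2) \<Rightarrow> bool" where
  "smooth f \<longleftrightarrow> (\<forall>n x. ((\<lambda>g t. vector_derivative g (at t)) ^^ n) f differentiable at x)"

text \<open>Functions in \<open>C_c^\<infinity>(I0, \<complex>\<^sup>2)\<close>, extended by zero to the real line.\<close>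

definition test_functions :: "(real \<Rightarrow> complex ^ 2) set" where
  "test_functions = {\<phi>. smooth \<phi> \<and> compact (closure {\<rho>. \<phi> \<rho> \<noteq> 0}) \<and>
                        closure {\<rho>. \<phi> \<rho> \<noteq> 0} \<subseteq> I0}"

definition dirac_expr :: "real \<Rightarrow> (real \<Rightarrow> complex ^ 2) \<Rightarrow> real \<Rightarrow> complex ^ 2" where
  "dirac_expr M \<phi> \<rho> = (let \<phi>' = vector_derivative \<phi> (at \<rho>) in
     vector [- \<phi>' $ 2 + of_real (M / cos \<rho>) * \<phi> \<rho> $ 2,
             \<phi>' $ 1 + of_real (M / cos \<rho>) * \<phi> \<rho> $ 1])"

text \<open>\<open>abs_spinorL2\<close> maps a square-integrable function to its class. It is injective on test
  functions, so \<open>inv_into\<close> recovers the test function; see \<open>dirac_abs\<close> below.\<close>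

definition dirac :: "real \<Rightarrow> operator" where
  "dirac M = (\<lambda>\<Phi>. if \<Phi> \<in> abs_spinorL2 ` test_functions
                 then Some (abs_spinorL2 (dirac_expr M (inv_into test_functions abs_spinorL2 \<Phi>)))
                 else None)"

definition \<sigma> :: "real \<Rightarrow> real" where
  "\<sigma> \<rho> = sqrt ((1 - sin \<rho>) / (1 + sin \<rho>))"

definition continuous_rep :: "spinorL2 \<Rightarrow> (real \<Rightarrow> complex ^ 2) \<Rightarrow> bool" where
  "continuous_rep \<Phi> \<phi> \<longleftrightarrow> sq_integrable \<phi> \<and> abs_spinorL2 \<phi> = \<Phi> \<and> continuous_on I0 \<phi>"

definition weighted1 :: "real \<Rightarrow> (real \<Rightarrow> complex ^ 2) \<Rightarrow> real \<Rightarrow> complex" where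
  "weighted1 M \<phi> \<rho> = of_real (\<sigma> \<rho> powr (- M)) * \<phi> \<rho> $ 1"

definition weighted2 :: "real \<Rightarrow> (real \<Rightarrow> complex ^ 2) \<Rightarrow> real \<Rightarrow> complex" where
  "weighted2 M \<phi> \<rho> = of_real (\<sigma> \<rho> powr M) * \<phi> \<rho> $ 2"

text \<open>Pointwise limits of a class are those of its continuous representative, which is unique on
  \<open>I0\<close>; \<open>p\<close> and \<open>m\<close> mark the limits at \<open>pi/2\<close> and \<open>-pi/2\<close>.\<close>

definition boundary_condition :: "real \<Rightarrow> complex ^ 2 ^ 2 \<Rightarrow> spinorL2 \<Rightarrow> bool" where
  "boundary_condition M U \<Phi> \<longleftrightarrow>
     (\<exists>\<phi> p1 m1 p2 m2. continuous_rep \<Phi> \<phi> \<and>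
        (weighted1 M \<phi> \<longlongrightarrow> p1) (at_left (pi / 2)) \<and>
        (weighted1 M \<phi> \<longlongrightarrow> m1) (at_right (-(pi / 2))) \<and>
        (weighted2 M \<phi> \<longlongrightarrow> p2) (at_left (pi / 2)) \<and>
        (weighted2 M \<phi> \<longlongrightarrow> m2) (at_right (-(pi / 2))) \<and>
        (mat 1 - U) *v vector [p2, m2] = \<i> *s ((mat 1 + U) *v vector [p1, - m1]))"

definition dirac_ext :: "real \<Rightarrow> complex ^ 2 ^ 2 \<Rightarrow> operator" where
  "dirac_ext M U = op_adjoint (dirac M) |` {\<Phi>. boundary_condition M U \<Phi>}"

definition unitary :: "complex ^ 'n ^ 'n \<Rightarrow> bool" where
  "unitary U \<longleftrightarrow> (let Ud = (\<chi> i j. cnj (U $ j $ i)) in Ud ** U = mat 1 \<and> U ** Ud = mat 1)"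

lemma test_functions_continuous: "\<phi> \<in> test_functions \<Longrightarrow> continuous_on UNIV \<phi>"
proof -
  assume "\<phi> \<in> test_functions"
  then have "\<forall>x. \<phi> differentiable at x"
    unfolding test_functions_def smooth_def by (auto dest: spec[of _ 0])
  then show ?thesis
    by (simp add: continuous_on_eq_continuous_at differentiable_imp_continuous_within)
qed

lemma test_functions_derivative_continuous:
  "\<phi> \<in> test_functions \<Longrightarrow> continuous_on UNIV (\<lambda>t. vector_derivative \<phi> (at t))"
proof -
  assume "\<phi> \<in> test_functions"
  then have "\<forall>x. (\<lambda>t. vector_derivative \<phi> (at t)) differentiable at x"
    unfolding test_functions_def smooth_def by (auto dest: spec[of _ 1])
  then show ?thesis
    by (simp add: continuous_on_eq_continuous_at differentiable_imp_continuous_within)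
qed

lemma sq_integrable_compact_support:
  assumes cont: "continuous_on I0 f" and K: "compact K" "K \<subseteq> I0"
    and supp: "\<And>x. x \<notin> K \<Longrightarrow> f x = 0"
  shows "sq_integrable f"
proof -
  have meas: "f \<in> borel_measurable (lebesgue_on I0)"
    by (rule continuous_imp_measurable_on_sets_lebesgue[OF cont]) simp
  have "compact (f ` K)"
    using K cont continuous_on_subset compact_continuous_image by blast
  then obtain B where B: "\<And>x. x \<in> K \<Longrightarrow> norm (f x) \<le> B"
    by (metis compact_imp_bounded bounded_iff imageI)
  have B': "norm (f x) \<le> \<bar>B\<bar>" for x
    using B[of x] supp[of x] by (cases "x \<in> K") auto
  have "integrable (lebesgue_on I0) (\<lambda>x. (norm (f x))\<^sup>2)"
  proof (rule Bochner_Integration.integrable_bound)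
    show "integrable (lebesgue_on I0) (\<lambda>x. B\<^sup>2)"
      by (intro finite_measure.integrable_const finite_measure_lebesgue_on) simp
    show "(\<lambda>x. (norm (f x))\<^sup>2) \<in> borel_measurable (lebesgue_on I0)"
      using meas by measurable
    show "AE x in lebesgue_on I0. norm ((norm (f x))\<^sup>2) \<le> norm (B\<^sup>2)"
      using power_mono[OF B' norm_ge_zero, of _ 2] by simp
  qed
  with meas show ?thesis by (simp add: sq_integrable_def)
qed

lemma test_functions_sq_integrable: "\<phi> \<in> test_functions \<Longrightarrow> sq_integrable \<phi>"
  by (rule sq_integrable_compact_support[where K="closure {\<rho>. \<phi> \<rho> \<noteq> 0}"])
    (use test_functions_continuous closure_subset[of "{\<rho>. \<phi> \<rho> \<noteq> 0}"] in
      \<open>auto simp: test_functions_def intro: continuous_on_subset\<close>)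

lemma dirac_expr_sq_integrable:
  assumes \<phi>: "\<phi> \<in> test_functions"
  shows "sq_integrable (dirac_expr M \<phi>)"
proof (rule sq_integrable_compact_support[where K="closure {\<rho>. \<phi> \<rho> \<noteq> 0}"])
  show "compact (closure {\<rho>. \<phi> \<rho> \<noteq> 0})" "closure {\<rho>. \<phi> \<rho> \<noteq> 0} \<subseteq> I0"
    using \<phi> by (auto simp: test_functions_def)
  have c: "continuous_on I0 \<phi>" "continuous_on I0 (\<lambda>t. vector_derivative \<phi> (at t))"
    using test_functions_continuous[OF \<phi>] test_functions_derivative_continuous[OF \<phi>]
    by (auto intro: continuous_on_subset)
  have cos: "\<forall>x\<in>I0. cos x \<noteq> 0"
    using cos_gt_zero_pi by fastforce
  have "continuous_on I0 (\<lambda>\<rho>. dirac_expr M \<phi> \<rho> $ 1)"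
    using c cos by (simp add: dirac_expr_def Let_def) (intro continuous_intros; simp)
  moreover have "continuous_on I0 (\<lambda>\<rho>. dirac_expr M \<phi> \<rho> $ 2)"
    using c cos by (simp add: dirac_expr_def Let_def) (intro continuous_intros; simp)
  ultimately have "continuous_on I0 (\<lambda>\<rho>. dirac_expr M \<phi> \<rho> $ i)" for i
    using exhaust_2[of i] by auto
  then show "continuous_on I0 (dirac_expr M \<phi>)"
    using continuous_on_vec_lambda[of I0 "\<lambda>i \<rho>. dirac_expr M \<phi> \<rho> $ i"] by simp
  fix x assume x: "x \<notin> closure {\<rho>. \<phi> \<rho> \<noteq> 0}"
  have zero: "\<phi> y = 0" if "y \<notin> closure {\<rho>. \<phi> \<rho> \<noteq> 0}" for y
    using that closure_subset[of "{\<rho>. \<phi> \<rho> \<noteq> 0}"] by blast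
  have "open (- closure {\<rho>. \<phi> \<rho> \<noteq> 0})" by (rule open_Compl) (rule closed_closure)
  then have "(\<phi> has_vector_derivative 0) (at x)"
    by (rule has_vector_derivative_transform_within_open[OF has_vector_derivative_const])
      (unfold Compl_iff, rule x, rule zero[symmetric])
  then have "vector_derivative \<phi> (at x) = 0" by (rule vector_derivative_at)
  moreover have "\<phi> x = 0" using x by (rule zero)
  ultimately show "dirac_expr M \<phi> x = 0"
    by (simp add: dirac_expr_def vec_eq_iff forall_2)
qed

lemma abs_spinorL2_eq_iff:
  "sq_integrable f \<Longrightarrow> sq_integrable g \<Longrightarrow>
     abs_spinorL2 f = abs_spinorL2 g \<longleftrightarrow> (AE x in lebesgue_on I0. f x = g x)"
  using Quotient3_rel[OF Quotient3_spinorL2, of f g] unfolding L2_rel_def by auto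

lemma continuous_rep_unique:
  assumes "continuous_rep \<Phi> f" "continuous_rep \<Phi> g" "x \<in> I0"
  shows "f x = g x"
proof -
  have c: "continuous_on I0 (\<lambda>x. f x - g x)" and "AE x in lebesgue_on I0. f x = g x"
    using assms abs_spinorL2_eq_iff[of f g]
    by (auto simp: continuous_rep_def intro!: continuous_intros)
  then have ae: "AE x in lebesgue. x \<in> I0 \<longrightarrow> f x = g x"
    by (simp add: AE_restrict_space_iff)
  obtain F where F: "closed F" "{x\<in>I0. f x - g x = 0} = I0 \<inter> F"
    using continuous_closedin_preimage_constant[OF c, of 0] by (auto simp: closedin_closed)
  have "AE x\<in>I0 in lebesgue. x \<in> F"
    using ae F(2) by (auto elim!: AE_mp)
  then have "x \<in> F"
    using mem_closed_if_AE_lebesgue_open[of I0 F x] F(1) assms(3) by auto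
  then have "x \<in> {x\<in>I0. f x - g x = 0}" unfolding F(2) using assms(3) by (rule IntI[rotated])
  then show ?thesis by simp
qed

lemma inj_on_test_functions: "inj_on abs_spinorL2 test_functions"
proof (rule inj_onI, rule ext)
  fix f g x
  assume fg: "f \<in> test_functions" "g \<in> test_functions" "abs_spinorL2 f = abs_spinorL2 g"
  have cr: "continuous_rep (abs_spinorL2 f) h"
    if "h \<in> test_functions" "abs_spinorL2 f = abs_spinorL2 h" for h
    using that test_functions_continuous[of h]
    by (auto simp: continuous_rep_def test_functions_sq_integrable intro: continuous_on_subset)
  show "f x = g x"
  proof (cases "x \<in> I0")
    case True
    then show ?thesis using continuous_rep_unique cr fg by blast
  next
    case False
    have "h x = 0" if "h \<in> test_functions" for h
      using that False closure_subset[of "{\<rho>. h \<rho> \<noteq> 0}"] unfolding test_functions_def by blast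
    then show ?thesis using fg by metis
  qed
qed

lemma dirac_abs:
  "\<phi> \<in> test_functions \<Longrightarrow> dirac M (abs_spinorL2 \<phi>) = Some (abs_spinorL2 (dirac_expr M \<phi>))"
  by (simp add: dirac_def inv_into_f_f[OF inj_on_test_functions])

lemma dom_dirac: "dom (dirac M) = abs_spinorL2 ` test_functions"
  by (auto simp: dirac_def dom_def)

end

(* Since (sigma^a)' = - a sec sigma^a, a spinor (f1, f2) lies in the domain of the adjoint, with image
   (g1, g2), iff the weighted components w1 = sigma^{-M} f1 and w2 = sigma^M f2 are absolutely
   continuous with w1' = sigma^{-M} g2 and w2' = - sigma^M g1. For |M| < 1/2 both weights are square
   integrable, so these derivatives are integrable on the whole interval: w1 and w2 have limits at
   both ends, and every quadruple of limits occurs. Integration by parts turns the defect of symmetry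
   of the adjoint into the form <x, y'> - <y, x'> of the boundary vectors
   x = (w2(pi/2), w2(-pi/2)) and y = (w1(pi/2), - w1(-pi/2)). Self-adjoint extensions therefore
   correspond to the subspaces of C^2 x C^2 that equal their own complement for this form, and after the
   Cayley transform a = x + i y, b = x - i y those are exactly the graphs b = U a of unitary U. *)

theory Submission
  imports Defs
begin

text \<open>An absolutely continuous function appears here as a constant plus \<open>prim\<close> of
  an integrable function. In this form the graph of the adjoint is parametrized by two constants and
  the image (\<open>dsol\<close>), and integration by parts becomes Fubini on a triangle. The
  obstacle is the way from the weak equation, which speaks only of test functions, to such a
  formula. It is overcome by the du Bois-Reymond lemma, which calls for a test function of integral
  1 and for the density of test functions in L2; density also makes adjoint values unique. Both
  components obey one scalar equation, with parameter \<open>N = M\<close> or \<open>N = -M\<close>,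
  which is why the estimates bound an absolute value. For an operator \<open>T\<close> between
  \<open>dirac M\<close> and its adjoint, Green's identity identifies the adjoint of
  \<open>T\<close> as the restriction of the full adjoint to vectors whose boundary values are
  complementary to those attained on the domain of \<open>T\<close>. Hence a self-adjoint
  \<open>T\<close> can be recovered from its boundary values alone. That every pair of boundary
  vectors is attained makes these values equal to their complement instead of merely contained in
  it.\<close>

section \<open>Smooth functions and test functions\<close>

text \<open>Carrying the derivative as a witness, instead of iterating
  \<open>vector_derivative\<close>, lets closure properties go by induction on \<open>n\<close>. The
  set \<open>S\<close> admits functions such as powers of \<open>\<sigma>\<close>, which are treated
  only on \<open>I0\<close>.\<close>

primrec diff_upto :: "nat \<Rightarrow> real set \<Rightarrow> (real \<Rightarrow> 'a::real_normed_vector) \<Rightarrow> bool" where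
  "diff_upto 0 S f \<longleftrightarrow> True"
| "diff_upto (Suc n) S f \<longleftrightarrow>
     (\<exists>f'. (\<forall>x\<in>S. (f has_vector_derivative f' x) (at x)) \<and> diff_upto n S f')"

lemma diff_upto_SucI:
  "(\<And>x. x \<in> S \<Longrightarrow> (f has_vector_derivative f' x) (at x)) \<Longrightarrow> diff_upto n S f' \<Longrightarrow> diff_upto (Suc n) S f"
  by auto

lemma diff_upto_SucE:
  assumes "diff_upto (Suc n) S f"
  obtains f' where "\<And>x. x \<in> S \<Longrightarrow> (f has_vector_derivative f' x) (at x)" "diff_upto n S f'"
  using assms by auto

lemma diff_upto_SucD: "diff_upto (Suc n) S f \<Longrightarrow> diff_upto n S f"
proof (induction n arbitrary: f)
  case (Suc n)
  from Suc.prems show ?case by (rule diff_upto_SucE) (blast intro: diff_upto_SucI Suc.IH)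
qed simp

lemma diff_upto_subset: "diff_upto n S f \<Longrightarrow> T \<subseteq> S \<Longrightarrow> diff_upto n T f"
proof (induction n arbitrary: f)
  case (Suc n)
  from Suc.prems(1) show ?case
    by (rule diff_upto_SucE) (rule diff_upto_SucI, use Suc in blast, use Suc in blast)
qed simp

lemma diff_upto_cong:
  assumes "open S" "\<And>x. x \<in> S \<Longrightarrow> f x = g x" "diff_upto n S f"
  shows "diff_upto n S g"
proof (cases n)
  case (Suc m)
  with assms(3) obtain f' where f': "\<And>x. x \<in> S \<Longrightarrow> (f has_vector_derivative f' x) (at x)" "diff_upto m S f'"
    by auto
  have "(g has_vector_derivative f' x) (at x)" if "x \<in> S" for x
    by (rule has_vector_derivative_transform_within_open[OF f'(1)[OF that] assms(1) that assms(2)])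
  with f'(2) Suc show ?thesis by auto
qed simp

lemma diff_upto_const: "diff_upto n S (\<lambda>x. c)"
proof (induction n arbitrary: c)
  case (Suc n)
  show ?case by (rule diff_upto_SucI[where f'="\<lambda>_. 0"]) (use Suc in \<open>auto intro: derivative_eq_intros\<close>)
qed simp

lemma diff_upto_add: "diff_upto n S f \<Longrightarrow> diff_upto n S g \<Longrightarrow> diff_upto n S (\<lambda>x. f x + g x)"
proof (induction n arbitrary: f g)
  case (Suc n)
  obtain f' where "\<And>x. x \<in> S \<Longrightarrow> (f has_vector_derivative f' x) (at x)" "diff_upto n S f'"
    using Suc.prems(1) by auto
  moreover obtain g' where "\<And>x. x \<in> S \<Longrightarrow> (g has_vector_derivative g' x) (at x)" "diff_upto n S g'"
    using Suc.prems(2) by auto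
  ultimately show ?case
    by (intro diff_upto_SucI[where f'="\<lambda>x. f' x + g' x"] Suc.IH has_vector_derivative_add)
qed simp

lemma diff_upto_linear: "bounded_linear L \<Longrightarrow> diff_upto n S f \<Longrightarrow> diff_upto n S (\<lambda>x. L (f x))"
proof (induction n arbitrary: f)
  case (Suc n)
  then obtain f' where "\<And>x. x \<in> S \<Longrightarrow> (f has_vector_derivative f' x) (at x)" "diff_upto n S f'"
    by auto
  then show ?case
    using Suc.IH[OF Suc.prems(1)]
    by (intro diff_upto_SucI[where f'="\<lambda>x. L (f' x)"]
        bounded_linear.has_vector_derivative[OF Suc.prems(1)])
qed simp

lemma diff_upto_bilinear:
  assumes "bounded_bilinear p"
  shows "diff_upto n S f \<Longrightarrow> diff_upto n S g \<Longrightarrow> diff_upto n S (\<lambda>x. p (f x) (g x))"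
proof (induction n arbitrary: f g)
  case (Suc n)
  obtain f' where f': "\<And>x. x \<in> S \<Longrightarrow> (f has_vector_derivative f' x) (at x)" "diff_upto n S f'"
    using Suc.prems(1) by auto
  obtain g' where g': "\<And>x. x \<in> S \<Longrightarrow> (g has_vector_derivative g' x) (at x)" "diff_upto n S g'"
    using Suc.prems(2) by auto
  show ?case
  proof (rule diff_upto_SucI)
    show "((\<lambda>x. p (f x) (g x)) has_vector_derivative p (f x) (g' x) + p (f' x) (g x)) (at x)"
      if "x \<in> S" for x
      using f'(1)[OF that] g'(1)[OF that] by (rule bounded_bilinear.has_vector_derivative[OF assms])
    show "diff_upto n S (\<lambda>x. p (f x) (g' x) + p (f' x) (g x))"
      using f'(2) g'(2) Suc.prems[THEN diff_upto_SucD] by (intro diff_upto_add Suc.IH)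
  qed
qed simp

lemmas diff_upto_mult = diff_upto_bilinear[OF bounded_bilinear_mult]
lemmas diff_upto_cmult = diff_upto_linear[OF bounded_linear_mult_right]

lemma diff_upto_affine:
  "diff_upto n UNIV f \<Longrightarrow> diff_upto n UNIV (\<lambda>x. f (a * x + b))"
proof (induction n arbitrary: f)
  case (Suc n)
  then obtain f' where *: "\<And>x. (f has_vector_derivative f' x) (at x)" "diff_upto n UNIV f'"
    by auto
  have "((\<lambda>x. f (a * x + b)) has_vector_derivative a *\<^sub>R f' (a * x + b)) (at x)" for x
  proof -
    have "((\<lambda>x. a * x + b) has_vector_derivative a) (at x)"
      unfolding has_real_derivative_iff_has_vector_derivative[symmetric]
      by (auto intro!: derivative_eq_intros)
    then show ?thesis using vector_diff_chain_at[OF _ *(1)] by (simp add: o_def)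
  qed
  with * show ?case
    by (intro diff_upto_SucI[where f'="\<lambda>x. a *\<^sub>R f' (a * x + b)"] diff_upto_linear[OF bounded_linear_scaleR_right] Suc.IH)
qed simp

lemma diff_upto_inverse:
  fixes f :: "real \<Rightarrow> real"
  assumes "\<And>x. x \<in> S \<Longrightarrow> f x \<noteq> 0"
  shows "diff_upto n S f \<Longrightarrow> diff_upto n S (\<lambda>x. inverse (f x))"
proof (induction n)
  case (Suc n)
  obtain f' where *: "\<And>x. x \<in> S \<Longrightarrow> (f has_vector_derivative f' x) (at x)" "diff_upto n S f'"
    using Suc.prems by auto
  have "diff_upto n S (\<lambda>x. inverse (f x))"
    using Suc.IH Suc.prems by (blast intro: diff_upto_SucD)
  then have "diff_upto n S (\<lambda>x. (-1) * (f' x * (inverse (f x) * inverse (f x))))"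
    by (intro diff_upto_cmult diff_upto_mult *)
  moreover have "((\<lambda>x. inverse (f x)) has_vector_derivative (-1) * (f' x * (inverse (f x) * inverse (f x)))) (at x)"
    if "x \<in> S" for x
    using *(1)[OF that] assms[OF that]
    by (auto simp flip: has_real_derivative_iff_has_vector_derivative intro!: derivative_eq_intros)
  ultimately show ?case by (intro diff_upto_SucI)
qed simp

text \<open>Off the closed set \<open>K\<close> the function is locally zero, so its derivative
  vanishes there by uniqueness. The derivative, extended by 0, therefore meets the same hypotheses
  and the induction continues.\<close>

lemma diff_upto_zero_extension:
  assumes S: "open S" and K: "closed K" "K \<subseteq> S"
  shows "diff_upto n S f \<Longrightarrow> (\<And>x. x \<notin> K \<Longrightarrow> f x = 0) \<Longrightarrow> diff_upto n UNIV f"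
proof (induction n arbitrary: f)
  case (Suc n)
  obtain f' where *: "\<And>x. x \<in> S \<Longrightarrow> (f has_vector_derivative f' x) (at x)" "diff_upto n S f'"
    using Suc.prems by auto
  have 0: "(f has_vector_derivative 0) (at x)" if "x \<notin> K" for x
    by (rule has_vector_derivative_transform_within_open[of "\<lambda>_. 0" 0 x "- K"])
      (use K that Suc.prems in auto)
  define g where "g x = (if x \<in> S then f' x else 0)" for x
  have "diff_upto n UNIV g"
  proof (rule Suc.IH)
    show "diff_upto n S g"
      by (rule diff_upto_cong[OF S _ *(2)]) (simp add: g_def)
    show "g x = 0" if "x \<notin> K" for x
      using *(1)[of x] 0[OF that] vector_derivative_unique_at by (auto simp: g_def)
  qed
  moreover have "(f has_vector_derivative g x) (at x)" for x
    using *(1)[of x] 0[of x] K by (auto simp: g_def)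
  ultimately show ?case by (intro diff_upto_SucI)
qed simp

lemma smooth_iff_diff_upto: "smooth f \<longleftrightarrow> (\<forall>n. diff_upto n UNIV f)"
proof
  let ?D = "\<lambda>(g::real \<Rightarrow> complex^2) t. vector_derivative g (at t)"
  have "diff_upto n UNIV f" if "\<forall>n x. (?D ^^ n) f differentiable at x" for n f
    using that
  proof (induction n arbitrary: f)
    case (Suc n)
    have "(?D ^^ n) (?D f) differentiable at x" for n x
      using Suc.prems[rule_format, of "Suc n" x] by (simp only: funpow_Suc_right o_def)
    moreover have "(f has_vector_derivative ?D f x) (at x)" for x
      using Suc.prems[rule_format, of 0 x] by (simp add: vector_derivative_works)
    ultimately show ?case by (intro diff_upto_SucI[where f'="?D f"] Suc.IH) auto
  qed simp
  then show "smooth f \<Longrightarrow> \<forall>n. diff_upto n UNIV f" by (simp add: smooth_def)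
  \<comment> \<open>Differentiability of the \<open>n\<close>-th derivative costs one order more
    than its existence, hence \<open>Suc n\<close>.\<close>
  have "diff_upto (Suc n) UNIV f \<Longrightarrow> (?D ^^ n) f differentiable at x" for n f x
  proof (induction n arbitrary: f)
    case 0
    then show ?case by (auto intro: differentiableI_vector)
  next
    case (Suc n)
    then obtain f' where f': "\<And>x. (f has_vector_derivative f' x) (at x)" "diff_upto (Suc n) UNIV f'"
      by (metis UNIV_I diff_upto.simps(2))
    then have "?D f = f'" by (auto intro!: ext vector_derivative_at)
    then show ?case
      using Suc.IH[OF f'(2)] by (simp only: funpow_Suc_right o_def)
  qed
  then show "\<forall>n. diff_upto n UNIV f \<Longrightarrow> smooth f" unfolding smooth_def by blast
qed

section \<open>A smooth transition function\<close>

definition flat :: "nat \<Rightarrow> real \<Rightarrow> real" where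
  "flat k x = (if x > 0 then inverse x ^ k * exp (- inverse x) else 0)"

lemma flat_tendsto_0: "(flat k \<longlongrightarrow> 0) (at 0)"
proof -
  have "((\<lambda>x. inverse x ^ k / exp (inverse x)) \<longlongrightarrow> 0) (at_right (0::real))"
    by (rule filterlim_compose[OF tendsto_power_div_exp_0 filterlim_inverse_at_top_right])
  then have "(flat k \<longlongrightarrow> 0) (at_right 0)"
    by (rule Lim_transform_eventually)
      (auto simp: flat_def eventually_at_filter exp_minus divide_inverse)
  moreover have "(flat k \<longlongrightarrow> 0) (at_left 0)"
    by (rule Lim_transform_eventually[OF tendsto_const]) (auto simp: flat_def eventually_at_filter)
  ultimately show ?thesis by (simp add: filterlim_at_split)
qed

text \<open>The family is closed under differentiation up to linear combinations, so smoothness of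
  all its members follows by one induction with \<open>k\<close> arbitrary.\<close>

lemma flat_deriv:
  "(flat k has_vector_derivative (- real k) * flat (Suc k) x + flat (Suc (Suc k)) x) (at x)"
proof (cases x "0::real" rule: linorder_cases)
  case less
  have "(flat k has_vector_derivative 0) (at x)"
    by (rule has_vector_derivative_transform_within_open[of "\<lambda>_. 0" 0 x "{..<0}"])
      (use less in \<open>auto simp: flat_def\<close>)
  then show ?thesis using less by (simp add: flat_def)
next
  case equal
  \<comment> \<open>The difference quotient at 0 is \<open>flat (Suc k)\<close>, so its limit is
    again an instance of \<open>flat_tendsto_0\<close>.\<close>
  have "((\<lambda>y. (flat k y - flat k 0) / (y - 0)) \<longlongrightarrow> 0) (at 0)"
    by (rule Lim_transform_eventually[OF flat_tendsto_0[of "Suc k"]])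
      (auto simp: flat_def eventually_at_filter divide_inverse)
  then show ?thesis
    using equal by (simp add: flat_def has_real_derivative_iff_has_vector_derivative[symmetric] has_field_derivative_iff)
next
  case greater
  have "((\<lambda>x. inverse x ^ k * exp (- inverse x)) has_vector_derivative
      (- real k) * flat (Suc k) x + flat (Suc (Suc k)) x) (at x)"
    unfolding has_real_derivative_iff_has_vector_derivative[symmetric]
    using greater by (cases k)
     (auto intro!: derivative_eq_intros simp: flat_def algebra_simps,
      metis power_minus_mult mult.commute neq0_conv One_nat_def)
  then show ?thesis
    by (rule has_vector_derivative_transform_within_open[of _ _ x "{0<..}"])
      (use greater in \<open>auto simp: flat_def\<close>)
qed

lemma diff_upto_flat: "diff_upto n UNIV (flat k)"
proof (induction n arbitrary: k)
  case (Suc n)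
  show ?case
    by (rule diff_upto_SucI[OF flat_deriv]) (intro diff_upto_add diff_upto_cmult Suc.IH)
qed simp

text \<open>The standard smooth transition: 0 for \<open>x <= 0\<close>, 1 for
  \<open>x >= 1\<close>. The denominator is positive because \<open>x\<close> and
  \<open>1 - x\<close> are never both nonpositive.\<close>

definition step :: "real \<Rightarrow> real" where
  "step x = flat 0 x * inverse (flat 0 x + flat 0 (1 - x))"

lemma flat0_pos: "x > 0 \<Longrightarrow> flat 0 x > 0" and flat0_nonneg: "flat 0 x \<ge> 0"
  by (auto simp: flat_def)

lemma step_denom_pos: "flat 0 x + flat 0 (1 - x) > 0"
proof (cases "x > 0")
  case True
  then show ?thesis by (intro add_pos_nonneg flat0_pos flat0_nonneg)
next
  case False
  then show ?thesis by (intro add_nonneg_pos flat0_pos flat0_nonneg) simp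
qed

lemma diff_upto_step: "diff_upto n UNIV step"
proof -
  have "diff_upto n UNIV (\<lambda>x. flat 0 ((-1) * x + 1))"
    by (intro diff_upto_affine diff_upto_flat)
  then have "diff_upto n UNIV (\<lambda>x. flat 0 (1 - x))" by (simp add: algebra_simps)
  then have "diff_upto n UNIV (\<lambda>x. flat 0 x * inverse (flat 0 x + flat 0 (1 - x)))"
    by (intro diff_upto_mult diff_upto_inverse diff_upto_add diff_upto_flat)
      (use step_denom_pos in \<open>simp add: less_imp_neq[symmetric]\<close>)
  then show ?thesis by (simp add: step_def[abs_def])
qed

lemma step_0: "x \<le> 0 \<Longrightarrow> step x = 0"
  by (simp add: step_def flat_def)

lemma step_1: "x \<ge> 1 \<Longrightarrow> step x = 1"
  using step_denom_pos[of x] by (simp add: step_def flat_def)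

lemma step_bounds: "0 \<le> step x" "step x \<le> 1"
  using step_denom_pos[of x] flat0_nonneg[of x] flat0_nonneg[of "1-x"]
  by (auto simp: step_def divide_inverse[symmetric] field_simps)

text \<open>The scalar counterpart of \<open>test_functions\<close>. Compact subsets of
  \<open>I0\<close> lie in a closed subinterval, and stating the support this way makes it plain
  that a primitive is constant to the left and to the right of it.\<close>

definition test_fun :: "(real \<Rightarrow> complex) set" where
  "test_fun = {\<zeta>. (\<forall>n. diff_upto n UNIV \<zeta>) \<and>
     (\<exists>a b. -(pi/2) < a \<and> a \<le> b \<and> b < pi/2 \<and> (\<forall>x. x \<notin> {a..b} \<longrightarrow> \<zeta> x = 0))}"

lemma compact_subset_I0:
  assumes "compact K" "K \<subseteq> I0"
  obtains a b where "-(pi/2) < a" "a \<le> b" "b < pi/2" "K \<subseteq> {a..b}"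
proof (cases "K = {}")
  case True
  then show ?thesis using that[of 0 0] by simp
next
  case False
  obtain l where l: "l \<in> K" "\<And>x. x \<in> K \<Longrightarrow> l \<le> x" using compact_attains_inf[OF assms(1) False] by blast
  obtain u where u: "u \<in> K" "\<And>x. x \<in> K \<Longrightarrow> x \<le> u" using compact_attains_sup[OF assms(1) False] by blast
  show ?thesis using that[of l u] l u assms(2) by fastforce
qed

lemma test_fun_supportI:
  assumes "\<zeta> \<in> test_fun" obtains K where "compact K" "K \<subseteq> I0" "\<And>x. x \<notin> K \<Longrightarrow> \<zeta> x = 0"
proof -
  obtain a b where "-(pi/2) < a \<and> a \<le> b \<and> b < pi/2 \<and> (\<forall>x. x \<notin> {a..b} \<longrightarrow> \<zeta> x = 0)"
    using assms by (auto simp: test_fun_def)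
  then show ?thesis by (intro that[of "{a..b}"]) auto
qed

lemma test_funI:
  assumes "\<And>n. diff_upto n I0 f" "compact K" "K \<subseteq> I0" "\<And>x. x \<notin> K \<Longrightarrow> f x = 0"
  shows "f \<in> test_fun"
proof -
  have "diff_upto n UNIV f" for n
    by (rule diff_upto_zero_extension[of I0 K]) (use assms compact_imp_closed in auto)
  moreover obtain a b where "-(pi/2) < a" "a \<le> b" "b < pi/2" "K \<subseteq> {a..b}"
    using compact_subset_I0[OF assms(2,3)] .
  moreover have "\<forall>x. x \<notin> {a..b} \<longrightarrow> f x = 0" using assms(4) \<open>K \<subseteq> {a..b}\<close> by blast
  ultimately show ?thesis unfolding test_fun_def by blast
qed

lemma test_functions_iff:
  "\<phi> \<in> test_functions \<longleftrightarrow> (\<lambda>x. \<phi> x $ 1) \<in> test_fun \<and> (\<lambda>x. \<phi> x $ 2) \<in> test_fun"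
proof
  assume \<phi>: "\<phi> \<in> test_functions"
  have "(\<lambda>x. \<phi> x $ i) \<in> test_fun" for i
  proof (rule test_funI[where K="closure {\<rho>. \<phi> \<rho> \<noteq> 0}"])
    show "diff_upto n I0 (\<lambda>x. \<phi> x $ i)" for n
      using \<phi> by (intro diff_upto_linear[OF bounded_linear_vec_nth])
        (auto simp: test_functions_def smooth_iff_diff_upto intro: diff_upto_subset)
    show "\<phi> x $ i = 0" if "x \<notin> closure {\<rho>. \<phi> \<rho> \<noteq> 0}" for x
    proof -
      have "x \<notin> {\<rho>. \<phi> \<rho> \<noteq> 0}" by (rule contra_subsetD[OF closure_subset that])
      then show ?thesis by simp
    qed
    show "compact (closure {\<rho>. \<phi> \<rho> \<noteq> 0})" "closure {\<rho>. \<phi> \<rho> \<noteq> 0} \<subseteq> I0"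
      using \<phi> unfolding test_functions_def by blast+
  qed
  then show "(\<lambda>x. \<phi> x $ 1) \<in> test_fun \<and> (\<lambda>x. \<phi> x $ 2) \<in> test_fun" by blast
next
  assume *: "(\<lambda>x. \<phi> x $ 1) \<in> test_fun \<and> (\<lambda>x. \<phi> x $ 2) \<in> test_fun"
  then obtain K L where K: "compact K" "K \<subseteq> I0" "\<And>x. x \<notin> K \<Longrightarrow> \<phi> x $ 1 = 0"
    and L: "compact L" "L \<subseteq> I0" "\<And>x. x \<notin> L \<Longrightarrow> \<phi> x $ 2 = 0"
    by (metis (no_types, lifting) test_fun_supportI)
  have lin: "bounded_linear (\<lambda>z. axis i z :: complex^2)" for i
    unfolding linear_conv_bounded_linear[symmetric]
    by (auto intro!: linearI simp: axis_def vec_eq_iff)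
  have "diff_upto n UNIV (\<lambda>x. axis 1 (\<phi> x $ 1) + axis 2 (\<phi> x $ 2) :: complex^2)" for n
    using * by (intro diff_upto_add diff_upto_linear[OF lin]) (auto simp: test_fun_def)
  moreover have "(\<lambda>x. axis 1 (\<phi> x $ 1) + axis 2 (\<phi> x $ 2)) = \<phi>"
    by (auto simp: fun_eq_iff vec_eq_iff axis_def forall_2)
  ultimately have "smooth \<phi>" by (simp add: smooth_iff_diff_upto)
  moreover have sub: "{\<rho>. \<phi> \<rho> \<noteq> 0} \<subseteq> K \<union> L"
    using K(3) L(3) by (auto simp: vec_eq_iff forall_2)
  then have c: "closure {\<rho>. \<phi> \<rho> \<noteq> 0} \<subseteq> K \<union> L"
    using K L by (intro closure_minimal) (auto intro: compact_imp_closed)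
  then have "closure {\<rho>. \<phi> \<rho> \<noteq> 0} \<subseteq> I0" using K L by auto
  moreover have "compact (closure {\<rho>. \<phi> \<rho> \<noteq> 0})"
    using compact_Int_closed[OF compact_Un[OF K(1) L(1)] closed_closure[of "{\<rho>. \<phi> \<rho> \<noteq> 0}"]] c
    by (simp add: Int_absorb1)
  ultimately show "\<phi> \<in> test_functions" by (simp add: test_functions_def)
qed

section \<open>The weight \<open>\<sigma>\<close> and its derivative\<close>

lemma cos_pos: "x \<in> I0 \<Longrightarrow> cos x > 0"
  by (auto intro: cos_gt_zero_pi)

lemma sin_strict_bounds: "x \<in> I0 \<Longrightarrow> -1 < sin x \<and> sin x < 1"
proof -
  assume "x \<in> I0"
  then have "(sin x)\<^sup>2 < 1"
    using cos_pos[of x] sin_cos_squared_add[of x] zero_less_power[of "cos x" 2] by linarith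
  then show ?thesis by (metis abs_square_less_1 abs_less_iff minus_less_iff)
qed

lemma \<sigma>_pos: "x \<in> I0 \<Longrightarrow> \<sigma> x > 0"
  using sin_strict_bounds[of x] by (simp add: \<sigma>_def)

lemma \<sigma>_powr_deriv:
  assumes x: "x \<in> I0"
  shows "((\<lambda>x. \<sigma> x powr a) has_real_derivative (- (a / cos x) * \<sigma> x powr a)) (at x)"
proof -
  have s: "1 + sin x > 0" "1 - sin x > 0" and c: "cos x > 0"
    using sin_strict_bounds[OF x] cos_pos[OF x] by auto
  \<comment> \<open>The power is written through
    \<open>ln \<sigma> = (ln (1 - sin) - ln (1 + sin)) / 2\<close>, whose derivative is
    \<open>- 1 / cos\<close> because \<open>cos^2 = (1 - sin) (1 + sin)\<close>.\<close>
  define g where "g x = exp (a * ((ln (1 - sin x) - ln (1 + sin x)) / 2))" for x :: real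
  have cc: "cos x * cos x = (1 - sin x) * (1 + sin x)"
    using sin_cos_squared_add[of x] by (simp add: power2_eq_square algebra_simps)
  have "- cos x / (1 - sin x) - cos x / (1 + sin x) = - 2 * cos x / ((1 - sin x) * (1 + sin x))"
    using s by (simp add: field_simps)
  also have "\<dots> = - 2 / cos x" using c by (simp flip: cc)
  finally have e: "- cos x / (1 - sin x) - cos x / (1 + sin x) = - 2 / cos x" .
  have "((\<lambda>x. ln (1 - sin x) - ln (1 + sin x)) has_real_derivative
      - cos x / (1 - sin x) - cos x / (1 + sin x)) (at x)"
    using s by (auto intro!: derivative_eq_intros)
  then have l: "((\<lambda>x. ln (1 - sin x) - ln (1 + sin x)) has_real_derivative - 2 / cos x) (at x)"
    by (simp only: e)
  have "(g has_real_derivative (- (a / cos x) * g x)) (at x)"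
    unfolding g_def
    using DERIV_fun_exp[OF DERIV_cmult[OF DERIV_cdivide[OF l, of 2], of a]] by (simp add: mult.commute)
  moreover have g: "g y = \<sigma> y powr a" if "y \<in> I0" for y
    using sin_strict_bounds[OF that] \<sigma>_pos[OF that]
    by (simp add: g_def powr_def \<sigma>_def ln_sqrt ln_div)
  ultimately have "(g has_real_derivative (- (a / cos x) * \<sigma> x powr a)) (at x)" using x by simp
  then show ?thesis
    by (rule has_field_derivative_transform_within_open[of _ _ x I0]) (use x g in auto)
qed

lemma diff_upto_sec: "diff_upto n I0 (\<lambda>x. inverse (cos x))"
proof (rule diff_upto_inverse)
  \<comment> \<open>Generalized to combinations of sine and cosine, which are closed under
    differentiation.\<close>
  have "diff_upto n UNIV (\<lambda>x. a * sin x + b * cos x)" for a b :: real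
  proof (induction n arbitrary: a b)
    case (Suc n)
    show ?case
      by (rule diff_upto_SucI[OF _ Suc[of "-b" a]])
        (auto simp flip: has_real_derivative_iff_has_vector_derivative intro!: derivative_eq_intros)
  qed simp
  from this[of 0 1] have "diff_upto n UNIV cos" by (simp only: mult_1 mult_zero_left add_0_left)
  then show "diff_upto n I0 cos" by (rule diff_upto_subset) simp
qed (use cos_pos in fastforce)

lemma diff_upto_\<sigma>_powr: "diff_upto n I0 (\<lambda>x. \<sigma> x powr a)"
proof (induction n)
  case (Suc n)
  have "diff_upto n I0 (\<lambda>x. ((-a) * inverse (cos x)) * \<sigma> x powr a)"
    by (intro diff_upto_mult diff_upto_const diff_upto_sec Suc)
  moreover have "((\<lambda>x. \<sigma> x powr a) has_vector_derivative (-a) * inverse (cos x) * \<sigma> x powr a) (at x)"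
    if "x \<in> I0" for x
    using \<sigma>_powr_deriv[OF that, of a]
    by (simp only: has_real_derivative_iff_has_vector_derivative divide_inverse mult_minus_left)
  ultimately show ?case by (rule diff_upto_SucI[rotated])
qed simp

text \<open>Smoothness of the weight is known only on \<open>I0\<close>, which suffices because the
  test function vanishes off a compact subset. This lets weights be shifted onto test
  functions.\<close>

lemma test_fun_\<sigma>_powr:
  assumes "\<zeta> \<in> test_fun" shows "(\<lambda>x. of_real (\<sigma> x powr a) * \<zeta> x) \<in> test_fun"
proof -
  obtain K where K: "compact K" "K \<subseteq> I0" "\<And>x. x \<notin> K \<Longrightarrow> \<zeta> x = 0" using test_fun_supportI[OF assms] by metis
  show ?thesis
  proof (rule test_funI[OF _ K(1,2)])
    show "diff_upto n I0 (\<lambda>x. of_real (\<sigma> x powr a) * \<zeta> x)" for n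
      using assms by (intro diff_upto_mult diff_upto_linear[OF bounded_linear_of_real] diff_upto_\<sigma>_powr)
        (auto simp: test_fun_def intro: diff_upto_subset)
  qed (simp add: K)
qed

lemma test_fun_add: 
  assumes "f \<in> test_fun" "g \<in> test_fun" shows "(\<lambda>x. f x + g x) \<in> test_fun"
proof -
  obtain K where K: "compact K" "K \<subseteq> I0" "\<And>x. x \<notin> K \<Longrightarrow> f x = 0" using test_fun_supportI[OF assms(1)] by metis
  obtain L where L: "compact L" "L \<subseteq> I0" "\<And>x. x \<notin> L \<Longrightarrow> g x = 0" using test_fun_supportI[OF assms(2)] by metis
  show ?thesis
  proof (rule test_funI[where K="K \<union> L"])
    show "diff_upto n I0 (\<lambda>x. f x + g x)" for n
      using assms by (intro diff_upto_add) (auto simp: test_fun_def intro: diff_upto_subset)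
  qed (use K L in auto)
qed

lemma test_fun_cmult:
  assumes "f \<in> test_fun" shows "(\<lambda>x. c * f x) \<in> test_fun"
  using assms by (auto simp: test_fun_def intro!: diff_upto_cmult)

lemma test_fun_0: "(\<lambda>_. 0) \<in> test_fun"
  by (auto simp: test_fun_def diff_upto_const intro!: exI[of _ 0])

lemma test_fun_deriv:
  assumes "f \<in> test_fun"
  shows "(f has_vector_derivative vector_derivative f (at x)) (at x)"
    and "(\<lambda>x. vector_derivative f (at x)) \<in> test_fun"
proof -
  have d: "\<exists>f'. (\<forall>x. (f has_vector_derivative f' x) (at x)) \<and> diff_upto n UNIV f'" for n
    using assms unfolding test_fun_def by (metis (mono_tags, lifting) UNIV_I diff_upto.simps(2) mem_Collect_eq)
  have e: "f' = (\<lambda>x. vector_derivative f (at x))" if "\<forall>x. (f has_vector_derivative f' x) (at x)" for f'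
    using that vector_derivative_at by (metis (no_types, lifting))
  show D: "(f has_vector_derivative vector_derivative f (at x)) (at x)" for x
    using d e by blast
  have "diff_upto n UNIV (\<lambda>x. vector_derivative f (at x))" for n
    using d[of n] e by auto
  moreover obtain K where K: "compact K" "K \<subseteq> I0" "\<And>x. x \<notin> K \<Longrightarrow> f x = 0" using test_fun_supportI[OF assms] by metis
  have "vector_derivative f (at x) = 0" if "x \<notin> K" for x
  proof (rule vector_derivative_at)
    show "(f has_vector_derivative 0) (at x)"
      by (rule has_vector_derivative_transform_within_open[of "\<lambda>_. 0" 0 x "- K"])
        (use K that compact_imp_closed in auto)
  qed
  ultimately show "(\<lambda>x. vector_derivative f (at x)) \<in> test_fun"
    using K by (intro test_funI[where K=K]) (auto intro: diff_upto_subset)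
qed

lemma test_fun_continuous: "f \<in> test_fun \<Longrightarrow> continuous_on S f"
  by (intro continuous_at_imp_continuous_on ballI has_vector_derivative_continuous[OF test_fun_deriv(1)])


section \<open>Density of the test functions\<close>

abbreviation \<mu> :: "real measure" where "\<mu> \<equiv> lebesgue_on I0"

abbreviation spinor :: "(real \<Rightarrow> complex^2) \<Rightarrow> spinorL2" where "spinor \<equiv> abs_spinorL2"

lemma L2_rel_refl: "sq_integrable f \<Longrightarrow> L2_rel f f"
  by (simp add: L2_rel_def)

lemma spinor_cases: obtains f where "sq_integrable f" "\<Phi> = spinor f"
proof -
  have "L2_rel (rep_spinorL2 \<Phi>) (rep_spinorL2 \<Phi>)" "spinor (rep_spinorL2 \<Phi>) = \<Phi>"
    by (rule Quotient3_rep_reflp[OF Quotient3_spinorL2] Quotient3_abs_rep[OF Quotient3_spinorL2])+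
  then show ?thesis using that[of "rep_spinorL2 \<Phi>"] by (simp add: L2_rel_def)
qed

lemma spinor_eqI:
  "sq_integrable f \<Longrightarrow> sq_integrable g \<Longrightarrow> (AE x in \<mu>. f x = g x) \<Longrightarrow> spinor f = spinor g"
  by (simp add: abs_spinorL2_eq_iff)

lemma spinor_add:
  "sq_integrable f \<Longrightarrow> sq_integrable g \<Longrightarrow> spinor f + spinor g = spinor (\<lambda>x. f x + g x)"
  by (simp add: plus_spinorL2.abs_eq L2_rel_refl)

lemma spinor_scaleR: "sq_integrable f \<Longrightarrow> r *\<^sub>R spinor f = spinor (\<lambda>x. r *\<^sub>R f x)"
  by (simp add: scaleR_spinorL2.abs_eq L2_rel_refl)

lemma spinor_cscale: "sq_integrable f \<Longrightarrow> c *\<^sub>C spinor f = spinor (\<lambda>x. c *s f x)"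
  by (simp add: cscale.abs_eq L2_rel_refl)

lemma sq_integrable_diff:
  "sq_integrable f \<Longrightarrow> sq_integrable g \<Longrightarrow> sq_integrable (\<lambda>x. f x - g x)"
  using sq_integrable_add[of f "\<lambda>x. (-1) *\<^sub>R g x"] sq_integrable_scaleR[of g "-1"] by simp

lemma spinor_diff:
  assumes "sq_integrable f" "sq_integrable g"
  shows "spinor f - spinor g = spinor (\<lambda>x. f x - g x)"
  using spinor_add[OF sq_integrable_diff[OF assms] assms(2)] by (simp add: algebra_simps)

lemma cinner_spinor:
  "sq_integrable f \<Longrightarrow> sq_integrable g \<Longrightarrow>
     cinner (spinor f) (spinor g) = (LINT x|\<mu>. hdot (f x) (g x))"
  by (simp add: cinner.abs_eq L2_rel_refl)

lemma norm_spinor_power2: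
  assumes "sq_integrable f" shows "(norm (spinor f))\<^sup>2 = (LINT x|\<mu>. (norm (f x))\<^sup>2)"
proof -
  have "(norm (spinor f))\<^sup>2 = Re (cinner (spinor f) (spinor f))"
    by (simp add: power2_norm_eq_inner inner_spinorL2_def)
  also have "\<dots> = (LINT x|\<mu>. (norm (f x))\<^sup>2)"
    unfolding cinner_spinor[OF assms assms] hdot_self integral_complex_of_real by simp
  finally show ?thesis .
qed

lemma sq_integrable_bounded:
  assumes "f \<in> borel_measurable \<mu>" "\<And>x. norm (f x) \<le> B"
  shows "sq_integrable f"
proof -
  have "integrable \<mu> (\<lambda>x. (norm (f x))\<^sup>2)"
  proof (rule Bochner_Integration.integrable_bound)
    show "integrable \<mu> (\<lambda>x. B\<^sup>2)"
      by (intro finite_measure.integrable_const finite_measure_lebesgue_on) simp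
    show "(\<lambda>x. (norm (f x))\<^sup>2) \<in> borel_measurable \<mu>"
      using assms(1) by measurable
    show "AE x in \<mu>. norm ((norm (f x))\<^sup>2) \<le> norm (B\<^sup>2)"
      using power_mono[OF assms(2) norm_ge_zero, of _ 2] by simp
  qed
  with assms show ?thesis by (simp add: sq_integrable_def)
qed

text \<open>Dominated convergence in L2: both the sequence and its limit are bounded by
  \<open>w\<close>, so \<open>4 w^2\<close> dominates the squared distance.\<close>

lemma spinor_dominated_convergence:
  assumes u: "\<And>n. sq_integrable (u n)" and f: "sq_integrable f"
    and lim: "\<And>x. x \<in> I0 \<Longrightarrow> (\<lambda>n. u n x) \<longlonglongrightarrow> f x"
    and w: "integrable \<mu> (\<lambda>x. (w x)\<^sup>2)" "\<And>n x. x \<in> I0 \<Longrightarrow> norm (u n x) \<le> w x"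
  shows "(\<lambda>n. spinor (u n)) \<longlonglongrightarrow> spinor f"
proof -
  have le: "norm (u n x - f x) \<le> 2 * w x" if "x \<in> I0" for n x
  proof -
    have "norm (f x) \<le> w x"
      by (rule LIMSEQ_le_const2[OF tendsto_norm[OF lim[OF that]]]) (use w(2)[OF that] in auto)
    then show ?thesis using norm_triangle_ineq4[of "u n x" "f x"] w(2)[OF that, of n] by linarith
  qed
  have "(\<lambda>n. LINT x|\<mu>. (norm (u n x - f x))\<^sup>2) \<longlonglongrightarrow> (LINT x|\<mu>. 0)"
  proof (rule integral_dominated_convergence[where w="\<lambda>x. 4 * (w x)\<^sup>2"])
    show "(\<lambda>x. (norm (u n x - f x))\<^sup>2) \<in> borel_measurable \<mu>" for n
    proof -
      have "u n \<in> borel_measurable \<mu>" "f \<in> borel_measurable \<mu>"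
        using u f by (auto simp: sq_integrable_def)
      then show ?thesis by measurable
    qed
    show "AE x in \<mu>. (\<lambda>n. (norm (u n x - f x))\<^sup>2) \<longlonglongrightarrow> 0"
    proof (rule AE_I2)
      fix x assume "x \<in> space \<mu>"
      then have "(\<lambda>n. (norm (u n x - f x))\<^sup>2) \<longlonglongrightarrow> (norm (f x - f x))\<^sup>2"
        by (intro tendsto_intros lim) simp
      then show "(\<lambda>n. (norm (u n x - f x))\<^sup>2) \<longlonglongrightarrow> 0" by simp
    qed
    show "AE x in \<mu>. norm ((norm (u n x - f x))\<^sup>2) \<le> 4 * (w x)\<^sup>2" for n
    proof (rule AE_I2)
      fix x assume "x \<in> space \<mu>"
      then have "norm (u n x - f x) \<le> 2 * w x" by (intro le) simp
      from power_mono[OF this norm_ge_zero, of 2]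
      show "norm ((norm (u n x - f x))\<^sup>2) \<le> 4 * (w x)\<^sup>2" by (simp add: power_mult_distrib)
    qed
  qed (use w(1) in auto)
  then have "(\<lambda>n. (norm (spinor (u n) - spinor f))\<^sup>2) \<longlonglongrightarrow> 0"
    by (simp add: spinor_diff u f norm_spinor_power2 sq_integrable_diff)
  then have "(\<lambda>n. sqrt ((norm (spinor (u n) - spinor f))\<^sup>2)) \<longlonglongrightarrow> sqrt 0"
    by (rule tendsto_real_sqrt)
  then show ?thesis by (subst LIM_zero_iff[symmetric]) (auto intro: tendsto_norm_zero_cancel)
qed

lemma test_functions_add: "f \<in> test_functions \<Longrightarrow> g \<in> test_functions \<Longrightarrow> (\<lambda>x. f x + g x) \<in> test_functions"
  by (simp add: test_functions_iff test_fun_add)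

lemma test_functions_scaleR: "f \<in> test_functions \<Longrightarrow> (\<lambda>x. r *\<^sub>R f x) \<in> test_functions"
  by (simp add: test_functions_iff test_fun_cmult scaleR_conv_of_real[where 'a=complex])

text \<open>Density is proved by enlarging what is known to lie in this closed real subspace, in the
  order of the construction of the integral: intervals, Borel sets, Lebesgue sets, nonnegative
  functions, real coordinates.\<close>

definition test_closure :: "spinorL2 set" where
  "test_closure = closure (spinor ` test_functions)"

lemma test_closure_add: 
  assumes "x \<in> test_closure" "y \<in> test_closure" shows "x + y \<in> test_closure"
proof -
  obtain X Y where X: "\<And>n. X n \<in> spinor ` test_functions" "X \<longlonglongrightarrow> x"
    and Y: "\<And>n. Y n \<in> spinor ` test_functions" "Y \<longlonglongrightarrow> y"
    using assms by (auto simp: test_closure_def closure_sequential)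
  have "X n + Y n \<in> spinor ` test_functions" for n
    using X(1)[of n] Y(1)[of n]
    by (auto simp: spinor_add test_functions_sq_integrable test_functions_add)
  then show ?thesis
    using tendsto_add[OF X(2) Y(2)] unfolding test_closure_def closure_sequential
    by (intro exI[of _ "\<lambda>n. X n + Y n"]) simp
qed

lemma test_closure_scaleR: 
  assumes "x \<in> test_closure" shows "r *\<^sub>R x \<in> test_closure"
proof -
  obtain X where X: "\<And>n. X n \<in> spinor ` test_functions" "X \<longlonglongrightarrow> x"
    using assms by (auto simp: test_closure_def closure_sequential)
  have "r *\<^sub>R X n \<in> spinor ` test_functions" for n
    using X(1)[of n] by (auto simp: spinor_scaleR test_functions_sq_integrable test_functions_scaleR)
  then show ?thesis
    using tendsto_scaleR[OF tendsto_const X(2), of r] unfolding test_closure_def closure_sequential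
    by (intro exI[of _ "\<lambda>n. r *\<^sub>R X n"]) simp
qed

lemma test_closure_limit:
  "(\<And>n. X n \<in> test_closure) \<Longrightarrow> X \<longlonglongrightarrow> x \<Longrightarrow> x \<in> test_closure"
  using closed_sequentially[of test_closure X x] by (simp add: test_closure_def)

lemma test_closure_test: "f \<in> test_functions \<Longrightarrow> spinor f \<in> test_closure"
  unfolding test_closure_def by (rule closure_subset[THEN subsetD]) simp

lemma borel_imp_sets_\<mu>: "A \<in> sets borel \<Longrightarrow> A \<inter> I0 \<in> sets \<mu>"
proof -
  assume "A \<in> sets borel"
  then have "A \<in> sets lebesgue" by auto
  then show ?thesis by (auto simp: sets_restrict_space)
qed

lemma sq_integrable_indicator:
  assumes "A \<inter> I0 \<in> sets \<mu>" shows "sq_integrable (\<lambda>x. indicat_real A x *\<^sub>R v)"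
proof (rule sq_integrable_bounded[where B="norm v"])
  have "indicat_real A \<in> borel_measurable \<mu>"
    using assms by (simp add: borel_measurable_indicator_iff)
  then show "(\<lambda>x. indicat_real A x *\<^sub>R v) \<in> borel_measurable \<mu>"
    by (intro borel_measurable_scaleR borel_measurable_const)
qed (auto simp: indicator_def)

lemma test_closure_interval:
  assumes ab: "-(pi/2) \<le> a" "b \<le> pi/2"
  shows "spinor (\<lambda>x. indicat_real {a<..<b} x *\<^sub>R v) \<in> test_closure"
proof -
  \<comment> \<open>The shift by 1 confines the support to
    \<open>[a + 1/(n+1), b - 1/(n+1)]\<close>, inside \<open>I0\<close> even if \<open>a\<close> or
    \<open>b\<close> is an end of it; the value is 1 at distance at least \<open>2/(n+1)\<close>
    from both ends.\<close>
  define \<theta> where "\<theta> n x = step (Suc n * (x - a) - 1) * step (Suc n * (b - x) - 1)" for n x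
  have zero: "\<theta> n x = 0" if "x \<notin> {a + 1 / Suc n..b - 1 / Suc n}" for n x
  proof -
    from that consider "x < a + 1 / Suc n" | "x > b - 1 / Suc n" by force
    then show ?thesis
    proof cases
      case 1
      then have "Suc n * (x - a) - 1 \<le> 0" by (simp add: field_simps)
      then show ?thesis by (simp add: \<theta>_def step_0)
    next
      case 2
      then have "Suc n * (b - x) - 1 \<le> 0" by (simp add: field_simps)
      then show ?thesis by (simp add: \<theta>_def step_0)
    qed
  qed
  have bnd: "0 \<le> \<theta> n x" "\<theta> n x \<le> 1" for n x
    using step_bounds by (auto simp: \<theta>_def intro!: mult_le_one)
  have smth: "diff_upto k UNIV (\<theta> n)" for k n
  proof -
    have "diff_upto k UNIV (\<lambda>x. step (Suc n * x + (- Suc n * a - 1)) * step ((- Suc n) * x + (Suc n * b - 1)))"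
      by (intro diff_upto_mult diff_upto_affine diff_upto_step)
    then show ?thesis by (simp add: \<theta>_def[abs_def] algebra_simps)
  qed
  have tf: "(\<lambda>x. of_real (\<theta> n x) * c) \<in> test_fun" for n c
  proof (rule test_funI[where K="{a + 1 / Suc n..b - 1 / Suc n}"])
    show "diff_upto k I0 (\<lambda>x. of_real (\<theta> n x) * c)" for k
      by (intro diff_upto_mult diff_upto_const diff_upto_linear[OF bounded_linear_of_real]
          diff_upto_subset[OF smth]) simp
    have "1 / real (Suc n) > 0" by simp
    then have "-(pi/2) < x \<and> x < pi/2" if "x \<in> {a + 1 / Suc n..b - 1 / Suc n}" for x
      using ab that unfolding atLeastAtMost_iff by linarith
    then show "{a + 1 / Suc n..b - 1 / Suc n} \<subseteq> I0" by auto
    show "of_real (\<theta> n x) * c = 0" if "x \<notin> {a + 1 / real (Suc n)..b - 1 / real (Suc n)}" for x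
      using zero[OF that] by simp
  qed simp
  have tfv: "(\<lambda>x. \<theta> n x *\<^sub>R v) \<in> test_functions" for n
    using tf by (simp add: test_functions_iff scaleR_conv_of_real[where 'a=complex])
  show ?thesis
  proof (rule test_closure_limit)
    show "spinor (\<lambda>x. \<theta> n x *\<^sub>R v) \<in> test_closure" for n
      by (intro test_closure_test tfv)
    show "(\<lambda>n. spinor (\<lambda>x. \<theta> n x *\<^sub>R v)) \<longlonglongrightarrow> spinor (\<lambda>x. indicat_real {a<..<b} x *\<^sub>R v)"
    proof (rule spinor_dominated_convergence[where w="\<lambda>x. norm v"])
      show "sq_integrable (\<lambda>x. \<theta> n x *\<^sub>R v)" for n
        by (rule test_functions_sq_integrable[OF tfv])
      show "sq_integrable (\<lambda>x. indicat_real {a<..<b} x *\<^sub>R v)"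
        by (intro sq_integrable_indicator borel_imp_sets_\<mu>) simp
      show "integrable \<mu> (\<lambda>x. (norm v)\<^sup>2)"
        by (intro finite_measure.integrable_const finite_measure_lebesgue_on) simp
      show "norm (\<theta> n x *\<^sub>R v) \<le> norm v" for n x
        using bnd[of n x] by (simp add: mult_left_le_one_le)
      show "(\<lambda>n. \<theta> n x *\<^sub>R v) \<longlonglongrightarrow> indicat_real {a<..<b} x *\<^sub>R v" for x
      proof (cases "x \<in> {a<..<b}")
        case False
        have "\<theta> n x = 0" for n
        proof -
          have "1 / real (Suc n) > 0" by simp
          then have "x \<notin> {a + 1 / Suc n..b - 1 / Suc n}"
            using False unfolding atLeastAtMost_iff greaterThanLessThan_iff by linarith
          then show ?thesis by (rule zero)
        qed
        with False show ?thesis by simp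
      next
        case True
        have ev: "\<forall>\<^sub>F n in sequentially. Suc n * d - 1 \<ge> 1" if "d > 0" for d :: real
        proof -
          obtain N where N: "2 / d < real N" using reals_Archimedean2 by blast
          show ?thesis
          proof (rule eventually_sequentiallyI[of N])
            fix n assume "N \<le> n"
            then have "2 / d \<le> real (Suc n)" using N by linarith
            then show "Suc n * d - 1 \<ge> 1" using that by (simp add: field_simps)
          qed
        qed
        have "x - a > 0" "b - x > 0" using True by auto
        from ev[OF this(1)] ev[OF this(2)] have "\<forall>\<^sub>F n in sequentially. \<theta> n x = 1"
          by eventually_elim (simp add: \<theta>_def step_1)
        then have "\<forall>\<^sub>F n in sequentially. \<theta> n x *\<^sub>R v = indicat_real {a<..<b} x *\<^sub>R v"
          by eventually_elim (use True in simp)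
        then show ?thesis by (rule tendsto_eventually)
      qed
    qed
  qed
qed

text \<open>Dynkin's argument: open intervals are stable under intersection and generate the Borel
  sets, and a disjoint union is the L2 limit of its partial unions. The vector \<open>v\<close> is
  quantified inside because the complement step uses \<open>-v\<close>.\<close>

lemma test_closure_borel:
  assumes "A \<in> sets borel"
  shows "\<forall>v. spinor (\<lambda>x. indicat_real A x *\<^sub>R v) \<in> test_closure"
proof -
  let ?G = "range (\<lambda>(a, b). {a<..<b::real})"
  have G: "sets borel = sigma_sets UNIV ?G"
    unfolding borel_eq_box[where 'a=real] box_real by (rule sets_measure_of) simp
  have int: "Int_stable ?G"
  proof (rule Int_stableI)
    fix A B assume "A \<in> ?G" "B \<in> ?G"
    then obtain a b c d where "A = {a<..<b}" "B = {c<..<d}" by auto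
    then have "A \<inter> B = {max a c<..<min b d}" by auto
    then show "A \<inter> B \<in> ?G" by auto
  qed
  have A: "A \<in> sigma_sets UNIV ?G" using assms G by simp
  have sq: "sq_integrable (\<lambda>x. indicat_real B x *\<^sub>R v)" if "B \<in> sets borel" for B v
    by (intro sq_integrable_indicator borel_imp_sets_\<mu> that)
  have interval: "spinor (\<lambda>x. indicat_real {a<..<b} x *\<^sub>R v) \<in> test_closure" for a b v
  proof -
    have "spinor (\<lambda>x. indicat_real {a<..<b} x *\<^sub>R v)
        = spinor (\<lambda>x. indicat_real {max a (-(pi/2))<..<min b (pi/2)} x *\<^sub>R v)"
      by (intro spinor_eqI sq AE_I2) (auto simp: indicator_def)
    then show ?thesis using test_closure_interval[of "max a (-(pi/2))" "min b (pi/2)" v] by simp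
  qed
  have "?G \<subseteq> Pow UNIV" by simp
  from int this A show ?thesis
  proof (induction rule: sigma_sets_induct_disjoint)
    case (basic A)
    then show ?case using interval by auto
  next
    case empty
    show ?case using interval[of 0 0] by simp
  next
    case (compl A)
    then have A: "A \<in> sets borel" by (simp add: G)
    show ?case
    proof
      fix v
      \<comment> \<open>The interval from -2 to 2 contains \<open>I0\<close> since
        \<open>pi < 4\<close>, so it may replace the whole line.\<close>
      have "spinor (\<lambda>x. indicat_real (UNIV - A) x *\<^sub>R v)
          = spinor (\<lambda>x. indicat_real {-2<..<2} x *\<^sub>R v + indicat_real A x *\<^sub>R (-v))"
        using A pi_less_4 by (intro spinor_eqI sq sq_integrable_add AE_I2) (auto simp: indicator_def)
      also have "\<dots> = spinor (\<lambda>x. indicat_real {-2<..<2} x *\<^sub>R v) + spinor (\<lambda>x. indicat_real A x *\<^sub>R (-v))"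
        by (rule spinor_add[symmetric]) (intro sq A; simp)+
      also have "\<dots> \<in> test_closure"
        by (rule test_closure_add[OF interval spec[OF compl(2)]])
      finally show "spinor (\<lambda>x. indicat_real (UNIV - A) x *\<^sub>R v) \<in> test_closure" .
    qed
  next
    case (union A)
    have A: "A i \<in> sets borel" for i using union.hyps(2) by (auto simp: G)
    show ?case
    proof
      fix v
      have part: "spinor (\<lambda>x. indicat_real (\<Union>i<n. A i) x *\<^sub>R v) \<in> test_closure" for n
      proof (induction n)
        case 0
        then show ?case using interval[of 0 0] by simp
      next
        case (Suc n)
        have "A n \<inter> A i = {}" if "i < n" for i
          using union.hyps(1) that by (auto simp: disjoint_family_on_def)
        then have "A n \<inter> (\<Union>i<n. A i) = {}" by blast
        then have "indicat_real (\<Union>i<Suc n. A i) x = indicat_real (\<Union>i<n. A i) x + indicat_real (A n) x" for x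
          by (auto simp: indicator_def lessThan_Suc)
        then have "spinor (\<lambda>x. indicat_real (\<Union>i<Suc n. A i) x *\<^sub>R v)
            = spinor (\<lambda>x. indicat_real (\<Union>i<n. A i) x *\<^sub>R v + indicat_real (A n) x *\<^sub>R v)"
          by (simp only: scaleR_left_distrib)
        also have "\<dots> = spinor (\<lambda>x. indicat_real (\<Union>i<n. A i) x *\<^sub>R v) + spinor (\<lambda>x. indicat_real (A n) x *\<^sub>R v)"
          using A by (intro spinor_add[symmetric] sq) auto
        also have "\<dots> \<in> test_closure"
          using Suc union.IH by (intro test_closure_add) auto
        finally show ?case .
      qed
      show "spinor (\<lambda>x. indicat_real (\<Union>i. A i) x *\<^sub>R v) \<in> test_closure"
      proof (rule test_closure_limit[OF part])
        show "(\<lambda>n. spinor (\<lambda>x. indicat_real (\<Union>i<n. A i) x *\<^sub>R v)) \<longlonglongrightarrow> spinor (\<lambda>x. indicat_real (\<Union>i. A i) x *\<^sub>R v)"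
        proof (rule spinor_dominated_convergence[where w="\<lambda>x. norm v"])
          show "integrable \<mu> (\<lambda>x. (norm v)\<^sup>2)"
            by (intro finite_measure.integrable_const finite_measure_lebesgue_on) simp
          show "(\<lambda>n. indicat_real (\<Union>i<n. A i) x *\<^sub>R v) \<longlonglongrightarrow> indicat_real (\<Union>i. A i) x *\<^sub>R v" for x
            by (intro tendsto_scaleR LIMSEQ_indicator_UN tendsto_const)
          show "sq_integrable (\<lambda>x. indicat_real (\<Union>i<n. A i) x *\<^sub>R v)" for n
            using A by (intro sq) auto
          show "sq_integrable (\<lambda>x. indicat_real (\<Union>i. A i) x *\<^sub>R v)"
            using A by (intro sq) auto
        qed (simp add: indicator_def)
      qed
    qed
  qed
qed

text \<open>A Lebesgue set differs from a Borel set within a null set, which a class in L2 does not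
  see.\<close>

lemma test_closure_indicator:
  assumes "A \<in> sets \<mu>"
  shows "spinor (\<lambda>x. indicat_real A x *\<^sub>R v) \<in> test_closure"
proof -
  obtain A' where A': "A' \<in> sets lebesgue" "A = I0 \<inter> A'" using assms by (auto simp: sets_restrict_space)
  then obtain S N N' where *: "A' = S \<union> N" "N \<subseteq> N'" "N' \<in> null_sets lborel" "S \<in> sets lborel"
    by (auto elim: sets_completionE)
  have "AE x in lebesgue. x \<notin> N'"
    using AE_not_in[OF *(3)] AE_completion by blast
  then have ae: "AE x in lebesgue. indicat_real A x = indicat_real (I0 \<inter> S) x"
    by eventually_elim (use A' * in \<open>auto simp: indicator_def\<close>)
  have "spinor (\<lambda>x. indicat_real A x *\<^sub>R v) = spinor (\<lambda>x. indicat_real (I0 \<inter> S) x *\<^sub>R v)"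
  proof (rule spinor_eqI)
    show "AE x in \<mu>. indicat_real A x *\<^sub>R v = indicat_real (I0 \<inter> S) x *\<^sub>R v"
      using ae by (subst AE_restrict_space_iff) auto
    show "sq_integrable (\<lambda>x. indicat_real A x *\<^sub>R v)"
      using assms A'(2) by (intro sq_integrable_indicator) (simp add: Int_absorb2)
    show "sq_integrable (\<lambda>x. indicat_real (I0 \<inter> S) x *\<^sub>R v)"
      using borel_imp_sets_\<mu>[of S] *(4)
      by (intro sq_integrable_indicator) (simp add: Int_commute Int_left_commute)
  qed
  then show ?thesis using test_closure_borel[of "I0 \<inter> S"] *(4) by auto
qed

text \<open>In the induction over nonnegative measurable functions, summands and approximants lie
  below the function itself and so inherit its square integrability.\<close>

lemma test_closure_nonneg:
  assumes "u \<in> borel_measurable \<mu>" "\<And>x. 0 \<le> u x"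
  shows "integrable \<mu> (\<lambda>x. (u x)\<^sup>2) \<Longrightarrow> spinor (\<lambda>x. u x *\<^sub>R v) \<in> test_closure"
  using assms
proof (induction rule: borel_measurable_induct_real)
  case (set A)
  then show ?case by (simp add: test_closure_indicator)
next
  case (mult u c)
  show ?case
  \<comment> \<open>For \<open>c = 0\<close> the integrability of the square of \<open>c * u\<close>
    says nothing about \<open>u\<close>, so the induction hypothesis is out of reach.\<close>
  proof (cases "c = 0")
    case True
    then show ?thesis using test_closure_indicator[of "{}" v] by simp
  next
    case False
    then have "integrable \<mu> (\<lambda>x. (u x)\<^sup>2)" using mult.prems by (simp add: power_mult_distrib)
    moreover from this have "sq_integrable (\<lambda>x. u x *\<^sub>R v)"
      using mult.hyps by (auto simp: sq_integrable_def power_mult_distrib)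
    ultimately show ?thesis
      using test_closure_scaleR[OF mult.IH, of c] by (simp add: spinor_scaleR)
  qed
next
  case (add u w)
  have sq: "integrable \<mu> (\<lambda>x. (u x)\<^sup>2)" "integrable \<mu> (\<lambda>x. (w x)\<^sup>2)"
    by (rule Bochner_Integration.integrable_bound[OF add.prems];
        use add.hyps in \<open>auto intro!: AE_I2 power_mono\<close>)+
  then have "sq_integrable (\<lambda>x. u x *\<^sub>R v)" "sq_integrable (\<lambda>x. w x *\<^sub>R v)"
    using add.hyps by (auto simp: sq_integrable_def power_mult_distrib)
  then show ?case
    using test_closure_add[OF add.IH(2)[OF sq(2)] add.IH(1)[OF sq(1)]] by (simp add: spinor_add scaleR_left_distrib)
next
  case (seq U)
  have le: "U i x \<le> u x" if "x \<in> I0" for i x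
    by (rule incseq_le[OF _ seq.hyps(4)]) (use seq.hyps(3) that in \<open>auto simp: incseq_def le_fun_def\<close>)
  have um: "u \<in> borel_measurable \<mu>"
    by (rule borel_measurable_LIMSEQ_real[OF seq.hyps(4) seq.hyps(1)])
  have U: "integrable \<mu> (\<lambda>x. (U i x)\<^sup>2)" for i
    by (rule Bochner_Integration.integrable_bound[OF seq.prems])
      (use seq.hyps le in \<open>auto intro!: AE_I2 power_mono\<close>)
  have sq: "sq_integrable (\<lambda>x. U n x *\<^sub>R v)" for n
    using U[of n] seq.hyps(1)[of n] by (auto simp: sq_integrable_def power_mult_distrib)
  show ?case
  proof (rule test_closure_limit[OF seq.IH[OF U]])
    show "(\<lambda>n. spinor (\<lambda>x. U n x *\<^sub>R v)) \<longlonglongrightarrow> spinor (\<lambda>x. u x *\<^sub>R v)"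
    proof (rule spinor_dominated_convergence[where w="\<lambda>x. u x * norm v"])
      show "sq_integrable (\<lambda>x. u x *\<^sub>R v)"
        using um seq.prems by (auto simp: sq_integrable_def power_mult_distrib)
      show "integrable \<mu> (\<lambda>x. (u x * norm v)\<^sup>2)"
        using seq.prems by (simp add: power_mult_distrib)
      show "(\<lambda>n. U n x *\<^sub>R v) \<longlonglongrightarrow> u x *\<^sub>R v" if "x \<in> I0" for x
        using that by (intro tendsto_scaleR seq.hyps(4) tendsto_const) simp
      show "norm (U n x *\<^sub>R v) \<le> u x * norm v" if "x \<in> I0" for n x
        using le[OF that, of n] seq.hyps(2)[of n x] by (auto intro!: mult_right_mono)
    qed (rule sq)
  qed
qed

lemma test_functions_dense: "closure (spinor ` test_functions) = UNIV"
proof -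
  have "\<Phi> \<in> test_closure" for \<Phi>
  proof -
    obtain f where f: "sq_integrable f" "\<Phi> = spinor f" using spinor_cases .
    have fm: "f \<in> borel_measurable \<mu>" and fi: "integrable \<mu> (\<lambda>x. (norm (f x))\<^sup>2)"
      using f by (auto simp: sq_integrable_def)
    have *: "spinor (\<lambda>x. max 0 (f x \<bullet> b) *\<^sub>R v) \<in> test_closure \<and> sq_integrable (\<lambda>x. max 0 (f x \<bullet> b) *\<^sub>R v)"
      if "norm b = 1" for b v
    proof -
      have m: "(\<lambda>x. max 0 (f x \<bullet> b)) \<in> borel_measurable \<mu>" using fm by measurable
      have "\<bar>max 0 (f x \<bullet> b)\<bar> \<le> \<bar>norm (f x)\<bar>" for x
        using norm_cauchy_schwarz[of "f x" b] that by simp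
      then have "(max 0 (f x \<bullet> b))\<^sup>2 \<le> (norm (f x))\<^sup>2" for x
        by (simp add: abs_le_square_iff)
      then have i: "integrable \<mu> (\<lambda>x. (max 0 (f x \<bullet> b))\<^sup>2)"
        using m by (intro Bochner_Integration.integrable_bound[OF fi]) auto
      then show ?thesis
        using m test_closure_nonneg[OF m _ i, of v] by (auto simp: sq_integrable_def power_mult_distrib)
    qed
    have **: "spinor (\<lambda>x. (f x \<bullet> b) *\<^sub>R b) \<in> test_closure \<and> sq_integrable (\<lambda>x. (f x \<bullet> b) *\<^sub>R b)" if "b \<in> Basis" for b
    proof -
      \<comment> \<open>The negative part of a coordinate along \<open>b\<close> is its positive
        part along \<open>-b\<close>, so only nonnegative coefficients occur.\<close>
      have "(\<lambda>x. max 0 (f x \<bullet> b) *\<^sub>R b + max 0 (f x \<bullet> (-b)) *\<^sub>R (-b)) = (\<lambda>x. (f x \<bullet> b) *\<^sub>R b)"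
        by (auto simp: max_def)
      moreover have "norm b = 1" "norm (-b) = 1" using that by auto
      note *[OF this(1), of b] and *[OF this(2), of "-b"]
      ultimately show ?thesis
        using test_closure_add[of "spinor (\<lambda>x. max 0 (f x \<bullet> b) *\<^sub>R b)" "spinor (\<lambda>x. max 0 (f x \<bullet> (-b)) *\<^sub>R (-b))"]
          sq_integrable_add[of "\<lambda>x. max 0 (f x \<bullet> b) *\<^sub>R b" "\<lambda>x. max 0 (f x \<bullet> (-b)) *\<^sub>R (-b)"]
        by (simp only: spinor_add)
    qed
    have "spinor (\<lambda>x. \<Sum>b\<in>B. (f x \<bullet> b) *\<^sub>R b) \<in> test_closure \<and> sq_integrable (\<lambda>x. \<Sum>b\<in>B. (f x \<bullet> b) *\<^sub>R b)"
      if "finite B" "B \<subseteq> Basis" for B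
      using that
    proof (induction B rule: finite_induct)
      case empty
      then show ?case using test_closure_indicator[of "{}" 0] by (simp add: sq_integrable_def)
    next
      case (insert b B)
      then show ?case
        using **[of b] test_closure_add[of "spinor (\<lambda>x. (f x \<bullet> b) *\<^sub>R b)" "spinor (\<lambda>x. \<Sum>b\<in>B. (f x \<bullet> b) *\<^sub>R b)"]
          sq_integrable_add[of "(\<lambda>x. (f x \<bullet> b) *\<^sub>R b)" "\<lambda>x. \<Sum>b\<in>B. (f x \<bullet> b) *\<^sub>R b"]
        by (simp add: spinor_add)
    qed
    from this[OF finite_Basis order_refl] show ?thesis by (simp add: euclidean_representation f)
  qed
  then show ?thesis by (auto simp: test_closure_def)
qed

text \<open>The kernel of \<open>inner \<Phi>\<close> is closed and contains a dense set, so
  \<open>\<Phi>\<close> is orthogonal to itself.\<close>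

lemma orthogonal_test_functions_imp_zero:
  assumes "\<And>\<phi>. \<phi> \<in> test_functions \<Longrightarrow> cinner \<Phi> (spinor \<phi>) = 0"
  shows "\<Phi> = 0"
proof -
  have "closed {\<xi>. inner \<Phi> \<xi> = 0}" by (intro closed_Collect_eq continuous_intros)
  then have "closure (spinor ` test_functions) \<subseteq> {\<xi>. inner \<Phi> \<xi> = 0}"
    using assms by (intro closure_minimal) (auto simp: inner_spinorL2_def)
  then have "UNIV \<subseteq> {\<xi>. inner \<Phi> \<xi> = 0}" by (simp only: test_functions_dense)
  then have "inner \<Phi> \<Phi> = 0" by blast
  then show ?thesis by (simp only: inner_eq_zero_iff)
qed


section \<open>Scalar square-integrable functions and primitives\<close>

definition sqi :: "(real \<Rightarrow> complex) \<Rightarrow> bool" where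
  "sqi f \<longleftrightarrow> f \<in> borel_measurable \<mu> \<and> integrable \<mu> (\<lambda>x. (cmod (f x))\<^sup>2)"

lemma sq_integrable_iff_sqi:
  "sq_integrable f \<longleftrightarrow> sqi (\<lambda>x. f x $ 1) \<and> sqi (\<lambda>x. f x $ 2)"
proof
  assume f: "sq_integrable f"
  then have fm: "f \<in> borel_measurable \<mu>" and fi: "integrable \<mu> (\<lambda>x. (norm (f x))\<^sup>2)"
    by (auto simp: sq_integrable_def)
  have "sqi (\<lambda>x. f x $ i)" for i
    unfolding sqi_def
  proof
    show m: "(\<lambda>x. f x $ i) \<in> borel_measurable \<mu>" by (rule borel_measurable_vec_nth[OF fm])
    show "integrable \<mu> (\<lambda>x. (cmod (f x $ i))\<^sup>2)"
    proof (rule Bochner_Integration.integrable_bound[OF fi])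
      show "(\<lambda>x. (cmod (f x $ i))\<^sup>2) \<in> borel_measurable \<mu>" using m by measurable
    qed (auto intro!: AE_I2 power_mono Finite_Cartesian_Product.norm_nth_le)
  qed
  then show "sqi (\<lambda>x. f x $ 1) \<and> sqi (\<lambda>x. f x $ 2)" by blast
next
  assume "sqi (\<lambda>x. f x $ 1) \<and> sqi (\<lambda>x. f x $ 2)"
  then have m: "(\<lambda>x. f x $ 1) \<in> borel_measurable \<mu>" "(\<lambda>x. f x $ 2) \<in> borel_measurable \<mu>"
    and i: "integrable \<mu> (\<lambda>x. (cmod (f x $ 1))\<^sup>2)" "integrable \<mu> (\<lambda>x. (cmod (f x $ 2))\<^sup>2)"
    by (auto simp: sqi_def)
  have ax: "(\<lambda>x. axis j (g x) :: complex^2) \<in> borel_measurable \<mu>" if "g \<in> borel_measurable \<mu>" for j g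
  proof -
    have "bounded_linear (\<lambda>z. axis j z :: complex^2)"
      unfolding linear_conv_bounded_linear[symmetric]
      by (auto intro!: linearI simp: axis_def vec_eq_iff)
    then have "continuous_on UNIV (\<lambda>z. axis j z :: complex^2)"
      by (simp add: linear_continuous_on)
    then show ?thesis using that by (rule borel_measurable_continuous_on)
  qed
  have "(\<lambda>x. axis 1 (f x $ 1) + axis 2 (f x $ 2)) = f"
    by (auto simp: fun_eq_iff vec_eq_iff axis_def forall_2)
  then have "f \<in> borel_measurable \<mu>"
    using borel_measurable_add[OF ax[OF m(1), of 1] ax[OF m(2), of 2]] by simp
  moreover have "(norm (f x))\<^sup>2 = (cmod (f x $ 1))\<^sup>2 + (cmod (f x $ 2))\<^sup>2" for x
    by (simp add: norm_vec_def L2_set_def sum_2)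
  ultimately show "sq_integrable f" using i by (simp add: sq_integrable_def)
qed

lemma sqi_cnj_iff: "sqi (\<lambda>x. cnj (f x)) \<longleftrightarrow> sqi f"
proof -
  have "(\<lambda>x. cnj (g x)) \<in> borel_measurable \<mu>" if "g \<in> borel_measurable \<mu>" for g
    using continuous_on_cnj[OF continuous_on_id] that by (rule borel_measurable_continuous_on)
  from this[of f] this[of "\<lambda>x. cnj (f x)"]
  have "(\<lambda>x. cnj (f x)) \<in> borel_measurable \<mu> \<longleftrightarrow> f \<in> borel_measurable \<mu>"
    unfolding complex_cnj_cnj by blast
  then show ?thesis by (simp add: sqi_def)
qed

lemma sqi_add: "sqi f \<Longrightarrow> sqi g \<Longrightarrow> sqi (\<lambda>x. f x + g x)"
  using sq_integrable_add[of "\<lambda>x. \<chi> i. f x" "\<lambda>x. \<chi> i. g x"] by (simp add: sq_integrable_iff_sqi)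

lemma sqi_bounded_mult:
  assumes "sqi g" "h \<in> borel_measurable \<mu>" "\<And>x. x \<in> I0 \<Longrightarrow> cmod (h x) \<le> B"
  shows "sqi (\<lambda>x. h x * g x)"
proof -
  have gm: "g \<in> borel_measurable \<mu>" and gi: "integrable \<mu> (\<lambda>x. B\<^sup>2 * (cmod (g x))\<^sup>2)"
    using assms(1) by (auto simp: sqi_def)
  have "integrable \<mu> (\<lambda>x. (cmod (h x * g x))\<^sup>2)"
  proof (rule Bochner_Integration.integrable_bound[OF gi])
    show "(\<lambda>x. (cmod (h x * g x))\<^sup>2) \<in> borel_measurable \<mu>" using gm assms(2) by measurable
    show "AE x in \<mu>. norm ((cmod (h x * g x))\<^sup>2) \<le> norm (B\<^sup>2 * (cmod (g x))\<^sup>2)"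
      using power_mono[OF assms(3) norm_ge_zero, of _ 2]
      by (intro AE_I2) (auto simp: norm_mult power_mult_distrib intro!: mult_right_mono)
  qed
  then show ?thesis using gm assms(2) by (auto simp: sqi_def)
qed

lemma sqi_cmult: "sqi g \<Longrightarrow> sqi (\<lambda>x. c * g x)"
  by (rule sqi_bounded_mult[where B="cmod c"]) auto

lemma sqi_minus_iff: "sqi (\<lambda>x. - g x) \<longleftrightarrow> sqi g"
  using sqi_cmult[of g "-1"] sqi_cmult[of "\<lambda>x. - g x" "-1"] by auto

lemma sqi_diff: "sqi f \<Longrightarrow> sqi g \<Longrightarrow> sqi (\<lambda>x. f x - g x)"
  using sqi_add[of f "\<lambda>x. - g x"] by (simp add: sqi_minus_iff)

lemma sqi_bounded:
  assumes "h \<in> borel_measurable \<mu>" "\<And>x. x \<in> I0 \<Longrightarrow> cmod (h x) \<le> B"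
  shows "sqi h"
proof -
  have "sqi (\<lambda>_. 1)"
    by (simp add: sqi_def finite_measure.integrable_const finite_measure_lebesgue_on)
  from sqi_bounded_mult[OF this assms] show ?thesis by simp
qed

text \<open>Both functions are placed in the first component of a spinor, where
  \<open>integrable_hdot\<close> applies.\<close>

lemma sqi_integrable_mult:
  assumes "sqi f" "sqi g" shows "integrable \<mu> (\<lambda>x. f x * g x)"
proof -
  have sq: "sq_integrable (\<lambda>x. axis 1 (cnj (f x)))" "sq_integrable (\<lambda>x. axis 1 (g x))"
    using assms sqi_cnj_iff[of f] sqi_bounded[of "\<lambda>_. 0"] by (auto simp: sq_integrable_iff_sqi axis_def)
  have "integrable \<mu> (\<lambda>x. hdot (axis 1 (cnj (f x))) (axis 1 (g x) :: complex^2))"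
    by (rule integrable_hdot[OF sq])
  then show ?thesis by (simp add: hdot_def sum_2 axis_def)
qed

lemma sqi_integrable: assumes "sqi f" shows "integrable \<mu> f"
  using sqi_integrable_mult[OF assms sqi_bounded[of "\<lambda>_. 1" 1]] by simp

lemma test_fun_sqi: "\<zeta> \<in> test_fun \<Longrightarrow> sqi \<zeta>"
  using test_functions_sq_integrable[of "\<lambda>x. axis 1 (\<zeta> x)"] test_fun_0
  by (simp add: test_functions_iff sq_integrable_iff_sqi axis_def)

section \<open>Square integrability of powers of the weight\<close>

lemma cot_le: "0 < y \<Longrightarrow> y < pi/2 \<Longrightarrow> (cos y)\<^sup>2 / (sin y)\<^sup>2 \<le> 1 / y\<^sup>2"
proof -
  assume y: "0 < y" "y < pi/2"
  have c: "cos y > 0" and s: "sin y > 0" using y by (auto intro!: cos_gt_zero sin_gt_zero)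
  have "y \<le> tan y" using abs_tan_ge[of y] y c s by (simp add: tan_def)
  then have "cos y * y \<le> sin y" using c by (simp add: tan_def field_simps)
  then have "(cos y * y)\<^sup>2 \<le> (sin y)\<^sup>2" using c y by (intro power_mono) auto
  then show ?thesis using s y by (simp add: field_simps power_mult_distrib)
qed

text \<open>In the half angle \<open>y = (pi/2 + x) / 2\<close> the weight is the cotangent of
  \<open>y\<close>, which is at most \<open>1 / y\<close> since \<open>y <= tan y\<close>.\<close>

lemma \<sigma>_le: 
  assumes x: "x \<in> I0" shows "\<sigma> x \<le> inverse ((pi/2 + x) / 2)"
proof -
  define y where "y = (pi/2 + x) / 2"
  have y: "0 < y" "y < pi/2" using x by (auto simp: y_def)
  have "2 * y = pi/2 + x" by (simp add: y_def)
  then have "sin x = - cos (2 * y)" by (simp only: cos_add) simp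
  then have "1 - sin x = 2 * (cos y)\<^sup>2" "1 + sin x = 2 * (sin y)\<^sup>2"
    by (simp_all add: cos_double_cos cos_double_sin) (simp add: sin_squared_eq)
  then have "\<sigma> x = sqrt ((cos y)\<^sup>2 / (sin y)\<^sup>2)" by (simp add: \<sigma>_def)
  also have "\<dots> \<le> sqrt (1 / y\<^sup>2)" using cot_le[OF y] by simp
  also have "\<dots> = inverse y"
    using y by (intro real_sqrt_unique) (auto simp: power_divide inverse_eq_divide)
  finally show ?thesis by (simp add: y_def)
qed

lemma \<sigma>_minus: "\<sigma> (- x) = inverse (\<sigma> x)"
  by (simp add: \<sigma>_def real_sqrt_divide)

text \<open>A positive power is singular only at the left end; the reflection \<open>x\<close> to
  \<open>-x\<close> inverts \<open>\<sigma>\<close> and handles negative powers. The sum of both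
  endpoint bounds covers either sign.\<close>

lemma \<sigma>_powr_le:
  assumes x: "x \<in> I0"
  shows "\<sigma> x powr p \<le> ((pi/2 + x) / 2) powr - \<bar>p\<bar> + ((pi/2 - x) / 2) powr - \<bar>p\<bar>"
proof -
  have *: "\<sigma> y powr q \<le> ((pi/2 + y) / 2) powr - q" if "y \<in> I0" "q \<ge> 0" for y q
  proof -
    have "\<sigma> y powr q \<le> inverse ((pi/2 + y) / 2) powr q"
      using \<sigma>_pos[OF that(1)] by (intro powr_mono2 that \<sigma>_le) auto
    also have "\<dots> = ((pi/2 + y) / 2) powr - q"
      using that by (subst powr_minus, subst inverse_powr) auto
    finally show ?thesis .
  qed
  show ?thesis
  proof (cases "p \<ge> 0")
    case True
    then show ?thesis using *[OF x True] by (smt (verit) powr_ge_zero)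
  next
    case False
    have "\<sigma> x powr p = \<sigma> (- x) powr (- p)"
      using \<sigma>_pos[OF x] by (simp add: \<sigma>_minus inverse_powr powr_minus)
    also have "\<dots> \<le> ((pi/2 - x) / 2) powr - \<bar>p\<bar>" using *[of "-x" "-p"] x False by simp
    finally show ?thesis by (smt (verit) powr_ge_zero)
  qed
qed

lemma integrable_endpoint_powr:
  assumes e: "e = 1 \<or> e = -1" and q: "q < 1"
  shows "integrable \<mu> (\<lambda>x. ((pi/2 + e * x) / 2) powr - q)"
proof -
  let ?f = "\<lambda>x. ((pi/2 + e * x) / 2) powr - q"
  let ?J = "{-(pi/2)..pi/2}"
  \<comment> \<open>This primitive is continuous up to both ends because \<open>1 - q > 0\<close>.
    As \<open>e\<close> is 1 or -1, the factor \<open>e * 2\<close> is the reciprocal of the inner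
    slope \<open>e / 2\<close>.\<close>
  let ?F = "\<lambda>x. e * 2 / (1 - q) * ((pi/2 + e * x) / 2) powr (1 - q)"
  have "(?f has_integral (?F (pi/2) - ?F (-(pi/2)))) ?J"
  proof (rule fundamental_theorem_of_calculus_interior)
    show "continuous_on ?J ?F"
      using e q by (intro continuous_intros continuous_on_powr') auto
    show "(?F has_vector_derivative ?f x) (at x)" if "x \<in> {-(pi/2)<..<pi/2}" for x
    proof -
      have pos: "(pi/2 + e * x) / 2 > 0" using e that by auto
      then have "((\<lambda>x. ((pi/2 + e * x) / 2) powr (1 - q)) has_real_derivative
          (1 - q) * ((pi/2 + e * x) / 2) powr ((1 - q) - 1) * (e / 2)) (at x)"
        by (intro DERIV_fun_powr[where r="1 - q", THEN DERIV_cong]) (auto intro!: derivative_eq_intros)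
      from DERIV_cmult[OF this, of "e * 2 / (1 - q)"]
      show ?thesis
        unfolding has_real_derivative_iff_has_vector_derivative[symmetric]
        by (rule DERIV_cong) (use e q in \<open>auto simp: field_simps\<close>)
    qed
  qed simp
  then have "?f integrable_on ?J" by blast
  then have "?f absolutely_integrable_on ?J" by (rule nonnegative_absolutely_integrable_1) simp
  then have "?f absolutely_integrable_on I0" by (rule set_integrable_subset) auto
  then show ?thesis by (simp add: set_integrable_def integrable_restrict_space)
qed

lemma \<sigma>_powr_continuous: "continuous_on I0 (\<lambda>x. \<sigma> x powr a)"
  by (intro continuous_at_imp_continuous_on ballI) (blast intro: DERIV_isCont \<sigma>_powr_deriv)

lemma \<sigma>_powr_measurable: "(\<lambda>x. \<sigma> x powr a) \<in> borel_measurable \<mu>"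
  by (rule continuous_imp_measurable_on_sets_lebesgue[OF \<sigma>_powr_continuous]) simp

text \<open>Squaring doubles the exponent, and \<open>|2 a| < 1\<close> is what
  \<open>integrable_endpoint_powr\<close> asks for at each end. The bound 1/2 on the mass enters
  through this estimate.\<close>

lemma sqi_\<sigma>_powr:
  assumes "\<bar>a\<bar> < 1/2" shows "sqi (\<lambda>x. of_real (\<sigma> x powr a))"
proof -
  have m: "(\<lambda>x. \<sigma> x powr b) \<in> borel_measurable \<mu>" for b by (rule \<sigma>_powr_measurable)
  have "integrable \<mu> (\<lambda>x. \<sigma> x powr (2 * a))"
  proof (rule Bochner_Integration.integrable_bound)
    show "integrable \<mu> (\<lambda>x. ((pi/2 + x) / 2) powr - \<bar>2 * a\<bar> + ((pi/2 - x) / 2) powr - \<bar>2 * a\<bar>)"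
      using integrable_endpoint_powr[of 1 "\<bar>2*a\<bar>"] integrable_endpoint_powr[of "-1" "\<bar>2*a\<bar>"] assms
      by (intro Bochner_Integration.integrable_add) auto
    show "AE x in \<mu>. norm (\<sigma> x powr (2 * a)) \<le> norm (((pi/2 + x) / 2) powr - \<bar>2 * a\<bar> + ((pi/2 - x) / 2) powr - \<bar>2 * a\<bar>)"
      using \<sigma>_powr_le[of _ "2 * a"] by (intro AE_I2) (simp add: abs_of_nonneg)
  qed (rule m)
  moreover have "(cmod (of_real (\<sigma> x powr a)))\<^sup>2 = \<sigma> x powr (2 * a)" for x
    by (simp add: power2_eq_square flip: powr_add)
  ultimately show ?thesis using m by (simp add: sqi_def)
qed

section \<open>Primitives and integration by parts\<close>

definition prim :: "(real \<Rightarrow> complex) \<Rightarrow> real \<Rightarrow> complex" where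
  "prim h r = (LINT t|\<mu>. indicator {..r} t *\<^sub>R h t)"

lemma indicator_atMost_measurable: "(indicator {..r} :: real \<Rightarrow> real) \<in> borel_measurable \<mu>"
  by (simp add: borel_measurable_indicator_iff borel_imp_sets_\<mu>)

lemma integrable_indicator_scaleR:
  fixes h :: "real \<Rightarrow> complex"
  assumes "integrable \<mu> h" shows "integrable \<mu> (\<lambda>t. indicat_real {..r} t *\<^sub>R h t)"
proof (rule Bochner_Integration.integrable_bound[OF assms])
  show "(\<lambda>t. indicat_real {..r} t *\<^sub>R h t) \<in> borel_measurable \<mu>"
    using assms indicator_atMost_measurable by (intro borel_measurable_scaleR) auto
qed (auto simp: indicator_def)

lemma prim_left: "prim h (-(pi/2)) = 0"
proof -
  have "prim h (-(pi/2)) = (LINT t|\<mu>. 0)"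
    unfolding prim_def by (rule Bochner_Integration.integral_cong) auto
  then show ?thesis by simp
qed

lemma prim_right: "prim h (pi/2) = (LINT t|\<mu>. h t)"
  unfolding prim_def by (rule Bochner_Integration.integral_cong) auto

text \<open>The indicator form of \<open>prim\<close> is suited to Fubini; this bridge to the
  integral over an interval supplies continuity and derivatives. The two domains differ in endpoints
  only.\<close>

lemma prim_eq_integral:
  assumes h: "integrable \<mu> h" and r: "r \<in> {-(pi/2)..pi/2}"
  shows "prim h r = integral {-(pi/2)..r} h"
proof -
  have "prim h r = integral I0 (\<lambda>t. indicat_real {..r} t *\<^sub>R h t)"
    unfolding prim_def by (rule lebesgue_integral_eq_integral[OF integrable_indicator_scaleR[OF h]]) simp
  also have "\<dots> = integral I0 (\<lambda>t. if t \<in> {..r} then h t else 0)"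
    by (rule Henstock_Kurzweil_Integration.integral_cong) (auto simp: indicator_def)
  also have "\<dots> = integral ({..r} \<inter> I0) h"
    by (rule Henstock_Kurzweil_Integration.integral_restrict_Int)
  also have "\<dots> = integral {-(pi/2)..r} h"
  proof (rule integral_spike_set)
    show "negligible {x \<in> {..r} \<inter> I0 - {-(pi/2)..r}. h x \<noteq> 0}"
      by (rule negligible_subset[of "{}"]) auto
    show "negligible {x \<in> {-(pi/2)..r} - {..r} \<inter> I0. h x \<noteq> 0}"
      by (rule negligible_subset[of "{-(pi/2), pi/2}"]) (use r in auto)
  qed
  finally show ?thesis .
qed

lemma prim_continuous:
  assumes h: "integrable \<mu> h" shows "continuous_on {-(pi/2)..pi/2} (prim h)"
proof -
  have "h integrable_on I0" by (rule integrable_on_lebesgue_on[OF h]) simp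
  then have "h integrable_on {-(pi/2)..pi/2}"
    using integrable_on_open_interval[of h "-(pi/2)" "pi/2"] by (simp add: box_real)
  then have "continuous_on {-(pi/2)..pi/2} (\<lambda>r. integral {-(pi/2)..r} h)"
    by (rule indefinite_integral_continuous_1)
  then show ?thesis by (rule continuous_on_eq) (simp add: prim_eq_integral[OF h])
qed

lemma prim_measurable: "integrable \<mu> h \<Longrightarrow> prim h \<in> borel_measurable \<mu>"
  by (rule continuous_imp_measurable_on_sets_lebesgue[OF continuous_on_subset[OF prim_continuous]]) auto

lemma prim_bound: "integrable \<mu> h \<Longrightarrow> cmod (prim h r) \<le> (LINT t|\<mu>. cmod (h t))"
proof -
  assume h: "integrable \<mu> h"
  have "cmod (prim h r) \<le> (LINT t|\<mu>. norm (indicat_real {..r} t *\<^sub>R h t))"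
    unfolding prim_def by (rule integral_norm_bound)
  also have "\<dots> \<le> (LINT t|\<mu>. cmod (h t))"
    by (intro integral_mono integrable_norm integrable_indicator_scaleR h) (auto simp: indicator_def)
  finally show ?thesis .
qed

lemma integrable_prim_mult:
  assumes "integrable \<mu> f" "integrable \<mu> g" shows "integrable \<mu> (\<lambda>x. prim f x * g x)"
proof (rule Bochner_Integration.integrable_bound)
  show "integrable \<mu> (\<lambda>x. (LINT t|\<mu>. cmod (f t)) * cmod (g x))"
    using assms by (intro integrable_mult_right integrable_norm)
  show "(\<lambda>x. prim f x * g x) \<in> borel_measurable \<mu>"
    using assms by (intro borel_measurable_times prim_measurable) auto
  show "AE x in \<mu>. norm (prim f x * g x) \<le> norm ((LINT t|\<mu>. cmod (f t)) * cmod (g x))"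
    using prim_bound[OF assms(1)] by (intro AE_I2) (auto simp: norm_mult intro!: mult_right_mono order_trans[OF prim_bound[OF assms(1)]])
qed

text \<open>Fubini for \<open>f t * g x\<close> on the triangle \<open>t <= x\<close>: integrating
  over \<open>x\<close> first leaves the total integral of \<open>g\<close> minus
  \<open>prim g t\<close>. Only integrability of \<open>f\<close> and \<open>g\<close> is involved,
  no pointwise derivative.\<close>

lemma prim_by_parts:
  assumes f: "integrable \<mu> f" and g: "integrable \<mu> g"
  shows "(LINT x|\<mu>. prim f x * g x) + (LINT x|\<mu>. f x * prim g x) = (LINT x|\<mu>. f x) * (LINT x|\<mu>. g x)"
proof -
  interpret finite_measure \<mu> by (rule finite_measure_lebesgue_on) simp
  interpret P: pair_sigma_finite \<mu> \<mu> ..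
  define k where "k x t = indicat_real {..x} t *\<^sub>R (f t * g x)" for x t
  have fm: "f \<in> borel_measurable \<mu>" and gm: "g \<in> borel_measurable \<mu>" using f g by auto
  have km: "case_prod k \<in> borel_measurable (\<mu> \<Otimes>\<^sub>M \<mu>)"
  proof -
    have id: "(\<lambda>x. x) \<in> borel_measurable \<mu>"
      by (rule continuous_imp_measurable_on_sets_lebesgue) auto
    have 1: "(\<lambda>z. fst z) \<in> borel_measurable (\<mu> \<Otimes>\<^sub>M \<mu>)" "(\<lambda>z. snd z) \<in> borel_measurable (\<mu> \<Otimes>\<^sub>M \<mu>)"
      using measurable_compose[OF measurable_fst id] measurable_compose[OF measurable_snd id] by auto
    have "{z \<in> space (\<mu> \<Otimes>\<^sub>M \<mu>). snd z \<le> fst z} \<in> sets (\<mu> \<Otimes>\<^sub>M \<mu>)"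
      using 1 by (intro borel_measurable_le)
    then have "indicat_real {z \<in> space (\<mu> \<Otimes>\<^sub>M \<mu>). snd z \<le> fst z} \<in> borel_measurable (\<mu> \<Otimes>\<^sub>M \<mu>)"
      by (rule borel_measurable_indicator)
    moreover have "(\<lambda>z. f (snd z) * g (fst z)) \<in> borel_measurable (\<mu> \<Otimes>\<^sub>M \<mu>)"
      using measurable_compose[OF measurable_fst gm] measurable_compose[OF measurable_snd fm] by (intro borel_measurable_times)
    ultimately have "(\<lambda>z. indicat_real {z \<in> space (\<mu> \<Otimes>\<^sub>M \<mu>). snd z \<le> fst z} z *\<^sub>R (f (snd z) * g (fst z)))
        \<in> borel_measurable (\<mu> \<Otimes>\<^sub>M \<mu>)"
      by (rule borel_measurable_scaleR)
    moreover have "case_prod k z = indicat_real {z \<in> space (\<mu> \<Otimes>\<^sub>M \<mu>). snd z \<le> fst z} z *\<^sub>R (f (snd z) * g (fst z))"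
      if "z \<in> space (\<mu> \<Otimes>\<^sub>M \<mu>)" for z
      using that by (cases z) (auto simp: k_def indicator_def)
    ultimately show ?thesis by (subst measurable_cong) 
  qed
  have ki: "integrable \<mu> (\<lambda>t. k x t)" for x
    unfolding k_def by (intro integrable_indicator_scaleR integrable_mult_left f) 
  have kint: "integrable (\<mu> \<Otimes>\<^sub>M \<mu>) (case_prod k)"
  proof (rule P.Fubini_integrable[OF km])
    show "AE x in \<mu>. integrable \<mu> (\<lambda>y. case_prod k (x, y))" using ki by simp
    show "integrable \<mu> (\<lambda>x. LINT y|\<mu>. norm (case_prod k (x, y)))"
    proof (rule Bochner_Integration.integrable_bound)
      show "integrable \<mu> (\<lambda>x. (LINT t|\<mu>. cmod (f t)) * cmod (g x))"
        using g by (intro integrable_mult_right integrable_norm)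
      have "(\<lambda>z. norm (case_prod k z)) \<in> borel_measurable (\<mu> \<Otimes>\<^sub>M \<mu>)" using km by measurable
      then show "(\<lambda>x. LINT y|\<mu>. norm (case_prod k (x, y))) \<in> borel_measurable \<mu>"
        by (intro borel_measurable_lebesgue_integral) (simp add: split_beta')
      have "(LINT y|\<mu>. norm (k x y)) \<le> (LINT t|\<mu>. cmod (f t)) * cmod (g x)" for x
      proof -
        have "(LINT y|\<mu>. norm (k x y)) \<le> (LINT t|\<mu>. cmod (f t) * cmod (g x))"
          using ki f by (intro integral_mono integrable_norm integrable_mult_left)
            (auto simp: k_def indicator_def norm_mult)
        then show ?thesis by simp
      qed
      moreover have "0 \<le> (LINT y|\<mu>. norm (k x y))" for x by (rule integral_nonneg_AE) simp
      ultimately show "AE x in \<mu>. norm (LINT y|\<mu>. norm (case_prod k (x, y))) \<le> norm ((LINT t|\<mu>. cmod (f t)) * cmod (g x))"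
        by (intro AE_I2) (auto intro: order_trans)
    qed
  qed
  have "(LINT x|\<mu>. prim f x * g x) = (LINT x|\<mu>. LINT t|\<mu>. k x t)"
    by (simp add: prim_def k_def flip: integral_mult_left_zero)
  also have "\<dots> = (LINT t|\<mu>. LINT x|\<mu>. k x t)" by (rule P.Fubini_integral[OF kint, symmetric])
  also have "\<dots> = (LINT t|\<mu>. f t * ((LINT x|\<mu>. g x) - prim g t))"
  proof (rule Bochner_Integration.integral_cong[OF refl])
    fix t
    \<comment> \<open>The section of the triangle contains \<open>x = t\<close>, while the
      complement of \<open>{..t}\<close> does not; this single point is null.\<close>
    have "AE x::real in lebesgue. x \<noteq> t"
      by (rule AE_not_in[of "{t}" lebesgue, simplified])
    then have "AE x in \<mu>. x \<noteq> t" by (subst AE_restrict_space_iff) auto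
    then have "AE x in \<mu>. k x t = f t * (g x - indicat_real {..t} x *\<^sub>R g x)"
      by eventually_elim (auto simp: k_def indicator_def)
    moreover have "(\<lambda>x. k x t) \<in> borel_measurable \<mu>"
    proof -
      have "(\<lambda>x. indicat_real {..x} t) = indicat_real {t..}" by (auto simp: indicator_def)
      moreover have "indicat_real {t..} \<in> borel_measurable \<mu>"
        by (simp add: borel_measurable_indicator_iff borel_imp_sets_\<mu>)
      ultimately show ?thesis
        unfolding k_def using gm by (intro borel_measurable_scaleR borel_measurable_times) simp_all
    qed
    ultimately have "(LINT x|\<mu>. k x t) = (LINT x|\<mu>. f t * (g x - indicat_real {..t} x *\<^sub>R g x))"
      using g integrable_indicator_scaleR[OF g] by (intro integral_cong_AE) auto
    also have "\<dots> = f t * ((LINT x|\<mu>. g x) - prim g t)"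
      using g integrable_indicator_scaleR[OF g] by (simp add: prim_def)
    finally show "(LINT x|\<mu>. k x t) = f t * ((LINT x|\<mu>. g x) - prim g t)" .
  qed
  also have "\<dots> = (LINT t|\<mu>. f t * (LINT x|\<mu>. g x)) - (LINT t|\<mu>. f t * prim g t)"
    using f integrable_prim_mult[OF g f]
    by (simp add: right_diff_distrib mult.commute)
  finally show ?thesis by simp
qed

text \<open>The product rule for the absolutely continuous functions \<open>c + prim f\<close> and
  \<open>d + prim g\<close>, whose values at the left end are \<open>c\<close> and
  \<open>d\<close>.\<close>

lemma by_parts:
  assumes f: "integrable \<mu> f" and g: "integrable \<mu> g"
  shows "(LINT x|\<mu>. (c + prim f x) * g x + f x * (d + prim g x))
    = (c + prim f (pi/2)) * (d + prim g (pi/2)) - c * d"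
proof -
  have i: "integrable \<mu> (\<lambda>x. prim f x * g x)" "integrable \<mu> (\<lambda>x. f x * prim g x)"
    using integrable_prim_mult[OF f g] integrable_prim_mult[OF g f] by (simp_all add: mult.commute)
  have "(LINT x|\<mu>. (c + prim f x) * g x + f x * (d + prim g x))
    = (LINT x|\<mu>. c * g x + f x * d + (prim f x * g x + f x * prim g x))"
    by (simp add: algebra_simps)
  also have "\<dots> = c * (LINT x|\<mu>. g x) + (LINT x|\<mu>. f x) * d + (LINT x|\<mu>. f x) * (LINT x|\<mu>. g x)"
    using f g i by (simp flip: prim_by_parts[OF f g])
  finally show ?thesis by (simp add: prim_right algebra_simps)
qed


section \<open>Weak solutions and the adjoint\<close>

lemma sqi_cong: "(\<And>x. x \<in> I0 \<Longrightarrow> f x = g x) \<Longrightarrow> sqi f \<longleftrightarrow> sqi g"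
  unfolding sqi_def
  by (intro arg_cong2[where f="(\<and>)"] measurable_cong Bochner_Integration.integrable_cong) auto

lemma \<sigma>_powr_mult_deriv:
  fixes \<zeta> :: "real \<Rightarrow> complex"
  assumes x: "x \<in> I0" and \<zeta>: "(\<zeta> has_vector_derivative \<zeta>') (at x)"
  shows "((\<lambda>x. of_real (\<sigma> x powr a) * \<zeta> x) has_vector_derivative
    of_real (\<sigma> x powr a) * (\<zeta>' - of_real (a / cos x) * \<zeta> x)) (at x)"
proof -
  have "((\<lambda>x. complex_of_real (\<sigma> x powr a)) has_vector_derivative of_real (- (a / cos x) * \<sigma> x powr a)) (at x)"
    using \<sigma>_powr_deriv[OF x, of a] unfolding has_real_derivative_iff_has_vector_derivative
    by (rule bounded_linear.has_vector_derivative[OF bounded_linear_of_real])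
  from has_vector_derivative_mult[OF this \<zeta>] show ?thesis
    by (rule has_vector_derivative_eq_rhs) (simp add: algebra_simps)
qed

lemma \<sigma>_powr_cancel: 
  assumes "x \<in> I0" 
  shows "complex_of_real (\<sigma> x powr a) * (of_real (\<sigma> x powr - a) * z) = z"
    "complex_of_real (\<sigma> x powr - a) * (of_real (\<sigma> x powr a) * z) = z"
proof -
  have "\<sigma> x powr a * \<sigma> x powr - a = 1"
    using \<sigma>_pos[OF assms] by (simp flip: powr_add)
  then have 1: "complex_of_real (\<sigma> x powr a) * of_real (\<sigma> x powr - a) = 1"
    by (metis of_real_mult of_real_1)
  have 2: "complex_of_real (\<sigma> x powr - a) * of_real (\<sigma> x powr a) = 1"
    by (subst mult.commute) (rule 1)
  show "complex_of_real (\<sigma> x powr a) * (of_real (\<sigma> x powr - a) * z) = z"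
    "complex_of_real (\<sigma> x powr - a) * (of_real (\<sigma> x powr a) * z) = z"
    by (simp_all only: mult.assoc[symmetric] 1 2 mult_1_left)
qed

text \<open>Both rows of the Dirac expression reduce to this: the second is \<open>dirac1 M\<close>
  of component 1, the first is the negative of \<open>dirac1 (-M)\<close> of component 2.\<close>

definition dirac1 :: "real \<Rightarrow> (real \<Rightarrow> complex) \<Rightarrow> real \<Rightarrow> complex" where
  "dirac1 N \<zeta> x = vector_derivative \<zeta> (at x) + of_real (N / cos x) * \<zeta> x"

text \<open>The integrating factor: since the logarithmic derivative of \<open>\<sigma>\<close> is
  \<open>- 1 / cos\<close>, conjugation by \<open>\<sigma>^N\<close> removes the zeroth-order
  term.\<close>

lemma dirac1_eq:
  assumes "\<zeta> \<in> test_fun" "x \<in> I0"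
  shows "dirac1 N \<zeta> x = of_real (\<sigma> x powr N) * vector_derivative (\<lambda>x. of_real (\<sigma> x powr - N) * \<zeta> x) (at x)"
proof -
  have "vector_derivative (\<lambda>x. of_real (\<sigma> x powr - N) * \<zeta> x) (at x) = of_real (\<sigma> x powr - N) * dirac1 N \<zeta> x"
    using \<sigma>_powr_mult_deriv[OF assms(2) test_fun_deriv(1)[OF assms(1)], of "-N"]
    by (simp add: vector_derivative_at dirac1_def)
  then show ?thesis by (simp add: \<sigma>_powr_cancel[OF assms(2)])
qed

lemma sqi_dirac1: assumes "\<zeta> \<in> test_fun" shows "sqi (dirac1 N \<zeta>)"
proof -
  have "sqi (\<lambda>x. of_real (\<sigma> x powr N) * vector_derivative (\<lambda>x. of_real (\<sigma> x powr - N) * \<zeta> x) (at x))"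
    by (intro test_fun_sqi test_fun_\<sigma>_powr test_fun_deriv(2) assms)
  then show ?thesis using dirac1_eq[OF assms, of _ N] by (subst sqi_cong)
qed

lemma test_fun_prim:
  assumes "\<eta> \<in> test_fun" and r: "r \<in> {-(pi/2)..pi/2}"
  shows "prim (\<lambda>x. vector_derivative \<eta> (at x)) r = \<eta> r"
proof -
  let ?D = "\<lambda>x. vector_derivative \<eta> (at x)"
  have "(?D has_integral \<eta> r - \<eta> (-(pi/2))) {-(pi/2)..r}"
    using r by (intro fundamental_theorem_of_calculus has_vector_derivative_at_within[OF test_fun_deriv(1)[OF assms(1)]]) auto
  moreover obtain K where "K \<subseteq> I0" "\<And>x. x \<notin> K \<Longrightarrow> \<eta> x = 0"
    using test_fun_supportI[OF assms(1)] by metis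
  then have "\<eta> (-(pi/2)) = 0" by (metis greaterThanLessThan_iff less_irrefl subsetD)
  ultimately have "integral {-(pi/2)..r} ?D = \<eta> r" by (simp add: integral_unique)
  then show ?thesis
    using prim_eq_integral[OF sqi_integrable[OF test_fun_sqi[OF test_fun_deriv(2)[OF assms(1)]]] r] by simp
qed

lemma test_fun_at_right_end: "\<eta> \<in> test_fun \<Longrightarrow> \<eta> (pi/2) = 0"
  by (erule test_fun_supportI) (metis greaterThanLessThan_iff less_irrefl subsetD)

text \<open>The derivative prescribed for \<open>\<sigma>^N u\<close>. For \<open>|N| < 1/2\<close>
  it is integrable up to both ends, which is where boundary values come from.\<close>

definition flux :: "real \<Rightarrow> (real \<Rightarrow> complex) \<Rightarrow> real \<Rightarrow> complex" where
  "flux N v t = - (of_real (\<sigma> t powr N) * v t)"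

text \<open>The constant \<open>c\<close> is the value of the weighted solution
  \<open>\<sigma>^N u\<close> at the left end.\<close>

definition sol :: "real \<Rightarrow> complex \<Rightarrow> (real \<Rightarrow> complex) \<Rightarrow> real \<Rightarrow> complex" where
  "sol N c v x = of_real (\<sigma> x powr - N) * (c + prim (flux N v) x)"

text \<open>\<open>weak N u v\<close> is the weak form of \<open>- u' + N sec u = v\<close>, equivalently \<open>(\<sigma>^N u)' = - \<sigma>^N v\<close>,
  whose general solution is \<open>sol N c v\<close>.\<close>

definition weak :: "real \<Rightarrow> (real \<Rightarrow> complex) \<Rightarrow> (real \<Rightarrow> complex) \<Rightarrow> bool" where
  "weak N u v \<longleftrightarrow> (\<forall>\<zeta>\<in>test_fun. (LINT x|\<mu>. cnj (u x) * dirac1 N \<zeta> x) = (LINT x|\<mu>. cnj (v x) * \<zeta> x))"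

lemma integrable_flux: "\<bar>N\<bar> < 1/2 \<Longrightarrow> sqi v \<Longrightarrow> integrable \<mu> (flux N v)"
  unfolding flux_def by (intro Bochner_Integration.integrable_minus sqi_integrable_mult sqi_\<sigma>_powr)

lemma sqi_sol:
  assumes "\<bar>N\<bar> < 1/2" "sqi v" shows "sqi (sol N c v)"
proof -
  note i = integrable_flux[OF assms]
  have "sqi (\<lambda>x. (c + prim (flux N v) x) * of_real (\<sigma> x powr - N))"
  proof (rule sqi_bounded_mult)
    show "sqi (\<lambda>x. of_real (\<sigma> x powr - N))" using assms by (intro sqi_\<sigma>_powr) simp
    show "(\<lambda>x. c + prim (flux N v) x) \<in> borel_measurable \<mu>"
      using prim_measurable[OF i] by simp
    show "cmod (c + prim (flux N v) x) \<le> cmod c + (LINT t|\<mu>. cmod (flux N v t))" for x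
      using prim_bound[OF i, of x] norm_triangle_ineq[of c "prim (flux N v) x"] by linarith
  qed
  then show ?thesis by (simp add: sol_def[abs_def] mult.commute)
qed

lemma cnj_prim: "cnj (prim h x) = prim (\<lambda>t. cnj (h t)) x"
  by (simp add: prim_def flip: Bochner_Integration.integral_cnj)

lemma integrable_cnj: "integrable \<mu> h \<Longrightarrow> integrable \<mu> (\<lambda>t. cnj (h t))"
  by (simp add: complex_integrable_cnj)

lemma weak_sol:
  assumes N: "\<bar>N\<bar> < 1/2" and v: "sqi v" shows "weak N (sol N c v) v"
  unfolding weak_def
proof
  fix \<zeta> assume \<zeta>: "\<zeta> \<in> test_fun"
  \<comment> \<open>In terms of \<open>\<eta>\<close> the two integrands are those of
    \<open>by_parts\<close>: \<open>dirac1 N \<zeta>\<close> is \<open>\<sigma>^N\<close> times the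
    derivative of \<open>\<eta>\<close>, and the right-hand side pairs \<open>\<eta>\<close> with
    the flux. The boundary terms vanish with \<open>\<eta>\<close>.\<close>
  define \<eta> where "\<eta> x = of_real (\<sigma> x powr - N) * \<zeta> x" for x
  let ?D = "\<lambda>x. vector_derivative \<eta> (at x)"
  let ?f = "\<lambda>t. cnj (flux N v t)"
  have \<eta>: "\<eta> \<in> test_fun" unfolding \<eta>_def[abs_def] by (rule test_fun_\<sigma>_powr[OF \<zeta>])
  have f: "integrable \<mu> ?f" by (intro integrable_cnj integrable_flux N v)
  have g: "integrable \<mu> ?D" by (intro sqi_integrable test_fun_sqi test_fun_deriv(2) \<eta>)
  have "(LINT x|\<mu>. cnj (sol N c v x) * dirac1 N \<zeta> x) - (LINT x|\<mu>. cnj (v x) * \<zeta> x)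
      = (LINT x|\<mu>. cnj (sol N c v x) * dirac1 N \<zeta> x - cnj (v x) * \<zeta> x)"
    by (intro Bochner_Integration.integral_diff[symmetric] sqi_integrable_mult sqi_dirac1 test_fun_sqi \<zeta>
        sqi_cnj_iff[THEN iffD2] sqi_sol N v)
  also have "\<dots> = (LINT x|\<mu>. (cnj c + prim ?f x) * ?D x + ?f x * (0 + prim ?D x))"
  proof (rule Bochner_Integration.integral_cong[OF refl])
    fix x assume "x \<in> space \<mu>"
    then have x: "x \<in> I0" by simp
    have "cnj (sol N c v x) * dirac1 N \<zeta> x
        = of_real (\<sigma> x powr - N) * (of_real (\<sigma> x powr N) * ((cnj c + prim ?f x) * ?D x))"
      unfolding dirac1_eq[OF \<zeta> x] by (simp add: sol_def cnj_prim \<eta>_def[abs_def] mult_ac)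
    then have "cnj (sol N c v x) * dirac1 N \<zeta> x = (cnj c + prim ?f x) * ?D x"
      by (simp only: \<sigma>_powr_cancel(2)[OF x])
    moreover
    have "?f x * prim ?D x = - (cnj (v x) * \<zeta> x)"
      using x \<sigma>_powr_cancel(1)[OF x, of N "\<zeta> x"]
      by (subst test_fun_prim[OF \<eta>]) (auto simp: flux_def \<eta>_def algebra_simps)
    ultimately show "cnj (sol N c v x) * dirac1 N \<zeta> x - cnj (v x) * \<zeta> x
        = (cnj c + prim ?f x) * ?D x + ?f x * (0 + prim ?D x)" by simp
  qed
  also have "\<dots> = 0"
    unfolding by_parts[OF f g] by (simp add: test_fun_prim[OF \<eta>] test_fun_at_right_end[OF \<eta>])
  finally show "(LINT x|\<mu>. cnj (sol N c v x) * dirac1 N \<zeta> x) = (LINT x|\<mu>. cnj (v x) * \<zeta> x)" by simp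
qed

text \<open>The scalar form of orthogonality to test functions, obtained by placing \<open>h\<close>
  in the first component of a spinor.\<close>

lemma sqi_eq_0_if_orthogonal:
  assumes h: "sqi h" and 0: "\<And>\<theta>. \<theta> \<in> test_fun \<Longrightarrow> (LINT x|\<mu>. cnj (h x) * \<theta> x) = 0"
  shows "AE x in \<mu>. h x = 0"
proof -
  let ?f = "\<lambda>x. axis 1 (h x) :: complex^2"
  have f: "sq_integrable ?f"
    using h sqi_bounded[of "\<lambda>_. 0" 0] by (simp add: sq_integrable_iff_sqi axis_def)
  have z: "sq_integrable (\<lambda>x. 0)" by (simp add: sq_integrable_def)
  have "spinor ?f = 0"
  proof (rule orthogonal_test_functions_imp_zero)
    fix \<phi> assume \<phi>: "\<phi> \<in> test_functions"
    have "cinner (spinor ?f) (spinor \<phi>) = (LINT x|\<mu>. cnj (h x) * \<phi> x $ 1)"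
      unfolding cinner_spinor[OF f test_functions_sq_integrable[OF \<phi>]]
      by (simp add: hdot_def sum_2 axis_def)
    also have "\<dots> = 0" using \<phi> by (intro 0) (simp add: test_functions_iff)
    finally show "cinner (spinor ?f) (spinor \<phi>) = 0" .
  qed
  then have "spinor ?f = spinor (\<lambda>x. 0)" by (simp add: zero_spinorL2_def)
  then have "AE x in \<mu>. ?f x = 0" by (simp add: abs_spinorL2_eq_iff[OF f z])
  then show ?thesis
    by eventually_elim (drule arg_cong[of _ _ "\<lambda>v. v $ 1"], simp add: axis_def)
qed

text \<open>If every test function had integral 0, the constant 1 would be orthogonal to all of them
  and hence vanish almost everywhere. A test function of nonzero integral is then rescaled.\<close>

lemma test_fun_normalized: obtains \<theta> where "\<theta> \<in> test_fun" "(LINT x|\<mu>. \<theta> x) = 1"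
proof -
  have "\<exists>\<theta>\<in>test_fun. (LINT x|\<mu>. \<theta> x) \<noteq> 0"
  proof (rule ccontr)
    assume "\<not> ?thesis"
    then have "AE x in \<mu>. (\<lambda>_. 1 :: complex) x = 0"
      by (intro sqi_eq_0_if_orthogonal sqi_bounded[where B=1]) auto
    then have "emeasure \<mu> (space \<mu>) = 0"
      by (subst (asm) AE_iff_measurable[OF sets.top]) auto
    then show False by (simp add: emeasure_restrict_space)
  qed
  then obtain \<theta> where "\<theta> \<in> test_fun" "(LINT x|\<mu>. \<theta> x) \<noteq> 0" by blast
  then show ?thesis
    using that[of "\<lambda>x. inverse (LINT x|\<mu>. \<theta> x) * \<theta> x"] by (simp add: test_fun_cmult)
qed

text \<open>The primitive vanishes to the left of the support, and the zero mean makes it vanish to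
  the right as well.\<close>

lemma test_fun_antiderivative:
  assumes \<kappa>: "\<kappa> \<in> test_fun" and 0: "(LINT x|\<mu>. \<kappa> x) = 0"
  shows "prim \<kappa> \<in> test_fun" "\<And>x. x \<in> I0 \<Longrightarrow> (prim \<kappa> has_vector_derivative \<kappa> x) (at x)"
proof -
  have i: "integrable \<mu> \<kappa>" by (intro sqi_integrable test_fun_sqi \<kappa>)
  show D: "(prim \<kappa> has_vector_derivative \<kappa> x) (at x)" if x: "x \<in> I0" for x
  proof -
    have "((\<lambda>u. integral {-(pi/2)..u} \<kappa>) has_vector_derivative \<kappa> x) (at x within {-(pi/2)..pi/2})"
      using x by (intro integral_has_vector_derivative test_fun_continuous[OF \<kappa>]) auto
    then have "((\<lambda>u. integral {-(pi/2)..u} \<kappa>) has_vector_derivative \<kappa> x) (at x)"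
      using x by (subst (asm) at_within_interior) auto
    then show ?thesis
      by (rule has_vector_derivative_transform_within_open[of _ _ _ I0])
        (use x in \<open>auto simp: prim_eq_integral[OF i]\<close>)
  qed
  obtain a b where ab: "-(pi/2) < a" "a \<le> b" "b < pi/2" "\<And>x. x \<notin> {a..b} \<Longrightarrow> \<kappa> x = 0"
    using \<kappa> by (auto simp: test_fun_def)
  show "prim \<kappa> \<in> test_fun"
  proof (rule test_funI[where K="{a..b}"])
    show "diff_upto n I0 (prim \<kappa>)" for n
    proof (cases n)
      case (Suc m)
      have "diff_upto m I0 \<kappa>" using \<kappa> by (auto simp: test_fun_def intro: diff_upto_subset)
      then show ?thesis unfolding Suc by (rule diff_upto_SucI[rotated]) (rule D)
    qed simp
    show "prim \<kappa> x = 0" if "x \<notin> {a..b}" for x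
    proof (cases "x < a")
      case True
      then have "prim \<kappa> x = (LINT t|\<mu>. 0)"
        unfolding prim_def by (intro Bochner_Integration.integral_cong) (auto simp: indicator_def ab(4))
      then show ?thesis by simp
    next
      case False
      with that have "prim \<kappa> x = (LINT t|\<mu>. \<kappa> t)"
        unfolding prim_def by (intro Bochner_Integration.integral_cong) (auto simp: indicator_def ab(4))
      then show ?thesis using 0 by simp
    qed
  qed (use ab in auto)
qed

text \<open>The du Bois-Reymond lemma in weighted form: the equation says that
  \<open>\<sigma>^N h\<close> has weak derivative zero, so it is constant.\<close>

lemma weak_0_imp:
  assumes N: "\<bar>N\<bar> < 1/2" and h: "sqi h" and w: "weak N h (\<lambda>_. 0)"
  obtains c where "AE x in \<mu>. h x = c * of_real (\<sigma> x powr - N)"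
proof -
  obtain \<theta>0 where \<theta>0: "\<theta>0 \<in> test_fun" "(LINT x|\<mu>. \<theta>0 x) = 1" using test_fun_normalized .
  let ?s = "\<lambda>a x. complex_of_real (\<sigma> x powr a)"
  \<comment> \<open>If \<open>\<sigma>^N h\<close> is a constant, pairing it with
    \<open>\<theta>0\<close>, of integral 1, returns the conjugate of that constant; the outer
    \<open>cnj\<close> undoes the conjugation.\<close>
  define c where "c = cnj (LINT x|\<mu>. cnj (h x) * (?s N x * \<theta>0 x))"
  have s: "sqi (?s (-N))" using N by (intro sqi_\<sigma>_powr) simp
  have "AE x in \<mu>. h x - c * ?s (-N) x = 0"
  proof (rule sqi_eq_0_if_orthogonal)
    show "sqi (\<lambda>x. h x - c * ?s (- N) x)" by (intro sqi_diff sqi_cmult h s)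
    fix \<theta> assume \<theta>: "\<theta> \<in> test_fun"
    \<comment> \<open>Subtracting a multiple of \<open>\<theta>0\<close> gives \<open>\<sigma>^{-N} \<theta>\<close> mean zero, so that it has a primitive \<open>\<eta>\<close> among the
      test functions; then \<open>\<sigma>^N \<eta>\<close> is tested against.\<close>
    define m where "m = (LINT x|\<mu>. ?s (-N) x * \<theta> x)"
    define \<kappa> where "\<kappa> x = ?s (-N) x * \<theta> x + (- m) * \<theta>0 x" for x
    have s\<theta>: "(\<lambda>x. ?s (-N) x * \<theta> x) \<in> test_fun" by (rule test_fun_\<sigma>_powr[OF \<theta>])
    have \<kappa>: "\<kappa> \<in> test_fun" unfolding \<kappa>_def[abs_def]
      by (intro test_fun_add test_fun_cmult s\<theta> \<theta>0)
    have "(LINT x|\<mu>. \<kappa> x) = 0"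
      unfolding \<kappa>_def using sqi_integrable[OF test_fun_sqi[OF s\<theta>]] sqi_integrable[OF test_fun_sqi[OF \<theta>0(1)]]
      by (simp add: \<theta>0 m_def)
    note \<eta> = test_fun_antiderivative[OF \<kappa> this]
    have z: "(\<lambda>x. ?s N x * prim \<kappa> x) \<in> test_fun" by (rule test_fun_\<sigma>_powr[OF \<eta>(1)])
    have d: "dirac1 N (\<lambda>x. ?s N x * prim \<kappa> x) x = \<theta> x - m * (?s N x * \<theta>0 x)" if x: "x \<in> I0" for x
    proof -
      have "vector_derivative (\<lambda>x. ?s N x * prim \<kappa> x) (at x) = ?s N x * (\<kappa> x - of_real (N / cos x) * prim \<kappa> x)"
        by (rule vector_derivative_at[OF \<sigma>_powr_mult_deriv[OF x \<eta>(2)[OF x]]])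
      then have "dirac1 N (\<lambda>x. ?s N x * prim \<kappa> x) x = ?s N x * \<kappa> x"
        by (simp add: dirac1_def algebra_simps)
      also have "\<dots> = \<theta> x - m * (?s N x * \<theta>0 x)"
        by (simp add: \<kappa>_def right_diff_distrib \<sigma>_powr_cancel(1)[OF x])
      finally show ?thesis .
    qed
    have i: "integrable \<mu> (\<lambda>x. cnj (h x) * \<theta> x)"
      by (intro sqi_integrable_mult test_fun_sqi \<theta> sqi_cnj_iff[THEN iffD2] h)
    have i0: "integrable \<mu> (\<lambda>x. cnj (h x) * (?s N x * \<theta>0 x))"
      by (intro sqi_integrable_mult test_fun_sqi test_fun_\<sigma>_powr \<theta>0 sqi_cnj_iff[THEN iffD2] h)
    have is': "integrable \<mu> (\<lambda>x. ?s (-N) x * \<theta> x)"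
      by (intro sqi_integrable test_fun_sqi s\<theta>)
    have "0 = (LINT x|\<mu>. cnj (h x) * dirac1 N (\<lambda>x. ?s N x * prim \<kappa> x) x)"
      using w z by (simp add: weak_def)
    also have "\<dots> = (LINT x|\<mu>. cnj (h x) * \<theta> x - m * (cnj (h x) * (?s N x * \<theta>0 x)))"
    proof (rule Bochner_Integration.integral_cong[OF refl])
      fix x assume "x \<in> space \<mu>"
      then have x: "x \<in> I0" by simp
      show "cnj (h x) * dirac1 N (\<lambda>x. ?s N x * prim \<kappa> x) x
          = cnj (h x) * \<theta> x - m * (cnj (h x) * (?s N x * \<theta>0 x))"
        by (simp only: d[OF x]) (simp add: algebra_simps)
    qed
    also have "\<dots> = (LINT x|\<mu>. cnj (h x) * \<theta> x) - m * cnj c"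
      using i i0 by (simp add: c_def)
    also have "\<dots> = (LINT x|\<mu>. cnj (h x) * \<theta> x) - (LINT x|\<mu>. cnj c * (?s (-N) x * \<theta> x))"
      by (simp add: m_def)
    also have "\<dots> = (LINT x|\<mu>. cnj (h x) * \<theta> x - cnj c * (?s (-N) x * \<theta> x))"
      using i is' by (intro Bochner_Integration.integral_diff[symmetric]) auto
    also have "\<dots> = (LINT x|\<mu>. cnj (h x - c * ?s (- N) x) * \<theta> x)"
      by (rule Bochner_Integration.integral_cong) (auto simp: algebra_simps)
    finally show "(LINT x|\<mu>. cnj (h x - c * ?s (- N) x) * \<theta> x) = 0" by simp
  qed
  then have "AE x in \<mu>. h x = c * ?s (-N) x" by eventually_elim simp
  then show ?thesis by (rule that)
qed

text \<open>Subtracting the particular solution \<open>sol N 0 v\<close> leaves a solution of the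
  homogeneous equation, and \<open>weak_0_imp\<close> describes those.\<close>

lemma weak_iff:
  assumes N: "\<bar>N\<bar> < 1/2" and u: "sqi u" and v: "sqi v"
  shows "weak N u v \<longleftrightarrow> (\<exists>c. AE x in \<mu>. u x = sol N c v x)"
proof
  assume w: "weak N u v"
  define h where "h x = u x - sol N 0 v x" for x
  have h: "sqi h" unfolding h_def[abs_def] by (intro sqi_diff u sqi_sol N v)
  have "weak N h (\<lambda>_. 0)"
    unfolding weak_def
  proof
    fix \<zeta> assume \<zeta>: "\<zeta> \<in> test_fun"
    have "(LINT x|\<mu>. cnj (h x) * dirac1 N \<zeta> x)
        = (LINT x|\<mu>. cnj (u x) * dirac1 N \<zeta> x - cnj (sol N 0 v x) * dirac1 N \<zeta> x)"
      by (simp add: h_def algebra_simps)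
    also have "\<dots> = (LINT x|\<mu>. cnj (u x) * dirac1 N \<zeta> x) - (LINT x|\<mu>. cnj (sol N 0 v x) * dirac1 N \<zeta> x)"
      by (rule Bochner_Integration.integral_diff)
        (intro sqi_integrable_mult sqi_dirac1 \<zeta> sqi_cnj_iff[THEN iffD2] sqi_sol N v u)+
    also have "\<dots> = 0" using w weak_sol[OF N v, of 0] \<zeta> by (simp add: weak_def)
    finally show "(LINT x|\<mu>. cnj (h x) * dirac1 N \<zeta> x) = (LINT x|\<mu>. cnj 0 * \<zeta> x)" by simp
  qed
  then obtain c where "AE x in \<mu>. h x = c * of_real (\<sigma> x powr - N)" using weak_0_imp[OF N h] by blast
  then have "AE x in \<mu>. u x = sol N c v x"
    by eventually_elim (simp add: h_def sol_def algebra_simps)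
  then show "\<exists>c. AE x in \<mu>. u x = sol N c v x" ..
next
  assume "\<exists>c. AE x in \<mu>. u x = sol N c v x"
  then obtain c where c: "AE x in \<mu>. u x = sol N c v x" ..
  have "(LINT x|\<mu>. cnj (u x) * dirac1 N \<zeta> x) = (LINT x|\<mu>. cnj (sol N c v x) * dirac1 N \<zeta> x)" if \<zeta>: "\<zeta> \<in> test_fun" for \<zeta>
  proof (rule integral_cong_AE)
    show "AE x in \<mu>. cnj (u x) * dirac1 N \<zeta> x = cnj (sol N c v x) * dirac1 N \<zeta> x"
      using c by eventually_elim simp
  qed (intro borel_measurable_integrable sqi_integrable_mult sqi_dirac1 \<zeta> sqi_cnj_iff[THEN iffD2] sqi_sol N v u)+
  then show "weak N u v" using weak_sol[OF N v, of c] by (simp add: weak_def)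
qed

section \<open>The graph of the adjoint\<close>

lemma vector_derivative_nth:
  fixes \<phi> :: "real \<Rightarrow> complex^2"
  assumes "\<phi> \<in> test_functions"
  shows "vector_derivative \<phi> (at x) $ i = vector_derivative (\<lambda>x. \<phi> x $ i) (at x)"
proof -
  have "smooth \<phi>" using assms by (simp add: test_functions_def)
  then have "\<phi> differentiable at x" unfolding smooth_def by (auto dest: spec[of _ 0])
  then have "(\<phi> has_vector_derivative vector_derivative \<phi> (at x)) (at x)"
    by (simp add: vector_derivative_works)
  then have "((\<lambda>x. \<phi> x $ i) has_vector_derivative vector_derivative \<phi> (at x) $ i) (at x)"
    by (rule bounded_linear.has_vector_derivative[OF bounded_linear_vec_nth])
  then show ?thesis by (simp add: vector_derivative_at)
qed

text \<open>The operator is off-diagonal, so test spinors with a single nonzero component separate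
  the two equations. Component 1 solves \<open>f1' + M sec f1 = g2\<close>; bringing it to the form
  of \<open>weak\<close> flips the signs of \<open>M\<close> and of \<open>g2\<close>.\<close>

lemma is_adjoint_value_iff_weak:
  assumes f: "sq_integrable f" and g: "sq_integrable g"
  shows "is_adjoint_value (dirac M) (spinor f) (spinor g) \<longleftrightarrow>
    weak (-M) (\<lambda>x. f x $ 1) (\<lambda>x. - g x $ 2) \<and> weak M (\<lambda>x. f x $ 2) (\<lambda>x. g x $ 1)"
proof -
  have fs: "sqi (\<lambda>x. cnj (f x $ 1))" "sqi (\<lambda>x. cnj (f x $ 2))"
    and gs: "sqi (\<lambda>x. cnj (g x $ 1))" "sqi (\<lambda>x. cnj (g x $ 2))"
    using f g by (auto simp: sq_integrable_iff_sqi sqi_cnj_iff)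
  let ?A = "\<lambda>i N \<zeta>. LINT x|\<mu>. cnj (f x $ i) * dirac1 N \<zeta> x"
  let ?B = "\<lambda>i \<zeta>. LINT x|\<mu>. cnj (g x $ i) * \<zeta> x"
  have L: "cinner (spinor f) (spinor (dirac_expr M \<phi>)) = ?A 2 M (\<lambda>x. \<phi> x $ 1) - ?A 1 (-M) (\<lambda>x. \<phi> x $ 2)"
    if \<phi>: "\<phi> \<in> test_functions" for \<phi>
  proof -
    have t: "(\<lambda>x. \<phi> x $ 1) \<in> test_fun" "(\<lambda>x. \<phi> x $ 2) \<in> test_fun"
      using \<phi> by (auto simp: test_functions_iff)
    have "cinner (spinor f) (spinor (dirac_expr M \<phi>)) =
      (LINT x|\<mu>. cnj (f x $ 2) * dirac1 M (\<lambda>x. \<phi> x $ 1) x - cnj (f x $ 1) * dirac1 (-M) (\<lambda>x. \<phi> x $ 2) x)"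
      unfolding cinner_spinor[OF f dirac_expr_sq_integrable[OF \<phi>]]
      by (rule Bochner_Integration.integral_cong)
        (auto simp: hdot_def sum_2 dirac_expr_def Let_def dirac1_def vector_derivative_nth[OF \<phi>] algebra_simps)
    also have "\<dots> = ?A 2 M (\<lambda>x. \<phi> x $ 1) - ?A 1 (-M) (\<lambda>x. \<phi> x $ 2)"
      by (intro Bochner_Integration.integral_diff sqi_integrable_mult sqi_dirac1 fs t)
    finally show ?thesis .
  qed
  have R: "cinner (spinor g) (spinor \<phi>) = ?B 1 (\<lambda>x. \<phi> x $ 1) + ?B 2 (\<lambda>x. \<phi> x $ 2)"
    if \<phi>: "\<phi> \<in> test_functions" for \<phi>
  proof -
    have t: "(\<lambda>x. \<phi> x $ 1) \<in> test_fun" "(\<lambda>x. \<phi> x $ 2) \<in> test_fun"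
      using \<phi> by (auto simp: test_functions_iff)
    show ?thesis
      unfolding cinner_spinor[OF g test_functions_sq_integrable[OF \<phi>]] hdot_def sum_2
      by (intro Bochner_Integration.integral_add sqi_integrable_mult gs test_fun_sqi t)
  qed
  have adj: "is_adjoint_value (dirac M) (spinor f) (spinor g) \<longleftrightarrow>
      (\<forall>\<phi>\<in>test_functions. ?A 2 M (\<lambda>x. \<phi> x $ 1) - ?A 1 (-M) (\<lambda>x. \<phi> x $ 2)
        = ?B 1 (\<lambda>x. \<phi> x $ 1) + ?B 2 (\<lambda>x. \<phi> x $ 2))"
    by (simp add: is_adjoint_value_def dom_dirac dirac_abs L R)
  have [simp]: "dirac1 N (\<lambda>x. 0) = (\<lambda>x. 0)" for N by (simp add: dirac1_def fun_eq_iff)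
  show ?thesis
  proof
    assume a: "is_adjoint_value (dirac M) (spinor f) (spinor g)"
    have "weak M (\<lambda>x. f x $ 2) (\<lambda>x. g x $ 1)"
      unfolding weak_def
    proof
      fix \<zeta> assume \<zeta>: "\<zeta> \<in> test_fun"
      then have "(\<lambda>x. axis 1 (\<zeta> x)) \<in> test_functions"
        using test_fun_0 by (simp add: test_functions_iff axis_def)
      from a[unfolded adj, rule_format, OF this]
      show "?A 2 M \<zeta> = ?B 1 \<zeta>" by (simp add: axis_def)
    qed
    moreover have "weak (-M) (\<lambda>x. f x $ 1) (\<lambda>x. - g x $ 2)"
      unfolding weak_def
    proof
      fix \<zeta> assume \<zeta>: "\<zeta> \<in> test_fun"
      then have "(\<lambda>x. axis 2 (\<zeta> x)) \<in> test_functions"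
        using test_fun_0 by (simp add: test_functions_iff axis_def)
      from a[unfolded adj, rule_format, OF this]
      have "- ?A 1 (-M) \<zeta> = ?B 2 \<zeta>" by (simp add: axis_def)
      then have "- ?B 2 \<zeta> = ?A 1 (-M) \<zeta>" by (rule minus_equation_iff[THEN iffD1])
      moreover have "(LINT x|\<mu>. cnj (- g x $ 2) * \<zeta> x) = - ?B 2 \<zeta>" by simp
      ultimately show "?A 1 (-M) \<zeta> = (LINT x|\<mu>. cnj (- g x $ 2) * \<zeta> x)" by (simp only:)
    qed
    ultimately show "weak (-M) (\<lambda>x. f x $ 1) (\<lambda>x. - g x $ 2) \<and> weak M (\<lambda>x. f x $ 2) (\<lambda>x. g x $ 1)" by blast
  next
    assume "weak (-M) (\<lambda>x. f x $ 1) (\<lambda>x. - g x $ 2) \<and> weak M (\<lambda>x. f x $ 2) (\<lambda>x. g x $ 1)"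
    then show "is_adjoint_value (dirac M) (spinor f) (spinor g)"
      unfolding adj weak_def by (simp add: test_functions_iff)
  qed
qed

text \<open>The general preimage of \<open>g\<close> under the adjoint; \<open>c\<close> and
  \<open>d\<close> are the left-end values of the first and second weighted component.\<close>

definition dsol :: "real \<Rightarrow> complex \<Rightarrow> complex \<Rightarrow> (real \<Rightarrow> complex^2) \<Rightarrow> real \<Rightarrow> complex^2" where
  "dsol M c d g x = vector [sol (-M) c (\<lambda>t. - g t $ 2) x, sol M d (\<lambda>t. g t $ 1) x]"

lemma dsol_sq_integrable: "\<bar>M\<bar> < 1/2 \<Longrightarrow> sq_integrable g \<Longrightarrow> sq_integrable (dsol M c d g)"
  by (simp add: sq_integrable_iff_sqi dsol_def sqi_sol sqi_minus_iff)

lemma is_adjoint_value_dirac_iff: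
  assumes M: "\<bar>M\<bar> < 1/2"
  shows "is_adjoint_value (dirac M) \<Phi> \<Psi> \<longleftrightarrow>
    (\<exists>c d g. sq_integrable g \<and> \<Psi> = spinor g \<and> \<Phi> = spinor (dsol M c d g))"
proof
  assume a: "is_adjoint_value (dirac M) \<Phi> \<Psi>"
  obtain f where f: "sq_integrable f" "\<Phi> = spinor f" using spinor_cases .
  obtain g where g: "sq_integrable g" "\<Psi> = spinor g" using spinor_cases .
  have s: "sqi (\<lambda>x. f x $ 1)" "sqi (\<lambda>x. f x $ 2)" "sqi (\<lambda>x. g x $ 1)" "sqi (\<lambda>x. - g x $ 2)"
    using f(1) g(1) by (auto simp: sq_integrable_iff_sqi sqi_minus_iff)
  obtain c d where "AE x in \<mu>. f x $ 1 = sol (-M) c (\<lambda>x. - g x $ 2) x" "AE x in \<mu>. f x $ 2 = sol M d (\<lambda>x. g x $ 1) x"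
    using a M s by (auto simp: f(2) g(2) is_adjoint_value_iff_weak f(1) g(1) weak_iff)
  then have "AE x in \<mu>. f x = dsol M c d g x"
    by eventually_elim (simp add: dsol_def vec_eq_iff forall_2)
  then have "spinor f = spinor (dsol M c d g)"
    by (intro spinor_eqI f dsol_sq_integrable M g)
  then show "\<exists>c d g. sq_integrable g \<and> \<Psi> = spinor g \<and> \<Phi> = spinor (dsol M c d g)"
    using f g by blast
next
  assume "\<exists>c d g. sq_integrable g \<and> \<Psi> = spinor g \<and> \<Phi> = spinor (dsol M c d g)"
  then show "is_adjoint_value (dirac M) \<Phi> \<Psi>"
    using M by (auto simp: is_adjoint_value_iff_weak dsol_sq_integrable)
      (auto simp: dsol_def sq_integrable_iff_sqi sqi_minus_iff intro!: weak_sol)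
qed


section \<open>Maximal isotropic subspaces and unitary matrices\<close>

lemma hdot_add_left: "hdot (u + v) w = hdot u w + hdot v w"
  by (simp add: hdot_def distrib_right sum.distrib)

lemma hdot_add_right: "hdot w (u + v) = hdot w u + hdot w v"
  by (simp add: hdot_def distrib_left sum.distrib)

lemma hdot_scale_left: "hdot (c *s u) w = cnj c * hdot u w"
  by (simp add: hdot_def sum_distrib_left mult.assoc)

lemma hdot_scale_right: "hdot u (c *s w) = c * hdot u w"
  by (simp add: hdot_def sum_distrib_left mult_ac)

lemma hdot_diff_left: "hdot (u - v) w = hdot u w - hdot v w"
  by (simp add: hdot_def left_diff_distrib sum_subtractf)

lemma hdot_diff_right: "hdot w (u - v) = hdot w u - hdot w v"
  by (simp add: hdot_def right_diff_distrib sum_subtractf)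

lemma hdot_zero [simp]: "hdot 0 u = 0" "hdot u 0 = 0"
  by (simp_all add: hdot_def)

lemma hdot_self_eq_0: "hdot u u = 0 \<longleftrightarrow> u = 0"
  by (simp add: hdot_self)

lemma hdot_eq_imp_eq: assumes "\<And>w. hdot u w = hdot v w" shows "u = v"
proof -
  have "hdot (u - v) (u - v) = 0" using assms by (simp add: hdot_diff_left)
  then show ?thesis by (simp add: hdot_self_eq_0)
qed

definition adj_matrix :: "complex ^ 'n ^ 'n \<Rightarrow> complex ^ 'n ^ 'n" where
  "adj_matrix U = (\<chi> i j. cnj (U $ j $ i))"

lemma hdot_adj_matrix: "hdot u (U *v w) = hdot (adj_matrix U *v u) w"
proof -
  have "hdot u (U *v w) = (\<Sum>i\<in>UNIV. \<Sum>j\<in>UNIV. cnj (u $ i) * (U $ i $ j * w $ j))"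
    by (simp add: hdot_def matrix_vector_mult_def sum_distrib_left)
  also have "\<dots> = (\<Sum>j\<in>UNIV. \<Sum>i\<in>UNIV. cnj (u $ i) * (U $ i $ j * w $ j))"
    by (rule sum.swap)
  also have "\<dots> = hdot (adj_matrix U *v u) w"
    by (simp add: hdot_def matrix_vector_mult_def adj_matrix_def sum_distrib_left mult_ac)
  finally show ?thesis .
qed

lemma unitary_iff: "unitary U \<longleftrightarrow> adj_matrix U ** U = mat 1 \<and> U ** adj_matrix U = mat 1"
  by (simp add: unitary_def adj_matrix_def Let_def)

text \<open>The graph of \<open>U\<close> is its own complement for the form
  \<open>hdot b b' - hdot a a'\<close>: the condition amounts to
  \<open>adj_matrix U *v b = a\<close>.\<close>

lemma unitary_graph_isotropic:
  assumes "unitary U"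
  shows "(\<forall>a'. hdot b (U *v a') = hdot a a') \<longleftrightarrow> b = U *v a"
proof
  assume "\<forall>a'. hdot b (U *v a') = hdot a a'"
  then have "adj_matrix U *v b = a" by (intro hdot_eq_imp_eq) (simp add: hdot_adj_matrix)
  then have "U *v (adj_matrix U *v b) = U *v a" by simp
  then show "b = U *v a" using assms by (simp add: unitary_iff matrix_vector_mul_assoc)
next
  assume "b = U *v a"
  then show "\<forall>a'. hdot b (U *v a') = hdot a a'"
    using assms by (simp add: hdot_adj_matrix unitary_iff matrix_vector_mul_assoc)
qed

lemma inner_eq_Re_hdot: "inner u v = Re (hdot u v)" for u v :: "complex ^ 'n"
  by (simp add: inner_vec_def hdot_def inner_complex_def)

text \<open>Isotropy forces \<open>b = 0\<close> whenever \<open>P 0 b\<close>, so \<open>P\<close>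
  is the graph of a map, which preserves \<open>hdot\<close>. Maximality is what makes its domain
  the whole space.\<close>

lemma maximal_isotropic_imp_unitary_graph:
  fixes P :: "complex ^ 'n \<Rightarrow> complex ^ 'n \<Rightarrow> bool"
  assumes add: "\<And>a b a' b'. P a b \<Longrightarrow> P a' b' \<Longrightarrow> P (a + a') (b + b')"
    and scale: "\<And>c a b. P a b \<Longrightarrow> P (c *s a) (c *s b)"
    and max: "\<And>a b. P a b \<longleftrightarrow> (\<forall>a' b'. P a' b' \<longrightarrow> hdot b b' = hdot a a')"
  obtains U where "unitary U" "\<And>a b. P a b \<longleftrightarrow> b = U *v a"
proof -
  have zero: "P 0 0" by (subst max) simp
  define A where "A = {a. \<exists>b. P a b}"
  have sub: "subspace A"
  proof (rule subspaceI)
    show "0 \<in> A" using zero by (auto simp: A_def)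
    show "x + y \<in> A" if "x \<in> A" "y \<in> A" for x y
      using that add unfolding A_def by blast
    show "r *\<^sub>R x \<in> A" if "x \<in> A" for r x
    proof -
      have "r *\<^sub>R x = of_real r *s x"
        by (simp add: vec_eq_iff scaleR_conv_of_real[where 'a=complex])
      then show ?thesis using that scale[of x _ "of_real r"] by (auto simp: A_def)
    qed
  qed
  have "A = UNIV"
  proof (rule ccontr)
    assume "A \<noteq> UNIV"
    then have "dim A \<noteq> DIM(complex ^ 'n)"
      using dim_eq_full[of A] span_eq_iff[THEN iffD2, OF sub] by simp
    then have "dim A < DIM(complex ^ 'n)" using dim_subset_UNIV[of A] by linarith
    then obtain a0 where a0: "a0 \<noteq> 0" "\<And>a. a \<in> A \<Longrightarrow> inner a0 a = 0"
      by (rule orthogonal_to_subspace_exists) (auto simp: orthogonal_def span_base)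
    have "hdot a0 a = 0" if "P a b" for a b
    proof (rule complex_eqI)
      \<comment> \<open>The vector \<open>a0\<close> is orthogonal for the real inner product only;
        testing with \<open>a\<close> and with \<open>\<i> *s a\<close> yields both parts of the
        complex one.\<close>
      have "a \<in> A" "\<i> *s a \<in> A" using that scale by (auto simp: A_def)
      then have "Re (hdot a0 a) = 0" "Re (hdot a0 (\<i> *s a)) = 0"
        using a0(2) by (auto simp flip: inner_eq_Re_hdot)
      then show "Re (hdot a0 a) = Re 0" "Im (hdot a0 a) = Im 0" by (simp_all add: hdot_scale_right)
    qed
    \<comment> \<open>maximality puts \<open>(a0, 0)\<close> into \<open>P\<close>, which is isotropic, so \<open>a0\<close> vanishes after all\<close>
    then have p: "P a0 0" by (subst max) auto
    then have "hdot a0 a0 = 0" using max[of a0 0] p by auto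
    then show False using a0 by (simp add: hdot_self_eq_0)
  qed
  then have "\<forall>a. \<exists>b. P a b" by (auto simp: A_def)
  then obtain f where f: "\<And>a. P a (f a)" by metis
  have uniq: "b = b'" if "P a b" "P a b'" for a b b'
  proof -
    have "P 0 (b - b')" using add[OF that(1) scale[OF that(2), of "-1"]] by (simp add: vec.scale_minus_left)
    then have "hdot (b - b') (b - b') = 0" using max[of 0 "b - b'"] by auto
    then show ?thesis by (simp add: hdot_self_eq_0)
  qed
  have "Vector_Spaces.linear (*s) (*s) f"
    by unfold_locales (auto intro: uniq f add scale)
  then have U: "matrix f *v a = f a" for a by (rule matrix_works)
  let ?U = "matrix f"
  have iso: "hdot (?U *v a) (?U *v a') = hdot a a'" for a a'
    using max[of a "f a"] f by (simp add: U)
  have "(adj_matrix ?U ** ?U) *v a = mat 1 *v a" for a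
    by (rule hdot_eq_imp_eq) (simp add: iso flip: matrix_vector_mul_assoc hdot_adj_matrix) 
  then have "adj_matrix ?U ** ?U = mat 1" by (simp add: matrix_eq)
  \<comment> \<open>An isometry yields only a left inverse; for square matrices it is also a right
    inverse.\<close>
  then have "unitary ?U" by (simp add: unitary_iff matrix_left_right_inverse)
  moreover have "P a b \<longleftrightarrow> b = ?U *v a" for a b using uniq f U by metis
  ultimately show ?thesis by (rule that)
qed

text \<open>The Cayley variables: in terms of \<open>a = x + \<i> y\<close> and \<open>b = x - \<i> y\<close> the boundary form becomes
  a difference of two inner products.\<close>

lemma boundary_form_cayley:
  "hdot (x - \<i> *s y) (x' - \<i> *s y') = hdot (x + \<i> *s y) (x' + \<i> *s y') \<longleftrightarrow> hdot x y' = hdot y x'"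
proof -
  have "hdot (x - \<i> *s y) (x' - \<i> *s y') - hdot (x + \<i> *s y) (x' + \<i> *s y')
      = (- 2 * \<i>) * (hdot x y' - hdot y x')"
    by (simp add: hdot_add_left hdot_add_right hdot_diff_left hdot_diff_right hdot_scale_left hdot_scale_right algebra_simps)
  then show ?thesis by (metis (no_types, opaque_lifting) complex_i_not_zero eq_iff_diff_eq_0 mult_eq_0_iff neg_equal_0_iff_equal zero_neq_numeral)
qed

lemma cayley_inverse:
  fixes a b :: "complex ^ 'n"
  obtains x y where "x + \<i> *s y = a" "x - \<i> *s y = b"
proof
  show "(1/2) *s (a + b) + \<i> *s ((- \<i> / 2) *s (a - b)) = a" "(1/2) *s (a + b) - \<i> *s ((- \<i> / 2) *s (a - b)) = b"
    by (auto simp: vec_eq_iff field_simps)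
qed

text \<open>The boundary condition \<open>(1 - U) x = i (1 + U) y\<close> with the terms free of
  \<open>U\<close> moved to one side.\<close>

definition cayley_graph :: "complex ^ 'n ^ 'n \<Rightarrow> complex ^ 'n \<Rightarrow> complex ^ 'n \<Rightarrow> bool" where
  "cayley_graph U x y \<longleftrightarrow> x - \<i> *s y = U *v (x + \<i> *s y)"

text \<open>This carries \<open>unitary_graph_isotropic\<close> back through the Cayley transform,
  whose surjectivity lets \<open>a'\<close> and \<open>(x', y')\<close> replace each other.\<close>

lemma cayley_graph_maximal:
  assumes "unitary U"
  shows "cayley_graph U x y \<longleftrightarrow> (\<forall>x' y'. cayley_graph U x' y' \<longrightarrow> hdot x y' = hdot y x')"
proof -
  have "cayley_graph U x y \<longleftrightarrow> (\<forall>a'. hdot (x - \<i> *s y) (U *v a') = hdot (x + \<i> *s y) a')"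
    unfolding cayley_graph_def unitary_graph_isotropic[OF assms] ..
  also have "\<dots> \<longleftrightarrow> (\<forall>x' y'. cayley_graph U x' y' \<longrightarrow> hdot x y' = hdot y x')"
  proof (intro iffI allI impI)
    fix x' y' assume *: "\<forall>a'. hdot (x - \<i> *s y) (U *v a') = hdot (x + \<i> *s y) a'" "cayley_graph U x' y'"
    have "hdot (x - \<i> *s y) (x' - \<i> *s y') = hdot (x + \<i> *s y) (x' + \<i> *s y')"
      unfolding *(2)[unfolded cayley_graph_def] using *(1) by blast
    then show "hdot x y' = hdot y x'" by (simp only: boundary_form_cayley)
  next
    fix a' assume *: "\<forall>x' y'. cayley_graph U x' y' \<longrightarrow> hdot x y' = hdot y x'"
    obtain x' y' where xy: "x' + \<i> *s y' = a'" "x' - \<i> *s y' = U *v a'" by (rule cayley_inverse)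
    then have "cayley_graph U x' y'" by (simp only: cayley_graph_def)
    with * have "hdot x y' = hdot y x'" by blast
    then have "hdot (x - \<i> *s y) (x' - \<i> *s y') = hdot (x + \<i> *s y) (x' + \<i> *s y')"
      by (simp only: boundary_form_cayley)
    then show "hdot (x - \<i> *s y) (U *v a') = hdot (x + \<i> *s y) a'" by (simp only: xy)
  qed
  finally show ?thesis .
qed

lemma maximal_isotropic_imp_cayley_graph:
  fixes L :: "complex ^ 'n \<Rightarrow> complex ^ 'n \<Rightarrow> bool"
  assumes add: "\<And>x y x' y'. L x y \<Longrightarrow> L x' y' \<Longrightarrow> L (x + x') (y + y')"
    and scale: "\<And>c x y. L x y \<Longrightarrow> L (c *s x) (c *s y)"
    and max: "\<And>x y. L x y \<longleftrightarrow> (\<forall>x' y'. L x' y' \<longrightarrow> hdot x y' = hdot y x')"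
  obtains U where "unitary U" "\<And>x y. L x y \<longleftrightarrow> cayley_graph U x y"
proof -
  \<comment> \<open>The image of \<open>L\<close> under the Cayley transform, written with its
    inverse \<open>x = (a + b) / 2\<close>, \<open>y = (a - b) / (2 i)\<close>.\<close>
  define P where "P a b \<longleftrightarrow> L ((1/2) *s (a + b)) ((- \<i> / 2) *s (a - b))" for a b
  have P: "P (x + \<i> *s y) (x - \<i> *s y) \<longleftrightarrow> L x y" for x y
  proof -
    have "(1/2) *s ((x + \<i> *s y) + (x - \<i> *s y)) = x" "(- \<i> / 2) *s ((x + \<i> *s y) - (x - \<i> *s y)) = y"
      by (auto simp: vec_eq_iff field_simps)
    then show ?thesis by (simp only: P_def)
  qed
  obtain U where U: "unitary U" "\<And>a b. P a b \<longleftrightarrow> b = U *v a"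
  proof (rule maximal_isotropic_imp_unitary_graph[of P])
    show "P (a + a') (b + b')" if "P a b" "P a' b'" for a b a' b'
      using add[OF that[unfolded P_def]] unfolding P_def
      by (simp add: vec.scale_right_distrib vec.scale_right_diff_distrib algebra_simps)
    show "P (c *s a) (c *s b)" if "P a b" for c a b
      using scale[OF that[unfolded P_def], of c] unfolding P_def
      by (simp add: vec.scale_right_distrib vec.scale_right_diff_distrib mult_ac)
    show "P a b \<longleftrightarrow> (\<forall>a' b'. P a' b' \<longrightarrow> hdot b b' = hdot a a')" for a b
    proof -
      obtain x y where xy: "x + \<i> *s y = a" "x - \<i> *s y = b" by (rule cayley_inverse)
      have "P a b \<longleftrightarrow> (\<forall>x' y'. L x' y' \<longrightarrow> hdot x y' = hdot y x')"
        using max[of x y] P[of x y] xy by simp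
      also have "\<dots> \<longleftrightarrow> (\<forall>x' y'. P (x' + \<i> *s y') (x' - \<i> *s y') \<longrightarrow> hdot b (x' - \<i> *s y') = hdot a (x' + \<i> *s y'))"
        by (simp only: P boundary_form_cayley flip: xy)
      also have "\<dots> \<longleftrightarrow> (\<forall>a' b'. P a' b' \<longrightarrow> hdot b b' = hdot a a')"
      proof (intro iffI allI impI)
        fix a' b' assume *: "\<forall>x' y'. P (x' + \<i> *s y') (x' - \<i> *s y') \<longrightarrow> hdot b (x' - \<i> *s y') = hdot a (x' + \<i> *s y')" "P a' b'"
        obtain x' y' where "x' + \<i> *s y' = a'" "x' - \<i> *s y' = b'" by (rule cayley_inverse)
        with * show "hdot b b' = hdot a a'" by blast
      qed blast
      finally show ?thesis .
    qed
  qed (use that in blast)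
  then show ?thesis using that[of U] P by (simp add: cayley_graph_def)
qed

section \<open>Boundary values and self-adjoint extensions\<close>

lemma cinner_add_left: "cinner (a + b) c = cinner a c + cinner b c"
proof -
  obtain f g h where *: "sq_integrable f" "a = spinor f" "sq_integrable g" "b = spinor g" "sq_integrable h" "c = spinor h"
    by (metis spinor_cases)
  then show ?thesis
    by (simp add: spinor_add cinner_spinor sq_integrable_add hdot_add_left integrable_hdot)
qed

lemma cinner_diff_left: "cinner (a - b) c = cinner a c - cinner b c"
  using cinner_add_left[of "a - b" b c] by simp

lemma cinner_scale_left: "cinner (k *\<^sub>C a) c = cnj k * cinner a c"
proof -
  obtain f h where *: "sq_integrable f" "a = spinor f" "sq_integrable h" "c = spinor h"
    by (metis spinor_cases)
  then show ?thesis
    by (simp add: spinor_cscale cinner_spinor sq_integrable_csmult hdot_scale_left integrable_hdot)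
qed

text \<open>Two values differ by a vector orthogonal to all test functions. Hence the description
  operator in \<open>op_adjoint\<close> is well defined for every operator whose domain contains
  them.\<close>

lemma is_adjoint_value_unique:
  assumes "spinor ` test_functions \<subseteq> dom T" "is_adjoint_value T \<Phi> \<Psi>" "is_adjoint_value T \<Phi> \<Psi>'"
  shows "\<Psi> = \<Psi>'"
proof -
  have "\<Psi> - \<Psi>' = 0"
  proof (rule orthogonal_test_functions_imp_zero)
    fix \<phi> assume "\<phi> \<in> test_functions"
    then have "spinor \<phi> \<in> dom T" using assms(1) by blast
    then show "cinner (\<Psi> - \<Psi>') (spinor \<phi>) = 0"
      using assms(2,3) by (auto simp: is_adjoint_value_def cinner_diff_left)
  qed
  then show ?thesis by simp
qed

lemma op_adjoint_eq_Some_iff: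
  assumes "spinor ` test_functions \<subseteq> dom T"
  shows "op_adjoint T \<Phi> = Some \<Psi> \<longleftrightarrow> is_adjoint_value T \<Phi> \<Psi>"
proof -
  have the: "(THE \<Psi>. is_adjoint_value T \<Phi> \<Psi>) = \<Psi>" if "is_adjoint_value T \<Phi> \<Psi>" for \<Psi>
    using that is_adjoint_value_unique[OF assms] by blast
  show ?thesis by (auto simp: op_adjoint_def the intro: is_adjoint_value_unique[OF assms])
qed

lemma op_adjoint_dirac_iff: "op_adjoint (dirac M) \<Phi> = Some \<Psi> \<longleftrightarrow> is_adjoint_value (dirac M) \<Phi> \<Psi>"
  by (rule op_adjoint_eq_Some_iff) (simp add: dom_dirac)

lemma is_adjoint_value_add:
  "is_adjoint_value T \<Phi> \<Psi> \<Longrightarrow> is_adjoint_value T \<Phi>' \<Psi>' \<Longrightarrow> is_adjoint_value T (\<Phi> + \<Phi>') (\<Psi> + \<Psi>')"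
  by (simp add: is_adjoint_value_def cinner_add_left)

lemma is_adjoint_value_scale:
  "is_adjoint_value T \<Phi> \<Psi> \<Longrightarrow> is_adjoint_value T (c *\<^sub>C \<Phi>) (c *\<^sub>C \<Psi>)"
  by (simp add: is_adjoint_value_def cinner_scale_left)

text \<open>The vectors \<open>x\<close> and \<open>y\<close> collect the boundary values
  \<open>(w2 (pi/2), w2 (-pi/2))\<close> and \<open>(w1 (pi/2), - w1 (-pi/2))\<close> of the weighted components.\<close>

definition boundary_data :: "real \<Rightarrow> spinorL2 \<Rightarrow> complex ^ 2 \<Rightarrow> complex ^ 2 \<Rightarrow> bool" where
  "boundary_data M \<Phi> x y \<longleftrightarrow> (\<exists>\<phi>. continuous_rep \<Phi> \<phi> \<and>
     (weighted1 M \<phi> \<longlongrightarrow> y $ 1) (at_left (pi / 2)) \<and>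
     (weighted1 M \<phi> \<longlongrightarrow> - y $ 2) (at_right (-(pi / 2))) \<and>
     (weighted2 M \<phi> \<longlongrightarrow> x $ 1) (at_left (pi / 2)) \<and>
     (weighted2 M \<phi> \<longlongrightarrow> x $ 2) (at_right (-(pi / 2))))"

lemma boundary_condition_iff:
  "boundary_condition M U \<Phi> \<longleftrightarrow> (\<exists>x y. boundary_data M \<Phi> x y \<and> cayley_graph U x y)"
proof -
  have c: "(mat 1 - U) *v x = \<i> *s ((mat 1 + U) *v y) \<longleftrightarrow> cayley_graph U x y" for x y
  proof -
    have "U *v (x + \<i> *s y) = U *v x + \<i> *s (U *v y)"
      by (simp add: matrix_vector_right_distrib vector_scalar_commute)
    moreover have "\<i> *s (y + U *v y) = \<i> *s y + \<i> *s (U *v y)" by (rule vec.scale_right_distrib)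
    moreover have "p - q = r + s \<longleftrightarrow> p - r = q + s" for p q r s :: "complex ^ 2"
      by (simp add: diff_eq_eq add_ac)
    ultimately show ?thesis
      by (simp only: cayley_graph_def matrix_vector_mult_diff_rdistrib matrix_vector_mult_add_rdistrib
          matrix_vector_mul_lid)
  qed
  show ?thesis
  proof
    assume "boundary_condition M U \<Phi>"
    then obtain \<phi> p1 m1 p2 m2 where *: "continuous_rep \<Phi> \<phi>"
      "(weighted1 M \<phi> \<longlongrightarrow> p1) (at_left (pi / 2))" "(weighted1 M \<phi> \<longlongrightarrow> m1) (at_right (-(pi / 2)))"
      "(weighted2 M \<phi> \<longlongrightarrow> p2) (at_left (pi / 2))" "(weighted2 M \<phi> \<longlongrightarrow> m2) (at_right (-(pi / 2)))"
      "cayley_graph U (vector [p2, m2]) (vector [p1, - m1])"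
      unfolding boundary_condition_def c by blast
    then have "boundary_data M \<Phi> (vector [p2, m2]) (vector [p1, - m1])"
      unfolding boundary_data_def by (intro exI[of _ \<phi>]) simp
    with *(6) show "\<exists>x y. boundary_data M \<Phi> x y \<and> cayley_graph U x y" by blast
  next
    assume "\<exists>x y. boundary_data M \<Phi> x y \<and> cayley_graph U x y"
    then obtain x y where xy: "boundary_data M \<Phi> x y" "cayley_graph U x y" by blast
    \<comment> \<open>The double negation fits the entry \<open>- m1\<close> of the boundary
      condition, with \<open>m1 = - y $ 2\<close>.\<close>
    have v: "x = vector [x $ 1, x $ 2]" "y = vector [y $ 1, - (- y $ 2)]"
      by (simp_all add: vec_eq_iff forall_2)
    show "boundary_condition M U \<Phi>"
      using xy v unfolding boundary_condition_def boundary_data_def c by metis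
  qed
qed

lemma eventually_I0_left: "\<forall>\<^sub>F x in at_left (pi/2). x \<in> I0"
  by (rule eventually_at_left_real) simp

lemma eventually_I0_right: "\<forall>\<^sub>F x in at_right (-(pi/2)). x \<in> I0"
  by (rule eventually_at_right_real) simp

text \<open>Continuous representatives agree on \<open>I0\<close>, hence near both ends, so their
  weighted limits agree.\<close>

lemma boundary_data_unique:
  assumes "boundary_data M \<Phi> x y" "boundary_data M \<Phi> x' y'"
  shows "x = x'" "y = y'"
proof -
  obtain \<phi> where \<phi>: "continuous_rep \<Phi> \<phi>"
     "(weighted1 M \<phi> \<longlongrightarrow> y $ 1) (at_left (pi / 2))" "(weighted1 M \<phi> \<longlongrightarrow> - y $ 2) (at_right (-(pi / 2)))"
     "(weighted2 M \<phi> \<longlongrightarrow> x $ 1) (at_left (pi / 2))" "(weighted2 M \<phi> \<longlongrightarrow> x $ 2) (at_right (-(pi / 2)))"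
    using assms(1) unfolding boundary_data_def by blast
  obtain \<psi> where \<psi>: "continuous_rep \<Phi> \<psi>"
     "(weighted1 M \<psi> \<longlongrightarrow> y' $ 1) (at_left (pi / 2))" "(weighted1 M \<psi> \<longlongrightarrow> - y' $ 2) (at_right (-(pi / 2)))"
     "(weighted2 M \<psi> \<longlongrightarrow> x' $ 1) (at_left (pi / 2))" "(weighted2 M \<psi> \<longlongrightarrow> x' $ 2) (at_right (-(pi / 2)))"
    using assms(2) unfolding boundary_data_def by blast
  have eq: "\<psi> x = \<phi> x" if "x \<in> I0" for x by (rule continuous_rep_unique[OF \<psi>(1) \<phi>(1) that])
  have e: "\<forall>\<^sub>F x in F. weighted1 M \<psi> x = weighted1 M \<phi> x" "\<forall>\<^sub>F x in F. weighted2 M \<psi> x = weighted2 M \<phi> x"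
    if "\<forall>\<^sub>F x in F. x \<in> I0" for F
    using that by (auto elim!: eventually_mono simp: weighted1_def weighted2_def eq simp del: greaterThanLessThan_iff)
  note l = e[OF eventually_I0_left] and r = e[OF eventually_I0_right]
  have "x $ 1 = x' $ 1" by (rule tendsto_unique[OF _ \<phi>(4) Lim_transform_eventually[OF \<psi>(4) l(2)]]) simp
  moreover have "x $ 2 = x' $ 2" by (rule tendsto_unique[OF _ \<phi>(5) Lim_transform_eventually[OF \<psi>(5) r(2)]]) simp
  moreover have "y $ 1 = y' $ 1" by (rule tendsto_unique[OF _ \<phi>(2) Lim_transform_eventually[OF \<psi>(2) l(1)]]) simp
  moreover have "- y $ 2 = - y' $ 2" by (rule tendsto_unique[OF _ \<phi>(3) Lim_transform_eventually[OF \<psi>(3) r(1)]]) simp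
  ultimately show "x = x'" "y = y'" by (simp_all add: vec_eq_iff forall_2)
qed

lemma continuous_rep_add:
  "continuous_rep \<Phi> \<phi> \<Longrightarrow> continuous_rep \<Psi> \<psi> \<Longrightarrow> continuous_rep (\<Phi> + \<Psi>) (\<lambda>x. \<phi> x + \<psi> x)"
  by (auto simp: continuous_rep_def spinor_add sq_integrable_add intro!: continuous_intros)

lemma continuous_rep_scale:
  "continuous_rep \<Phi> \<phi> \<Longrightarrow> continuous_rep (c *\<^sub>C \<Phi>) (\<lambda>x. c *s \<phi> x)"
  unfolding continuous_rep_def
  by (intro conjI) (auto simp: spinor_cscale sq_integrable_csmult,
    auto simp: vector_scalar_mult_def intro!: continuous_intros)

lemma weighted_add:
  "weighted1 M (\<lambda>x. \<phi> x + \<psi> x) = (\<lambda>x. weighted1 M \<phi> x + weighted1 M \<psi> x)"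
  "weighted2 M (\<lambda>x. \<phi> x + \<psi> x) = (\<lambda>x. weighted2 M \<phi> x + weighted2 M \<psi> x)"
  by (auto simp: weighted1_def weighted2_def algebra_simps)

lemma weighted_scale:
  "weighted1 M (\<lambda>x. c *s \<phi> x) = (\<lambda>x. c * weighted1 M \<phi> x)"
  "weighted2 M (\<lambda>x. c *s \<phi> x) = (\<lambda>x. c * weighted2 M \<phi> x)"
  by (auto simp: weighted1_def weighted2_def algebra_simps)

lemma boundary_data_add:
  assumes "boundary_data M \<Phi> x y" "boundary_data M \<Phi>' x' y'"
  shows "boundary_data M (\<Phi> + \<Phi>') (x + x') (y + y')"
proof -
  obtain \<phi> where \<phi>: "continuous_rep \<Phi> \<phi>"
     "(weighted1 M \<phi> \<longlongrightarrow> y $ 1) (at_left (pi / 2))" "(weighted1 M \<phi> \<longlongrightarrow> - y $ 2) (at_right (-(pi / 2)))"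
     "(weighted2 M \<phi> \<longlongrightarrow> x $ 1) (at_left (pi / 2))" "(weighted2 M \<phi> \<longlongrightarrow> x $ 2) (at_right (-(pi / 2)))"
    using assms(1) unfolding boundary_data_def by blast
  obtain \<psi> where \<psi>: "continuous_rep \<Phi>' \<psi>"
     "(weighted1 M \<psi> \<longlongrightarrow> y' $ 1) (at_left (pi / 2))" "(weighted1 M \<psi> \<longlongrightarrow> - y' $ 2) (at_right (-(pi / 2)))"
     "(weighted2 M \<psi> \<longlongrightarrow> x' $ 1) (at_left (pi / 2))" "(weighted2 M \<psi> \<longlongrightarrow> x' $ 2) (at_right (-(pi / 2)))"
    using assms(2) unfolding boundary_data_def by blast
  have "- (y + y') $ 2 = - y $ 2 + - y' $ 2" by simp
  then show ?thesis
    unfolding boundary_data_def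
    using continuous_rep_add[OF \<phi>(1) \<psi>(1)] tendsto_add[OF \<phi>(2) \<psi>(2)] tendsto_add[OF \<phi>(3) \<psi>(3)]
      tendsto_add[OF \<phi>(4) \<psi>(4)] tendsto_add[OF \<phi>(5) \<psi>(5)]
    by (intro exI[of _ "\<lambda>x. \<phi> x + \<psi> x"]) (simp only: weighted_add vector_add_component)
qed

lemma boundary_data_scale:
  assumes "boundary_data M \<Phi> x y"
  shows "boundary_data M (c *\<^sub>C \<Phi>) (c *s x) (c *s y)"
proof -
  obtain \<phi> where \<phi>: "continuous_rep \<Phi> \<phi>"
     "(weighted1 M \<phi> \<longlongrightarrow> y $ 1) (at_left (pi / 2))" "(weighted1 M \<phi> \<longlongrightarrow> - y $ 2) (at_right (-(pi / 2)))"
     "(weighted2 M \<phi> \<longlongrightarrow> x $ 1) (at_left (pi / 2))" "(weighted2 M \<phi> \<longlongrightarrow> x $ 2) (at_right (-(pi / 2)))"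
    using assms(1) unfolding boundary_data_def by blast
  have "- (c *s y) $ 2 = c * (- y $ 2)" by simp
  then show ?thesis
    unfolding boundary_data_def
    using continuous_rep_scale[OF \<phi>(1), of c] \<phi>(2-)[THEN tendsto_mult_left, of c]
    by (intro exI[of _ "\<lambda>x. c *s \<phi> x"]) (simp only: weighted_scale vector_smult_component)
qed

lemma boundary_data_test_functions:
  assumes \<phi>: "\<phi> \<in> test_functions" shows "boundary_data M (spinor \<phi>) 0 0"
proof -
  have rep: "continuous_rep (spinor \<phi>) \<phi>"
    using test_functions_sq_integrable[OF \<phi>] test_functions_continuous[OF \<phi>]
    by (auto simp: continuous_rep_def intro: continuous_on_subset)
  obtain a b where ab: "-(pi/2) < a" "b < pi/2" "\<And>x. x \<notin> {a..b} \<Longrightarrow> \<phi> x = 0"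
  proof -
    let ?K = "closure {\<rho>. \<phi> \<rho> \<noteq> 0}"
    have "compact ?K" "?K \<subseteq> I0" using \<phi> by (simp_all add: test_functions_def)
    then obtain a b where ab: "-(pi/2) < a" "b < pi/2" "?K \<subseteq> {a..b}" by (rule compact_subset_I0)
    have "\<phi> x = 0" if "x \<notin> {a..b}" for x
    proof -
      have "x \<notin> ?K" using that ab(3) by (rule contra_subsetD[rotated])
      then have "x \<notin> {\<rho>. \<phi> \<rho> \<noteq> 0}" by (rule contra_subsetD[OF closure_subset])
      then show ?thesis by simp
    qed
    from that[OF ab(1,2) this] show ?thesis .
  qed
  have l: "\<forall>\<^sub>F x in at_left (pi/2). \<phi> x = 0"
    using eventually_at_left_real[OF ab(2)] by eventually_elim (simp add: ab(3))
  have r: "\<forall>\<^sub>F x in at_right (-(pi/2)). \<phi> x = 0"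
    using eventually_at_right_real[OF ab(1)] by eventually_elim (simp add: ab(3))
  have "(weighted1 M \<phi> \<longlongrightarrow> 0) F" "(weighted2 M \<phi> \<longlongrightarrow> 0) F" if "\<forall>\<^sub>F x in F. \<phi> x = 0" for F
    using that by (auto intro!: tendsto_eventually elim!: eventually_mono simp: weighted1_def weighted2_def)
  with rep l r show ?thesis by (auto simp: boundary_data_def)
qed

lemma limits_of_continuous:
  assumes "continuous_on {-(pi/2)..pi/2} W" "\<And>x. x \<in> I0 \<Longrightarrow> w x = W x"
  shows "(w \<longlongrightarrow> W (pi/2)) (at_left (pi/2))" "(w \<longlongrightarrow> W (-(pi/2))) (at_right (-(pi/2)))"
proof -
  have *: "\<forall>\<^sub>F x in F. W x = w x" if "\<forall>\<^sub>F x in F. x \<in> I0" for F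
    using that by (rule eventually_mono) (rule assms(2)[symmetric])
  show "(w \<longlongrightarrow> W (pi/2)) (at_left (pi/2))"
    by (rule Lim_transform_eventually[OF continuous_on_Icc_at_leftD[OF assms(1)] *[OF eventually_I0_left]]) simp
  show "(w \<longlongrightarrow> W (-(pi/2))) (at_right (-(pi/2)))"
    by (rule Lim_transform_eventually[OF continuous_on_Icc_at_rightD[OF assms(1)] *[OF eventually_I0_right]]) simp
qed

text \<open>The weights cancel on \<open>I0\<close>, leaving a constant plus a primitive in each
  component. Such functions are continuous on the closed interval, so the limits exist and can be
  read off.\<close>

lemma boundary_data_dsol:
  assumes M: "\<bar>M\<bar> < 1/2" and g: "sq_integrable g"
  shows "boundary_data M (spinor (dsol M c d g))
    (vector [d + prim (flux M (\<lambda>t. g t $ 1)) (pi/2), d])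
    (vector [c + prim (flux (-M) (\<lambda>t. - g t $ 2)) (pi/2), - c])"
proof -
  let ?a = "flux (-M) (\<lambda>t. - g t $ 2)" and ?b = "flux M (\<lambda>t. g t $ 1)"
  have i: "integrable \<mu> ?a" "integrable \<mu> ?b"
    using g M by (auto intro!: integrable_flux simp: sq_integrable_iff_sqi sqi_minus_iff)
  have cont: "continuous_on {-(pi/2)..pi/2} (\<lambda>x. c + prim ?a x)" "continuous_on {-(pi/2)..pi/2} (\<lambda>x. d + prim ?b x)"
    by (intro continuous_intros prim_continuous i)+
  have w1: "weighted1 M (dsol M c d g) x = c + prim ?a x" if "x \<in> I0" for x
    using \<sigma>_powr_cancel(2)[OF that, of M] by (simp add: weighted1_def dsol_def sol_def)
  have w2: "weighted2 M (dsol M c d g) x = d + prim ?b x" if "x \<in> I0" for x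
    using \<sigma>_powr_cancel(1)[OF that, of M] by (simp add: weighted2_def dsol_def sol_def)
  have sc: "continuous_on I0 (\<lambda>x. complex_of_real (\<sigma> x powr a))" for a
    by (intro continuous_on_of_real \<sigma>_powr_continuous)
  have "continuous_on I0 (\<lambda>x. dsol M c d g x $ 1)"
    unfolding dsol_def sol_def by (auto intro!: continuous_intros sc continuous_on_subset[OF prim_continuous[OF i(1)]])
  moreover have "continuous_on I0 (\<lambda>x. dsol M c d g x $ 2)"
    unfolding dsol_def sol_def by (auto intro!: continuous_intros sc continuous_on_subset[OF prim_continuous[OF i(2)]])
  ultimately have "continuous_on I0 (\<lambda>x. dsol M c d g x $ i)" for i
    using exhaust_2[of i] by auto
  then have "continuous_on I0 (dsol M c d g)"
    using continuous_on_vec_lambda[of I0 "\<lambda>i x. dsol M c d g x $ i"] by simp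
  then have "continuous_rep (spinor (dsol M c d g)) (dsol M c d g)"
    using dsol_sq_integrable[OF M g] by (simp add: continuous_rep_def)
  then show ?thesis
    using limits_of_continuous[OF cont(1) w1] limits_of_continuous[OF cont(2) w2]
    unfolding boundary_data_def by (intro exI[of _ "dsol M c d g"]) (simp add: prim_left)
qed

lemma prim_flux_surj:
  assumes "\<bar>N\<bar> < 1/2" obtains v where "sqi v" "prim (flux N v) (pi/2) = p"
proof
  \<comment> \<open>Chosen so that the flux is the constant \<open>p / pi\<close> on an interval of
    length \<open>pi\<close>.\<close>
  let ?v = "\<lambda>x. (- p / of_real pi) * of_real (\<sigma> x powr - N)"
  show "sqi ?v" using assms by (intro sqi_cmult sqi_\<sigma>_powr) simp
  have "prim (flux N ?v) (pi/2) = (LINT x|\<mu>. p / of_real pi)"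
    unfolding prim_right
  proof (rule Bochner_Integration.integral_cong[OF refl])
    fix x assume "x \<in> space \<mu>"
    then have "x \<in> I0" by simp
    from \<sigma>_powr_cancel(1)[OF this, of N "- p / of_real pi"]
    show "flux N ?v x = p / of_real pi" by (simp add: flux_def mult_ac)
  qed
  also have "\<dots> = p" by (simp add: measure_restrict_space scaleR_conv_of_real)
  finally show "prim (flux N ?v) (pi/2) = p" .
qed

section \<open>Operators between the Dirac operator and its adjoint\<close>

context
  fixes M :: real
  assumes M: "\<bar>M\<bar> < 1/2"
begin

abbreviation dirac_adj :: operator where "dirac_adj \<equiv> op_adjoint (dirac M)"

lemma adjoint_boundary_data:
  assumes "dirac_adj \<Phi> = Some \<Psi>" obtains x y where "boundary_data M \<Phi> x y"
  using assms boundary_data_dsol[OF M] unfolding op_adjoint_dirac_iff is_adjoint_value_dirac_iff[OF M] by blast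

text \<open>The left-end values are free parameters of \<open>dsol\<close>, and the two components
  of the image independently control the increments across the interval.\<close>

lemma adjoint_boundary_data_surj:
  obtains \<Phi> \<Psi> where "dirac_adj \<Phi> = Some \<Psi>" "boundary_data M \<Phi> x y"
proof -
  \<comment> \<open>The increments to realize are \<open>x $ 1 - x $ 2\<close> for the second
    weighted component and, because \<open>y\<close> holds the left value negated,
    \<open>y $ 1 + y $ 2\<close> for the first.\<close>
  obtain v where v: "sqi v" "prim (flux M v) (pi/2) = x $ 1 - x $ 2" using prim_flux_surj[OF M] .
  have "\<bar>- M\<bar> < 1/2" using M by simp
  then obtain w where w: "sqi w" "prim (flux (-M) w) (pi/2) = y $ 1 + y $ 2" using prim_flux_surj by blast
  define g where "g t = (vector [v t, - w t] :: complex ^ 2)" for t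
  have g: "sq_integrable g" using v w by (simp add: sq_integrable_iff_sqi g_def sqi_minus_iff)
  have "vector [x $ 2 + (x $ 1 - x $ 2), x $ 2] = x" "vector [- y $ 2 + (y $ 1 + y $ 2), - (- y $ 2)] = y"
    by (simp_all add: vec_eq_iff forall_2)
  then have "boundary_data M (spinor (dsol M (- y $ 2) (x $ 2) g)) x y"
    using boundary_data_dsol[OF M g, of "- y $ 2" "x $ 2"] v w by (simp add: g_def)
  moreover have "dirac_adj (spinor (dsol M (- y $ 2) (x $ 2) g)) = Some (spinor g)"
    unfolding op_adjoint_dirac_iff is_adjoint_value_dirac_iff[OF M] using g by blast
  ultimately show ?thesis using that by blast
qed

lemma green_identity:
  assumes "dirac_adj \<Phi> = Some \<Psi>" "dirac_adj \<Phi>' = Some \<Psi>'" "boundary_data M \<Phi> x y" "boundary_data M \<Phi>' x' y'"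
  shows "cinner \<Phi> \<Psi>' - cinner \<Psi> \<Phi>' = hdot x y' - hdot y x'"
proof -
  obtain c d g where g: "sq_integrable g" "\<Psi> = spinor g" "\<Phi> = spinor (dsol M c d g)"
    using assms(1) unfolding op_adjoint_dirac_iff is_adjoint_value_dirac_iff[OF M] by blast
  obtain c' d' g' where g': "sq_integrable g'" "\<Psi>' = spinor g'" "\<Phi>' = spinor (dsol M c' d' g')"
    using assms(2) unfolding op_adjoint_dirac_iff is_adjoint_value_dirac_iff[OF M] by blast
  define a b where "a = flux (-M) (\<lambda>t. - g t $ 2)" and "b = flux M (\<lambda>t. g t $ 1)"
  define a' b' where "a' = flux (-M) (\<lambda>t. - g' t $ 2)" and "b' = flux M (\<lambda>t. g' t $ 1)"
  have x: "x = vector [d + prim b (pi/2), d]" "y = vector [c + prim a (pi/2), - c]"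
    using boundary_data_unique[OF assms(3)[unfolded g] boundary_data_dsol[OF M g(1)]] by (simp_all add: a_def b_def)
  have x': "x' = vector [d' + prim b' (pi/2), d']" "y' = vector [c' + prim a' (pi/2), - c']"
    using boundary_data_unique[OF assms(4)[unfolded g'] boundary_data_dsol[OF M g'(1)]] by (simp_all add: a'_def b'_def)
  have i: "integrable \<mu> a" "integrable \<mu> b" "integrable \<mu> a'" "integrable \<mu> b'"
    using g(1) g'(1) M by (auto intro!: integrable_flux simp: a_def b_def a'_def b'_def sq_integrable_iff_sqi sqi_minus_iff)
  let ?ca = "\<lambda>t. cnj (a t)" and ?cb = "\<lambda>t. cnj (b t)"
  have ci: "integrable \<mu> ?ca" "integrable \<mu> ?cb" using i by (auto intro: integrable_cnj)
  \<comment> \<open>\<open>P\<close> is the derivative of the conjugated first weighted component of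
    \<open>\<Phi>\<close> times the second one of \<open>\<Phi>'\<close>; \<open>Q\<close> is the
    same with the components exchanged. The sign built into \<open>y\<close> and \<open>y'\<close>
    accounts for the lower limit of integration.\<close>
  define P where "P x = (cnj c + prim ?ca x) * b' x + ?ca x * (d' + prim b' x)" for x
  define Q where "Q x = (cnj d + prim ?cb x) * a' x + ?cb x * (c' + prim a' x)" for x
  have P: "integrable \<mu> P" and Q: "integrable \<mu> Q"
    unfolding P_def[abs_def] Q_def[abs_def] distrib_left distrib_right
    using integrable_prim_mult[OF ci(1) i(4)] integrable_prim_mult[OF i(4) ci(1)]
      integrable_prim_mult[OF ci(2) i(3)] integrable_prim_mult[OF i(3) ci(2)] i ci
    by (auto simp: mult.commute)
  note sqi = dsol_sq_integrable[OF M g(1), of c d] dsol_sq_integrable[OF M g'(1), of c' d']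
  have "cinner \<Phi> \<Psi>' - cinner \<Psi> \<Phi>' = (LINT x|\<mu>. hdot (dsol M c d g x) (g' x)) - (LINT x|\<mu>. hdot (g x) (dsol M c' d' g' x))"
    unfolding g g' by (simp only: cinner_spinor g(1) g'(1) sqi)
  also have "\<dots> = (LINT x|\<mu>. hdot (dsol M c d g x) (g' x) - hdot (g x) (dsol M c' d' g' x))"
    by (rule Bochner_Integration.integral_diff[symmetric]) (intro integrable_hdot g(1) g'(1) sqi)+
  also have "\<dots> = (LINT x|\<mu>. Q x - P x)"
    by (simp add: hdot_def sum_2 dsol_def sol_def P_def Q_def a_def b_def a'_def b'_def cnj_prim)
      (simp add: flux_def algebra_simps)
  also have "\<dots> = (LINT x|\<mu>. Q x) - (LINT x|\<mu>. P x)"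
    by (rule Bochner_Integration.integral_diff[OF Q P])
  also have "\<dots> = hdot x y' - hdot y x'"
    unfolding P_def Q_def by_parts[OF ci(1) i(4)] by_parts[OF ci(2) i(3)]
    by (simp add: x x' hdot_def sum_2 cnj_prim algebra_simps)
  finally show ?thesis .
qed

lemma adjoint_extends_dirac: "dirac M \<subseteq>\<^sub>m dirac_adj"
proof (unfold map_le_def, intro ballI)
  fix \<Phi> assume "\<Phi> \<in> dom (dirac M)"
  then obtain \<phi> where \<phi>: "\<phi> \<in> test_functions" "\<Phi> = spinor \<phi>" by (auto simp: dom_dirac)
  \<comment> \<open>Since \<open>\<sigma>^N u\<close> is itself a test function, it is the primitive
    of its own derivative, with left-end value 0; so \<open>u\<close> is a \<open>sol\<close> with
    \<open>c = 0\<close>.\<close>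
  have *: "weak N u (\<lambda>x. - dirac1 (-N) u x)" if N: "\<bar>N\<bar> < 1/2" and u: "u \<in> test_fun" for N u
  proof -
    have s: "sqi u" "sqi (\<lambda>x. - dirac1 (-N) u x)"
      using u by (auto simp: sqi_minus_iff test_fun_sqi sqi_dirac1)
    let ?\<eta> = "\<lambda>x. of_real (\<sigma> x powr N) * u x"
    have \<eta>: "?\<eta> \<in> test_fun" by (rule test_fun_\<sigma>_powr[OF u])
    have fl: "flux N (\<lambda>x. - dirac1 (-N) u x) x = vector_derivative ?\<eta> (at x)" if "x \<in> I0" for x
      using dirac1_eq[OF u that, of "-N"] \<sigma>_powr_cancel(1)[OF that, of N] by (simp add: flux_def)
    have "prim (flux N (\<lambda>x. - dirac1 (-N) u x)) x = ?\<eta> x" if "x \<in> I0" for x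
    proof -
      have "prim (flux N (\<lambda>x. - dirac1 (-N) u x)) x = prim (\<lambda>x. vector_derivative ?\<eta> (at x)) x"
        unfolding prim_def by (rule Bochner_Integration.integral_cong) (auto simp: fl)
      then show ?thesis using that by (simp add: test_fun_prim[OF \<eta>])
    qed
    then have "u x = sol N 0 (\<lambda>x. - dirac1 (-N) u x) x" if "x \<in> I0" for x
      using \<sigma>_powr_cancel(2)[OF that, of N] that by (simp add: sol_def)
    then have "AE x in \<mu>. u x = sol N 0 (\<lambda>x. - dirac1 (-N) u x) x" by (intro AE_I2) simp
    then show ?thesis unfolding weak_iff[OF N s] by blast
  qed
  have t: "(\<lambda>x. \<phi> x $ 1) \<in> test_fun" "(\<lambda>x. \<phi> x $ 2) \<in> test_fun"
    using \<phi> by (auto simp: test_functions_iff)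
  have "dirac_expr M \<phi> x $ 1 = - dirac1 (-M) (\<lambda>x. \<phi> x $ 2) x" "dirac_expr M \<phi> x $ 2 = dirac1 M (\<lambda>x. \<phi> x $ 1) x" for x
    by (simp_all add: dirac_expr_def Let_def dirac1_def vector_derivative_nth[OF \<phi>(1)])
  then have "is_adjoint_value (dirac M) (spinor \<phi>) (spinor (dirac_expr M \<phi>))"
    unfolding is_adjoint_value_iff_weak[OF test_functions_sq_integrable[OF \<phi>(1)] dirac_expr_sq_integrable[OF \<phi>(1)]]
    using *[OF _ t(1), of "-M"] *[OF M t(2)] M by simp
  then show "dirac M \<Phi> = dirac_adj \<Phi>"
    using \<phi> by (simp add: dirac_abs flip: op_adjoint_dirac_iff)
qed

definition traces :: "operator \<Rightarrow> complex ^ 2 \<Rightarrow> complex ^ 2 \<Rightarrow> bool" where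
  "traces T x y \<longleftrightarrow> (\<exists>\<Phi>\<in>dom T. boundary_data M \<Phi> x y)"

text \<open>Passing from \<open>dirac M\<close> to \<open>T\<close> only adds conditions on adjoint
  values, so \<open>\<Phi>\<close> lies in the domain of the full adjoint. There Green's identity
  turns each remaining condition into one on boundary vectors.\<close>

lemma op_adjoint_between:
  assumes T: "dirac M \<subseteq>\<^sub>m T" "T \<subseteq>\<^sub>m dirac_adj"
  shows "op_adjoint T \<Phi> = Some \<Psi> \<longleftrightarrow> dirac_adj \<Phi> = Some \<Psi> \<and>
    (\<exists>x y. boundary_data M \<Phi> x y \<and> (\<forall>x' y'. traces T x' y' \<longrightarrow> hdot x y' = hdot y x'))"
proof -
  have TA: "dirac_adj \<xi> = T \<xi>" if "\<xi> \<in> dom T" for \<xi>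
    using T(2) that by (simp add: map_le_def)
  have dense: "spinor ` test_functions \<subseteq> dom T"
    using map_le_implies_dom_le[OF T(1)] by (simp add: dom_dirac)
  have green: "cinner \<Phi> (the (T \<xi>)) = cinner \<Psi> \<xi> \<longleftrightarrow> hdot x y' = hdot y x'"
    if "dirac_adj \<Phi> = Some \<Psi>" "boundary_data M \<Phi> x y" "\<xi> \<in> dom T" "boundary_data M \<xi> x' y'" for x y x' y' \<xi>
  proof -
    obtain \<Xi> where "T \<xi> = Some \<Xi>" using \<open>\<xi> \<in> dom T\<close> by auto
    then have "dirac_adj \<xi> = Some \<Xi>" using TA that by auto
    from green_identity[OF that(1) this that(2,4)] \<open>T \<xi> = Some \<Xi>\<close> show ?thesis
      by (metis eq_iff_diff_eq_0 option.sel)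
  qed
  show ?thesis
    unfolding op_adjoint_eq_Some_iff[OF dense]
  proof
    assume adj: "is_adjoint_value T \<Phi> \<Psi>"
    then have "is_adjoint_value (dirac M) \<Phi> \<Psi>"
      using T(1) unfolding is_adjoint_value_def map_le_def by (metis domIff)
    then have A: "dirac_adj \<Phi> = Some \<Psi>" by (simp add: op_adjoint_dirac_iff)
    then obtain x y where xy: "boundary_data M \<Phi> x y" by (rule adjoint_boundary_data)
    have "hdot x y' = hdot y x'" if t: "traces T x' y'" for x' y'
    proof -
      obtain \<xi> where "\<xi> \<in> dom T" "boundary_data M \<xi> x' y'"
        using t unfolding traces_def by blast
      then show ?thesis using green[OF A xy] adj by (auto simp: is_adjoint_value_def)
    qed
    with A xy show "dirac_adj \<Phi> = Some \<Psi> \<and> (\<exists>x y. boundary_data M \<Phi> x y \<and> (\<forall>x' y'. traces T x' y' \<longrightarrow> hdot x y' = hdot y x'))"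
      by blast
  next
    assume "dirac_adj \<Phi> = Some \<Psi> \<and> (\<exists>x y. boundary_data M \<Phi> x y \<and> (\<forall>x' y'. traces T x' y' \<longrightarrow> hdot x y' = hdot y x'))"
    then obtain x y where *: "dirac_adj \<Phi> = Some \<Psi>" "boundary_data M \<Phi> x y" "\<And>x' y'. traces T x' y' \<Longrightarrow> hdot x y' = hdot y x'"
      by blast
    show "is_adjoint_value T \<Phi> \<Psi>"
      unfolding is_adjoint_value_def
    proof
      fix \<xi> assume \<xi>: "\<xi> \<in> dom T"
      then obtain \<Xi> where "dirac_adj \<xi> = Some \<Xi>" using TA by auto
      then obtain x' y' where b: "boundary_data M \<xi> x' y'" by (rule adjoint_boundary_data)
      then have "traces T x' y'" using \<xi> by (auto simp: traces_def)
      then show "cinner \<Phi> (the (T \<xi>)) = cinner \<Psi> \<xi>" using green[OF *(1,2) \<xi> b] *(3) by blast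
    qed
  qed
qed

lemma dirac_ext_eq_Some_iff:
  "dirac_ext M U \<Phi> = Some \<Psi> \<longleftrightarrow> dirac_adj \<Phi> = Some \<Psi> \<and> (\<exists>x y. boundary_data M \<Phi> x y \<and> cayley_graph U x y)"
  by (auto simp: dirac_ext_def restrict_map_def boundary_condition_iff)

lemma dirac_ext_between: "dirac M \<subseteq>\<^sub>m dirac_ext M U" "dirac_ext M U \<subseteq>\<^sub>m dirac_adj"
proof -
  show "dirac_ext M U \<subseteq>\<^sub>m dirac_adj" by (auto simp: map_le_def dirac_ext_eq_Some_iff)
  show "dirac M \<subseteq>\<^sub>m dirac_ext M U"
  proof (unfold map_le_def, intro ballI)
    fix \<Phi> assume d: "\<Phi> \<in> dom (dirac M)"
    then obtain \<phi> where \<phi>: "\<phi> \<in> test_functions" "\<Phi> = spinor \<phi>" by (auto simp: dom_dirac)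
    obtain \<Psi> where \<Psi>: "dirac M \<Phi> = Some \<Psi>" using d by auto
    then have "dirac_adj \<Phi> = Some \<Psi>" using adjoint_extends_dirac d by (auto simp: map_le_def)
    moreover have "cayley_graph U 0 0" by (simp add: cayley_graph_def)
    ultimately show "dirac M \<Phi> = dirac_ext M U \<Phi>"
      using boundary_data_test_functions[OF \<phi>(1), of M] \<phi>(2) \<Psi> dirac_ext_eq_Some_iff[of U \<Phi> \<Psi>] by metis
  qed
qed

text \<open>One inclusion needs uniqueness of boundary data, the other that every pair
  \<open>x\<close>, \<open>y\<close> is attained on the domain of the adjoint.\<close>

lemma traces_dirac_ext: "traces (dirac_ext M U) x y \<longleftrightarrow> cayley_graph U x y"
proof
  assume "traces (dirac_ext M U) x y"
  then show "cayley_graph U x y"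
    unfolding traces_def dom_def by (auto simp: dirac_ext_eq_Some_iff dest: boundary_data_unique)
next
  assume c: "cayley_graph U x y"
  obtain \<Phi> \<Psi> where "dirac_adj \<Phi> = Some \<Psi>" "boundary_data M \<Phi> x y" by (rule adjoint_boundary_data_surj)
  with c have "dirac_ext M U \<Phi> = Some \<Psi>" by (auto simp: dirac_ext_eq_Some_iff)
  with \<open>boundary_data M \<Phi> x y\<close> show "traces (dirac_ext M U) x y" by (auto simp: traces_def)
qed

lemma linear_dirac_ext: "linear_operator (dirac_ext M U)"
  unfolding linear_operator_def
proof (intro conjI allI impI)
  have "(\<lambda>_. 0) \<in> test_functions" using test_fun_0 by (simp add: test_functions_iff)
  then have "boundary_data M 0 0 0"
    using boundary_data_test_functions[of "\<lambda>_. 0" M] by (simp add: zero_spinorL2_def)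
  moreover have "dirac_adj 0 = Some 0"
    unfolding op_adjoint_dirac_iff is_adjoint_value_def using cinner_diff_left[of 0 0] by simp
  moreover have "cayley_graph U 0 0" by (simp add: cayley_graph_def)
  ultimately show "dirac_ext M U 0 = Some 0" unfolding dirac_ext_eq_Some_iff by blast
next
  fix \<Phi> \<Psi> \<Phi>' \<Psi>' assume *: "dirac_ext M U \<Phi> = Some \<Phi>'" "dirac_ext M U \<Psi> = Some \<Psi>'"
  obtain x y where 1: "dirac_adj \<Phi> = Some \<Phi>'" "boundary_data M \<Phi> x y" "cayley_graph U x y"
    using *(1) unfolding dirac_ext_eq_Some_iff by blast
  obtain x' y' where 2: "dirac_adj \<Psi> = Some \<Psi>'" "boundary_data M \<Psi> x' y'" "cayley_graph U x' y'"
    using *(2) unfolding dirac_ext_eq_Some_iff by blast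
  have "dirac_adj (\<Phi> + \<Psi>) = Some (\<Phi>' + \<Psi>')"
    using 1(1) 2(1) unfolding op_adjoint_dirac_iff by (rule is_adjoint_value_add)
  moreover have "cayley_graph U (x + x') (y + y')"
  proof -
    have "x + x' - \<i> *s (y + y') = (x - \<i> *s y) + (x' - \<i> *s y')"
      by (simp add: vec.scale_right_distrib)
    also have "\<dots> = U *v ((x + \<i> *s y) + (x' + \<i> *s y'))"
      using 1(3) 2(3) unfolding cayley_graph_def by (simp only: matrix_vector_right_distrib)
    also have "(x + \<i> *s y) + (x' + \<i> *s y') = x + x' + \<i> *s (y + y')"
      by (simp add: vec.scale_right_distrib add_ac)
    finally show ?thesis unfolding cayley_graph_def .
  qed
  ultimately show "dirac_ext M U (\<Phi> + \<Psi>) = Some (\<Phi>' + \<Psi>')"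
    using boundary_data_add[OF 1(2) 2(2)] unfolding dirac_ext_eq_Some_iff by blast
next
  fix c \<Phi> \<Phi>' assume *: "dirac_ext M U \<Phi> = Some \<Phi>'"
  obtain x y where 1: "dirac_adj \<Phi> = Some \<Phi>'" "boundary_data M \<Phi> x y" "cayley_graph U x y"
    using * unfolding dirac_ext_eq_Some_iff by blast
  have "dirac_adj (c *\<^sub>C \<Phi>) = Some (c *\<^sub>C \<Phi>')"
    using 1(1) unfolding op_adjoint_dirac_iff by (rule is_adjoint_value_scale)
  moreover have "cayley_graph U (c *s x) (c *s y)"
  proof -
    have e: "c *s x + \<i> *s (c *s y) = c *s (x + \<i> *s y)" "c *s x - \<i> *s (c *s y) = c *s (x - \<i> *s y)"
      by (simp_all add: vec.scale_right_distrib vec.scale_right_diff_distrib mult.commute)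
    show ?thesis
      unfolding cayley_graph_def e vector_scalar_commute 1(3)[unfolded cayley_graph_def] ..
  qed
  ultimately show "dirac_ext M U (c *\<^sub>C \<Phi>) = Some (c *\<^sub>C \<Phi>')"
    using boundary_data_scale[OF 1(2)] unfolding dirac_ext_eq_Some_iff by blast
qed

lemma densely_defined_extension: "dirac M \<subseteq>\<^sub>m T \<Longrightarrow> densely_defined T"
  using closure_mono[OF map_le_implies_dom_le[of "dirac M" T]]
  by (auto simp: densely_defined_def dom_dirac test_functions_dense)

lemma map_eqI_Some: "(\<And>\<Phi> \<Psi>. S \<Phi> = Some \<Psi> \<longleftrightarrow> T \<Phi> = Some \<Psi>) \<Longrightarrow> S = T"
  by (rule ext) (metis not_None_eq)

text \<open>The adjoint is cut out by the complement of the traces, and the Cayley graph of a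
  unitary matrix is its own complement.\<close>

lemma self_adjoint_dirac_ext:
  assumes "unitary U" shows "self_adjoint (dirac_ext M U)"
proof -
  have "op_adjoint (dirac_ext M U) = dirac_ext M U"
    by (rule map_eqI_Some)
      (simp only: op_adjoint_between[OF dirac_ext_between] traces_dirac_ext
        cayley_graph_maximal[OF assms, symmetric] dirac_ext_eq_Some_iff)
  then show ?thesis
    by (simp add: self_adjoint_def linear_dirac_ext densely_defined_extension dirac_ext_between)
qed

text \<open>Every \<open>a\<close> has the form \<open>x + \<i> *s y\<close> for a pair in the
  Cayley graph of \<open>U\<close>; that pair is also a trace of the extension for \<open>V\<close>,
  and there \<open>x - \<i> *s y\<close> is both \<open>U *v a\<close> and
  \<open>V *v a\<close>.\<close>

lemma dirac_ext_inj:
  assumes "dirac_ext M U = dirac_ext M V" shows "U = V"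
proof -
  have "U *v a = V *v a" for a
  proof -
    obtain x y where "x + \<i> *s y = a" "x - \<i> *s y = U *v a" by (rule cayley_inverse)
    moreover from this have "cayley_graph V x y"
      using assms traces_dirac_ext[of U x y] traces_dirac_ext[of V x y] by (simp add: cayley_graph_def)
    ultimately show ?thesis by (simp add: cayley_graph_def)
  qed
  then show ?thesis by (simp add: matrix_eq)
qed

text \<open>Taking adjoints reverses inclusion, so a self-adjoint \<open>T\<close> above
  \<open>dirac M\<close> lies below its adjoint. Then \<open>T\<close> is determined by its traces,
  which form a self-complementary subspace and so a Cayley graph.\<close>

lemma dirac_ext_surj:
  assumes T: "self_adjoint T" "dirac M \<subseteq>\<^sub>m T"
  obtains U where "unitary U" "T = dirac_ext M U"
proof -
  have lin: "linear_operator T" and adj: "op_adjoint T = T" using T(1) by (auto simp: self_adjoint_def)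
  have dense: "spinor ` test_functions \<subseteq> dom T"
    using map_le_implies_dom_le[OF T(2)] by (simp add: dom_dirac)
  have TA: "T \<subseteq>\<^sub>m dirac_adj"
  proof (unfold map_le_def, intro ballI)
    fix \<Phi> assume "\<Phi> \<in> dom T"
    then obtain \<Psi> where \<Psi>: "T \<Phi> = Some \<Psi>" by auto
    then have "is_adjoint_value T \<Phi> \<Psi>" using adj op_adjoint_eq_Some_iff[OF dense] by metis
    then have "is_adjoint_value (dirac M) \<Phi> \<Psi>"
      using T(2) unfolding is_adjoint_value_def map_le_def by (metis domIff)
    then show "T \<Phi> = dirac_adj \<Phi>" using \<Psi> by (simp flip: op_adjoint_dirac_iff)
  qed
  \<comment> \<open>With \<open>op_adjoint T\<close> replaced by \<open>T\<close> this is a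
    fixed-point equation: membership in the domain of \<open>T\<close> is decided by the complement
    of the traces of \<open>T\<close> itself.\<close>
  note iff = op_adjoint_between[OF T(2) TA, unfolded adj]
  obtain U where U: "unitary U" "\<And>x y. traces T x y \<longleftrightarrow> cayley_graph U x y"
  proof (rule maximal_isotropic_imp_cayley_graph[of "traces T"])
    show "traces T (x + x') (y + y')" if "traces T x y" "traces T x' y'" for x y x' y'
      using that lin unfolding traces_def linear_operator_def dom_def by (blast intro: boundary_data_add)
    show "traces T (c *s x) (c *s y)" if "traces T x y" for c x y
      using that lin unfolding traces_def linear_operator_def dom_def by (blast intro: boundary_data_scale)
    show "traces T x y \<longleftrightarrow> (\<forall>x' y'. traces T x' y' \<longrightarrow> hdot x y' = hdot y x')" for x y
    proof
      assume "traces T x y"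
      then obtain \<Phi> \<Psi> where "T \<Phi> = Some \<Psi>" "boundary_data M \<Phi> x y" by (auto simp: traces_def)
      then show "\<forall>x' y'. traces T x' y' \<longrightarrow> hdot x y' = hdot y x'"
        unfolding iff using boundary_data_unique by metis
    next
      assume *: "\<forall>x' y'. traces T x' y' \<longrightarrow> hdot x y' = hdot y x'"
      obtain \<Phi> \<Psi> where "dirac_adj \<Phi> = Some \<Psi>" "boundary_data M \<Phi> x y" by (rule adjoint_boundary_data_surj)
      with * have "T \<Phi> = Some \<Psi>" unfolding iff by blast
      with \<open>boundary_data M \<Phi> x y\<close> show "traces T x y" by (auto simp: traces_def)
    qed
  qed (use that in blast)
  have "T = dirac_ext M U"
    by (rule map_eqI_Some) (simp only: iff U(2) dirac_ext_eq_Some_iff cayley_graph_maximal[OF U(1), symmetric])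
  with U(1) show ?thesis by (rule that)
qed

end

theorem mainTheorem2:
  fixes M :: real
  assumes "0 \<le> M" and "M < 1 / 2"
  shows "(\<forall>U. unitary U \<longrightarrow> self_adjoint (dirac_ext M U) \<and> dirac M \<subseteq>\<^sub>m dirac_ext M U) \<and>
    bij_betw (dirac_ext M) {U. unitary U} {A. self_adjoint A \<and> dirac M \<subseteq>\<^sub>m A}"
proof -
  have M: "\<bar>M\<bar> < 1/2" using assms by simp
  note ext = self_adjoint_dirac_ext[OF M] dirac_ext_between(1)[OF M]
  have "bij_betw (dirac_ext M) {U. unitary U} {A. self_adjoint A \<and> dirac M \<subseteq>\<^sub>m A}"
    unfolding bij_betw_def
  proof
    show "inj_on (dirac_ext M) {U. unitary U}" by (rule inj_onI) (rule dirac_ext_inj[OF M])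
    show "dirac_ext M ` {U. unitary U} = {A. self_adjoint A \<and> dirac M \<subseteq>\<^sub>m A}"
    proof (intro equalityI subsetI)
      fix T assume "T \<in> {A. self_adjoint A \<and> dirac M \<subseteq>\<^sub>m A}"
      then obtain U where "unitary U" "T = dirac_ext M U" using dirac_ext_surj[OF M] by blast
      then show "T \<in> dirac_ext M ` {U. unitary U}" by blast
    qed (use ext in blast)
  qed
  with ext show ?thesis by blast
qed

end
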